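(* Let $G$ be a connected, simply connected semisimple Lie group, and let $\hat Z^G_b(\Gamma;q)$ be the $q$-series attached (as in the context) to a weighted tree $\Gamma$ with weakly negative definite linking matrix and a label $b\in\mathcal B^G(\Gamma)$. Then $\hat Z^G_b$ is invariant under Neumann moves: if $\Gamma$ (top) and $\Gamma'$ (bottom) are weighted trees with weakly negative definite linking matrices related by one of the Neumann moves (1), (2), (3) listed in the context, and if $b\in\mathcal B^G(\Gamma)$ and $b'\in\mathcal B^G(\Gamma')$ correspond under the bijection $\mathcal B^G(\Gamma)\cong\mathcal B^G(\Gamma')$ associated with that move, then $$\hat Z^G_b(\Gamma;q)=\hat Z^G_{b'}(\Gamma';q).$$
   Context: **Lie theory.** $G$ has root system $\Delta$, root lattice $Q$, weight lattice $P$, Weyl group $W$ with length function $l$, positive roots $\Delta^+$, Weyl vector $\rho$ (half-sum of the positive roots). $(\cdot,\cdot)$ is the standard $W$-invariant inner product, normalized by $(\alpha,\alpha)=2$ for short roots. For $\beta\in P$, $x^\beta$ denotes a formal exponential ($x^\beta x^\gamma=x^{\beta+\gamma}$), on which $w\in W$ acts by $w(x^\beta)=x^{w(\beta)}$. (In coordinates $x^\beta=\prod_j x_j^{(\beta,\omega_j)}$ with $\omega_j$ the fundamental weights.) **Weighted trees.** $\Gamma$ is a finite tree with vertex set $V$, each vertex $v$ carrying an integer weight. Its linking matrix ${\rm B}$ is the symmetric $V\times V$ integer matrix whose diagonal entries are the weights and whose off-diagonal entry at $(u,v)$ is $1$ if $u,v$ are joined by an edge and $0$ otherwise. It determines a plumbed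 3-manifold $Y(\Gamma)$ (surgery on the corresponding link of unknots). ${\rm B}$ is called weakly negative definite if it is invertible and ${\rm B}^{-1}$ is negative definite on the subspace spanned by the vertices of degree $\ge 3$. $\sigma$ and $\pi$ denote the signature and the number of positive eigenvalues of ${\rm B}$. ${\rm B}$ acts on $Q^V$ and $(P\otimes\mathbb Q)^V$ in the obvious way, and for $\ell,\ell'\in (P\otimes\mathbb Q)^V$, $(\ell,\ell')=\sum_v(\ell_v,\ell'_v)$. **Labels.** $\mathcal B^G(\Gamma)=(Q^V+\delta)/{\rm B}Q^V$, where $\delta_v=(2-\deg v)\rho$. **Vertex coefficients.** Let $D=\sum_{w\in W}(-1)^{l(w)}x^{w(\rho)}=x^\rho\prod_{\alpha\in\Delta^+}(1-x^{-\alpha})$. For $d\ge 0$ define numbers $n^{(d)}(\mu)$, $\mu\in P$, as follows. If $d\le 2$, $n^{(d)}(\mu)$ is the coefficient of $x^\mu$ in $D^{2-d}$. If $d\ge 3$, let $E=x^{-(d-2)\rho}\prod_{\alpha\in\Delta^+}\big(\sum_{k\ge0}x^{-k\alpha}\big)^{d-2}$ (the expansion of $D^{2-d}$ in one Weyl chamber); then $n^{(d)}(\mu)$ is the coefficient of $x^\mu$ in $\frac1{|W|}\sum_{w\in W}(-1)^{d\,l(w)}w(E)$, the average of the expansions of $D^{2-d}$ over all $|W|$ Weyl chambers. **The series.** For weakly negative definite ${\rm B}$ and $b\in\mathcal B^G(\Gamma)$, $$\hat Z_b^G(\Gamma;q)=(-1)^{|\Delta^+|\pi}\,q^{\frac{3\sigma-\operatorname{Tr}{\rm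 B}}2(\rho,\rho)}\sum_{\ell\in {\rm B}Q^V+b}\Big(\prod_{v\in V}n^{(\deg v)}(\ell_v)\Big)q^{-\frac12(\ell,{\rm B}^{-1}\ell)} .$$ This is a formal series in rational powers of $q$. Equivalently, it is $(-1)^{|\Delta^+|\pi}q^{\frac{3\sigma-\operatorname{Tr}{\rm B}}2(\rho,\rho)}$ times the constant term in all variables $x_v$ (principal value integral over $|x_{vj}|=1$) of $\prod_v\big(\sum_{w}(-1)^{l(w)}x_v^{w(\rho)}\big)^{2-\deg v}\sum_{\ell\in{\rm B}Q^V+b}q^{-\frac12(\ell,{\rm B}^{-1}\ell)}\prod_vx_v^{-\ell_v}$. **Neumann moves** (top tree $\Gamma$, bottom tree $\Gamma'$, $\varepsilon\in\{+1,-1\}$; anything not mentioned is unchanged). (1) $\Gamma'$ contains an edge joining vertices $v_1,v_2$ of weights $m_1,m_2$. $\Gamma$ is obtained by subdividing this edge with a new vertex $v_0$ of weight $\varepsilon$ and changing the weights of $v_1,v_2$ to $m_1+\varepsilon$, $m_2+\varepsilon$. Writing $L\ni v_1$ and $R\ni v_2$ for the vertex sets of the two components obtained by removing the edge, the bijection of labels sends the class of $(\ell'_L,\ell'_R)\in Q^{V'}+\delta'$ to the class of $(\ell'_L,0,-\varepsilon\,\ell'_R)$ (with $0$ at $v_0$). (2) $\Gamma'$ contains a vertex $v_0$ of weight $m$. $\Gamma$ is obtained by changing its weight to $m+\varepsilon$ and attaching to $v_0$ a new leaf $v_1$ of weight $\varepsilon$. The bijection of labels sends the class of $\ell\in Q^V+\delta$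 to the class of $\ell'$ with $\ell'_{v_0}=\ell_{v_0}-\varepsilon\,\ell_{v_1}$ and $\ell'_v=\ell_v$ for all other vertices $v$ of $\Gamma'$. (3) $\Gamma$ contains a vertex $v_0$ of weight $0$ and degree $2$, with neighbours $v_1,v_2$ of weights $m_1,m_2$. $\Gamma'$ is obtained by deleting $v_0$ and merging $v_1,v_2$ into one vertex $v_{12}$ of weight $m_1+m_2$, adjacent to all the other neighbours of $v_1$ and of $v_2$. Let $L\ni v_1$, $R\ni v_2$ be the vertex sets of the components of $\Gamma\setminus\{v_0\}$. Every class in $\mathcal B^G(\Gamma)$ has a representative $\ell$ with $\ell_{v_0}=0$; the bijection of labels sends it to the class of $\ell'$ with $\ell'_{v_{12}}=\ell_{v_1}-\ell_{v_2}$, $\ell'_v=\ell_v$ for $v\in L\setminus\{v_1\}$, and $\ell'_v=-\ell_v$ for $v\in R\setminus\{v_2\}$. *)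

theory Defs
  imports "HOL-Analysis.Analysis" "HOL-Library.Poly_Mapping" "HOL-Library.FuncSet"
begin

section \<open>Root systems\<close>

text \<open>A connected, simply connected semisimple group enters only through its root system, which
  is given here as a finite subset of a Euclidean space, the \<^emph>\<open>W\<close>-invariant inner
  product being the ambient one.  The ambient space is allowed to be larger than the span of the
  roots, so that the trivial group (no roots) is included.\<close>

definition reflect :: "'a::euclidean_space \<Rightarrow> 'a \<Rightarrow> 'a" where
  "reflect \<alpha> x = x - (2 * (x \<bullet> \<alpha>) / (\<alpha> \<bullet> \<alpha>)) *\<^sub>R \<alpha>"

definition root_system :: "'a::euclidean_space set \<Rightarrow> bool" where
  "root_system \<Delta> \<longleftrightarrow>
     finite \<Delta> \<and> 0 \<notin> \<Delta> \<and>
     (\<forall>\<alpha>\<in>\<Delta>. \<forall>\<beta>\<in>\<Delta>. reflect \<alpha> \<beta> \<in> \<Delta>) \<and>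
     (\<forall>\<alpha>\<in>\<Delta>. \<forall>\<beta>\<in>\<Delta>. 2 * (\<beta> \<bullet> \<alpha>) / (\<alpha> \<bullet> \<alpha>) \<in> \<int>) \<and>
     (\<forall>\<alpha>\<in>\<Delta>. \<forall>c. c *\<^sub>R \<alpha> \<in> \<Delta> \<longrightarrow> c = 1 \<or> c = -1)"

definition irred_component :: "'a::euclidean_space set \<Rightarrow> 'a \<Rightarrow> 'a set" where
  "irred_component \<Delta> \<alpha> = {(\<beta>, \<gamma>). \<beta> \<in> \<Delta> \<and> \<gamma> \<in> \<Delta> \<and> \<beta> \<bullet> \<gamma> \<noteq> 0}\<^sup>* `` {\<alpha>}"

text \<open>The short roots are those of minimal length in their irreducible component (all roots of a
  simply laced component are short).\<close>

definition normalized :: "'a::euclidean_space set \<Rightarrow> bool" where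
  "normalized \<Delta> \<longleftrightarrow>
     (\<forall>\<alpha>\<in>\<Delta>. (\<forall>\<beta>\<in>irred_component \<Delta> \<alpha>. \<alpha> \<bullet> \<alpha> \<le> \<beta> \<bullet> \<beta>) \<longrightarrow> \<alpha> \<bullet> \<alpha> = 2)"

definition pos_roots :: "'a::euclidean_space set \<Rightarrow> 'a set \<Rightarrow> 'a set" where
  "pos_roots \<Delta> \<Phi> = {\<alpha>\<in>\<Delta>. \<exists>c::'a \<Rightarrow> nat. \<alpha> = (\<Sum>\<beta>\<in>\<Phi>. real (c \<beta>) *\<^sub>R \<beta>)}"

definition simple_system :: "'a::euclidean_space set \<Rightarrow> 'a set \<Rightarrow> bool" where
  "simple_system \<Delta> \<Phi> \<longleftrightarrow>
     \<Phi> \<subseteq> \<Delta> \<and> independent \<Phi> \<and>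
     (\<forall>\<alpha>\<in>\<Delta>. \<alpha> \<in> pos_roots \<Delta> \<Phi> \<or> - \<alpha> \<in> pos_roots \<Delta> \<Phi>)"

definition root_lattice :: "'a::euclidean_space set \<Rightarrow> 'a set" where
  "root_lattice \<Delta> = range (\<lambda>c::'a \<Rightarrow> int. \<Sum>\<alpha>\<in>\<Delta>. of_int (c \<alpha>) *\<^sub>R \<alpha>)"

definition weyl_vector :: "'a::euclidean_space set \<Rightarrow> 'a set \<Rightarrow> 'a" where
  "weyl_vector \<Delta> \<Phi> = (1/2) *\<^sub>R (\<Sum>\<alpha>\<in>pos_roots \<Delta> \<Phi>. \<alpha>)"

definition reflect_word :: "'a::euclidean_space list \<Rightarrow> 'a \<Rightarrow> 'a" where
  "reflect_word \<alpha>s = foldr (\<lambda>\<alpha> w. reflect \<alpha> \<circ> w) \<alpha>s id"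

definition weyl_group :: "'a::euclidean_space set \<Rightarrow> ('a \<Rightarrow> 'a) set" where
  "weyl_group \<Delta> = reflect_word ` {\<alpha>s. set \<alpha>s \<subseteq> \<Delta>}"

definition weyl_length :: "'a::euclidean_space set \<Rightarrow> ('a \<Rightarrow> 'a) \<Rightarrow> nat" where
  "weyl_length \<Phi> w = (LEAST n. \<exists>\<alpha>s. length \<alpha>s = n \<and> set \<alpha>s \<subseteq> \<Phi> \<and> reflect_word \<alpha>s = w)"


section \<open>Vertex coefficients\<close>

text \<open>A finite combination of formal exponentials is an element of the group ring
  \<^typ>\<open>'a \<Rightarrow>\<^sub>0 rat\<close>, in which \<open>Poly_Mapping.single \<beta> c\<close> stands for \<open>c x\<^sup>\<beta>\<close>; an
  infinite one is the function that assigns to \<open>\<mu>\<close> the coefficient of \<open>x\<^sup>\<mu>\<close>.\<close>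

definition weyl_denom :: "'a::euclidean_space set \<Rightarrow> 'a set \<Rightarrow> ('a \<Rightarrow>\<^sub>0 rat)" where
  "weyl_denom \<Delta> \<Phi> =
     (\<Sum>w\<in>weyl_group \<Delta>. Poly_Mapping.single (w (weyl_vector \<Delta> \<Phi>)) ((-1) ^ weyl_length \<Phi> w))"

text \<open>\<open>\<Sum>\<^sub>k x\<^sup>k\<^sup>\<beta>\<close>, for \<open>\<beta> \<noteq> 0\<close>.\<close>

definition geom_series :: "'a::euclidean_space \<Rightarrow> 'a \<Rightarrow> rat" where
  "geom_series \<beta> \<mu> = (if \<exists>k::nat. \<mu> = real k *\<^sub>R \<beta> then 1 else 0)"

text \<open>Product of a finite family of formal series.  The sum is over the ways of writing \<open>\<mu>\<close> as a
  sum of exponents occurring in the factors; for the families below there are finitely many.\<close>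

definition series_prod :: "'i set \<Rightarrow> ('i \<Rightarrow> 'a::euclidean_space \<Rightarrow> rat) \<Rightarrow> 'a \<Rightarrow> rat" where
  "series_prod I f \<mu> =
     (\<Sum>\<nu>\<in>{\<nu> \<in> Pi\<^sub>E I (\<lambda>i. {\<beta>. f i \<beta> \<noteq> 0}). (\<Sum>i\<in>I. \<nu> i) = \<mu>}. \<Prod>i\<in>I. f i (\<nu> i))"

text \<open>The expansion \<open>E\<close> of the power \<open>2 - d\<close> of the Weyl denominator.  Evaluating at
  \<open>\<mu> + (d-2)\<rho>\<close> accounts for the factor \<open>x\<close> to the \<open>-(d-2)\<rho>\<close>; the second component of the index
  set accounts for the power \<open>d-2\<close>.\<close>

definition chamber_expansion ::
    "'a::euclidean_space set \<Rightarrow> 'a set \<Rightarrow> nat \<Rightarrow> 'a \<Rightarrow> rat" where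
  "chamber_expansion \<Delta> \<Phi> d \<mu> =
     series_prod (pos_roots \<Delta> \<Phi> \<times> {..<d - 2}) (\<lambda>(\<alpha>, i). geom_series (- \<alpha>))
       (\<mu> + real (d - 2) *\<^sub>R weyl_vector \<Delta> \<Phi>)"

definition vertex_coeff :: "'a::euclidean_space set \<Rightarrow> 'a set \<Rightarrow> nat \<Rightarrow> 'a \<Rightarrow> rat" where
  "vertex_coeff \<Delta> \<Phi> d \<mu> =
     (if d \<le> 2 then Poly_Mapping.lookup (weyl_denom \<Delta> \<Phi> ^ (2 - d)) \<mu>
      else (1 / of_nat (card (weyl_group \<Delta>))) *
        (\<Sum>w\<in>weyl_group \<Delta>.
           (-1) ^ (d * weyl_length \<Phi> w) * chamber_expansion \<Delta> \<Phi> d (inv w \<mu>)))"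


section \<open>Weighted trees\<close>

text \<open>Vertices are drawn from a finite type.  Values of \<open>weight\<close> off \<open>vertices\<close> are
  irrelevant.\<close>

record 'v wgraph =
  vertices :: "'v set"
  edges :: "'v set set"
  weight :: "'v \<Rightarrow> int"

definition adj :: "'v set set \<Rightarrow> ('v \<times> 'v) set" where
  "adj F = {(u, v). {u, v} \<in> F}"

definition reach :: "'v set set \<Rightarrow> 'v \<Rightarrow> 'v set" where
  "reach F v = (adj F)\<^sup>* `` {v}"

definition is_cycle :: "'v set set \<Rightarrow> 'v list \<Rightarrow> bool" where
  "is_cycle F p \<longleftrightarrow> 3 \<le> length p \<and> distinct p \<and>
     successively (\<lambda>u v. {u, v} \<in> F) p \<and> {last p, hd p} \<in> F"

definition weighted_tree :: "'v::finite wgraph \<Rightarrow> bool" where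
  "weighted_tree \<Gamma> \<longleftrightarrow>
     vertices \<Gamma> \<noteq> {} \<and>
     (\<forall>e\<in>edges \<Gamma>. e \<subseteq> vertices \<Gamma> \<and> card e = 2) \<and>
     (\<forall>u\<in>vertices \<Gamma>. \<forall>v\<in>vertices \<Gamma>. v \<in> reach (edges \<Gamma>) u) \<and>
     (\<nexists>p. is_cycle (edges \<Gamma>) p)"

definition degree :: "'v::finite wgraph \<Rightarrow> 'v \<Rightarrow> nat" where
  "degree \<Gamma> v = card {u. {u, v} \<in> edges \<Gamma>}"

text \<open>Families indexed by \<open>V = vertices \<Gamma>\<close> are vectors over the whole vertex type that vanish off
  \<open>V\<close>, and \<open>V \<times> V\<close> matrices are extended by zero.\<close>

definition families :: "'v set \<Rightarrow> 'b::zero set \<Rightarrow> ('b ^ 'v::finite) set" where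
  "families S A = {x. \<forall>v. (v \<in> S \<longrightarrow> x $ v \<in> A) \<and> (v \<notin> S \<longrightarrow> x $ v = 0)}"

definition linking_matrix :: "'v::finite wgraph \<Rightarrow> real ^ 'v ^ 'v" where
  "linking_matrix \<Gamma> = (\<chi> u v.
     if u \<in> vertices \<Gamma> \<and> v \<in> vertices \<Gamma>
     then if u = v then of_int (weight \<Gamma> u) else if {u, v} \<in> edges \<Gamma> then 1 else 0
     else 0)"

definition is_linking_inverse :: "'v::finite wgraph \<Rightarrow> real ^ 'v ^ 'v \<Rightarrow> bool" where
  "is_linking_inverse \<Gamma> C \<longleftrightarrow>
     (let one = (\<chi> u v. if u = v \<and> u \<in> vertices \<Gamma> then 1 else 0) in
        C \<in> families (vertices \<Gamma>) (families (vertices \<Gamma>) UNIV) \<and>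
        linking_matrix \<Gamma> ** C = one \<and> C ** linking_matrix \<Gamma> = one)"

definition linking_inverse :: "'v::finite wgraph \<Rightarrow> real ^ 'v ^ 'v" where
  "linking_inverse \<Gamma> = (THE C. is_linking_inverse \<Gamma> C)"

definition weakly_negative_definite :: "'v::finite wgraph \<Rightarrow> bool" where
  "weakly_negative_definite \<Gamma> \<longleftrightarrow>
     (\<exists>C. is_linking_inverse \<Gamma> C) \<and>
     (\<forall>x \<in> families {v \<in> vertices \<Gamma>. 3 \<le> degree \<Gamma> v} UNIV.
        x \<noteq> 0 \<longrightarrow> x \<bullet> (linking_inverse \<Gamma> *v x) < 0)"

definition eigenspace :: "'v::finite wgraph \<Rightarrow> real \<Rightarrow> (real ^ 'v) set" where
  "eigenspace \<Gamma> t = {x \<in> families (vertices \<Gamma>) UNIV. linking_matrix \<Gamma> *v x = t *\<^sub>R x}"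

text \<open>Eigenvalues in \<open>S\<close> counted with multiplicity; the matrix is symmetric, so algebraic and
  geometric multiplicities agree.\<close>

definition count_eigenvalues :: "'v::finite wgraph \<Rightarrow> real set \<Rightarrow> nat" where
  "count_eigenvalues \<Gamma> S =
     (\<Sum>t\<in>{t\<in>S. \<exists>x\<in>eigenspace \<Gamma> t. x \<noteq> 0}. dim (eigenspace \<Gamma> t))"

definition num_positive :: "'v::finite wgraph \<Rightarrow> nat" where
  "num_positive \<Gamma> = count_eigenvalues \<Gamma> {0<..}"

definition signature :: "'v::finite wgraph \<Rightarrow> int" where
  "signature \<Gamma> = int (count_eigenvalues \<Gamma> {0<..}) - int (count_eigenvalues \<Gamma> {..<0})"


section \<open>Labels and the series\<close>

definition mat_act ::
    "real ^ 'v ^ 'v \<Rightarrow> 'a::euclidean_space ^ 'v \<Rightarrow> 'a ^ 'v::finite" where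
  "mat_act M l = (\<chi> u. \<Sum>v\<in>UNIV. (M $ u $ v) *\<^sub>R (l $ v))"

definition label_shift ::
    "'a::euclidean_space set \<Rightarrow> 'a set \<Rightarrow> 'v::finite wgraph \<Rightarrow> 'a ^ 'v" where
  "label_shift \<Delta> \<Phi> \<Gamma> =
     (\<chi> v. if v \<in> vertices \<Gamma> then (2 - real (degree \<Gamma> v)) *\<^sub>R weyl_vector \<Delta> \<Phi> else 0)"

definition label_reps ::
    "'a::euclidean_space set \<Rightarrow> 'a set \<Rightarrow> 'v::finite wgraph \<Rightarrow> ('a ^ 'v) set" where
  "label_reps \<Delta> \<Phi> \<Gamma> =
     (\<lambda>k. k + label_shift \<Delta> \<Phi> \<Gamma>) ` families (vertices \<Gamma>) (root_lattice \<Delta>)"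

definition label_class ::
    "'a::euclidean_space set \<Rightarrow> 'v::finite wgraph \<Rightarrow> 'a ^ 'v \<Rightarrow> ('a ^ 'v) set" where
  "label_class \<Delta> \<Gamma> l =
     (\<lambda>k. mat_act (linking_matrix \<Gamma>) k + l) ` families (vertices \<Gamma>) (root_lattice \<Delta>)"

definition labels ::
    "'a::euclidean_space set \<Rightarrow> 'a set \<Rightarrow> 'v::finite wgraph \<Rightarrow> ('a ^ 'v) set set" where
  "labels \<Delta> \<Phi> \<Gamma> = label_class \<Delta> \<Gamma> ` label_reps \<Delta> \<Phi> \<Gamma>"

definition summand_coeff ::
    "'a::euclidean_space set \<Rightarrow> 'a set \<Rightarrow> 'v::finite wgraph \<Rightarrow> 'a ^ 'v \<Rightarrow> rat" where
  "summand_coeff \<Delta> \<Phi> \<Gamma> l = (\<Prod>v\<in>vertices \<Gamma>. vertex_coeff \<Delta> \<Phi> (degree \<Gamma> v) (l $ v))"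

definition summand_exponent ::
    "'a::euclidean_space set \<Rightarrow> 'a set \<Rightarrow> 'v::finite wgraph \<Rightarrow> 'a ^ 'v \<Rightarrow> real" where
  "summand_exponent \<Delta> \<Phi> \<Gamma> l =
     (3 * of_int (signature \<Gamma>) - trace (linking_matrix \<Gamma>)) / 2
       * (weyl_vector \<Delta> \<Phi> \<bullet> weyl_vector \<Delta> \<Phi>)
     - (1/2) * (l \<bullet> mat_act (linking_inverse \<Gamma>) l)"

text \<open>A formal series in powers of \<open>q\<close> is the function that assigns to each exponent its
  coefficient.  Exponents are real numbers because inner products are; those that occur are rational.
  A label \<open>b\<close> is a coset, so the sum over \<open>BQ\<^sup>V + b\<close> is the sum over \<open>l \<in> b\<close>.  Weak negative
  definiteness makes the summation set finite.\<close>

definition Zhat ::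
    "'a::euclidean_space set \<Rightarrow> 'a set \<Rightarrow> 'v::finite wgraph \<Rightarrow> ('a ^ 'v) set \<Rightarrow> real \<Rightarrow> rat" where
  "Zhat \<Delta> \<Phi> \<Gamma> b r =
     (-1) ^ (card (pos_roots \<Delta> \<Phi>) * num_positive \<Gamma>) *
     (\<Sum>l\<in>{l\<in>b. summand_coeff \<Delta> \<Phi> \<Gamma> l \<noteq> 0 \<and> summand_exponent \<Delta> \<Phi> \<Gamma> l = r}.
        summand_coeff \<Delta> \<Phi> \<Gamma> l)"


section \<open>Neumann moves\<close>

text \<open>For each move the first definition relates the two trees (first argument: the top one) and
  the second is the graph of the associated bijection of labels, read off from representatives.\<close>

definition neumann1 :: "int \<Rightarrow> 'v \<Rightarrow> 'v \<Rightarrow> 'v \<Rightarrow> 'v wgraph \<Rightarrow> 'v wgraph \<Rightarrow> bool" where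
  "neumann1 \<epsilon> v0 v1 v2 \<Gamma> \<Gamma>' \<longleftrightarrow>
     v0 \<notin> vertices \<Gamma>' \<and> {v1, v2} \<in> edges \<Gamma>' \<and>
     vertices \<Gamma> = insert v0 (vertices \<Gamma>') \<and>
     edges \<Gamma> = (edges \<Gamma>' - {{v1, v2}}) \<union> {{v1, v0}, {v0, v2}} \<and>
     weight \<Gamma> v0 = \<epsilon> \<and>
     weight \<Gamma> v1 = weight \<Gamma>' v1 + \<epsilon> \<and>
     weight \<Gamma> v2 = weight \<Gamma>' v2 + \<epsilon> \<and>
     (\<forall>v\<in>vertices \<Gamma>' - {v1, v2}. weight \<Gamma> v = weight \<Gamma>' v)"

definition label_corr1 ::
    "'a::euclidean_space set \<Rightarrow> 'a set \<Rightarrow> int \<Rightarrow> 'v \<Rightarrow> 'v \<Rightarrow> 'v \<Rightarrow> 'v::finite wgraph \<Rightarrow> 'v wgraph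
      \<Rightarrow> ('a ^ 'v) set \<Rightarrow> ('a ^ 'v) set \<Rightarrow> bool" where
  "label_corr1 \<Delta> \<Phi> \<epsilon> v0 v1 v2 \<Gamma> \<Gamma>' b b' \<longleftrightarrow>
     (let L = reach (edges \<Gamma>' - {{v1, v2}}) v1;
          R = reach (edges \<Gamma>' - {{v1, v2}}) v2
      in \<exists>l'\<in>label_reps \<Delta> \<Phi> \<Gamma>'.
           b' = label_class \<Delta> \<Gamma>' l' \<and>
           b = label_class \<Delta> \<Gamma>
             (\<chi> v. if v \<in> L then l' $ v
                   else if v \<in> R then - (of_int \<epsilon> *\<^sub>R (l' $ v))
                   else 0))"

definition neumann2 :: "int \<Rightarrow> 'v \<Rightarrow> 'v \<Rightarrow> 'v wgraph \<Rightarrow> 'v wgraph \<Rightarrow> bool" where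
  "neumann2 \<epsilon> v0 v1 \<Gamma> \<Gamma>' \<longleftrightarrow>
     v0 \<in> vertices \<Gamma>' \<and> v1 \<notin> vertices \<Gamma>' \<and>
     vertices \<Gamma> = insert v1 (vertices \<Gamma>') \<and>
     edges \<Gamma> = insert {v0, v1} (edges \<Gamma>') \<and>
     weight \<Gamma> v1 = \<epsilon> \<and>
     weight \<Gamma> v0 = weight \<Gamma>' v0 + \<epsilon> \<and>
     (\<forall>v\<in>vertices \<Gamma>' - {v0}. weight \<Gamma> v = weight \<Gamma>' v)"

definition label_corr2 ::
    "'a::euclidean_space set \<Rightarrow> 'a set \<Rightarrow> int \<Rightarrow> 'v \<Rightarrow> 'v \<Rightarrow> 'v::finite wgraph \<Rightarrow> 'v wgraph
      \<Rightarrow> ('a ^ 'v) set \<Rightarrow> ('a ^ 'v) set \<Rightarrow> bool" where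
  "label_corr2 \<Delta> \<Phi> \<epsilon> v0 v1 \<Gamma> \<Gamma>' b b' \<longleftrightarrow>
     (\<exists>l\<in>label_reps \<Delta> \<Phi> \<Gamma>.
        b = label_class \<Delta> \<Gamma> l \<and>
        b' = label_class \<Delta> \<Gamma>'
          (\<chi> v. if v = v0 then l $ v0 - of_int \<epsilon> *\<^sub>R (l $ v1)
                else if v \<in> vertices \<Gamma>' then l $ v
                else 0))"

text \<open>The merged vertex \<open>v12\<close> may be any vertex not otherwise present in the new tree, for example
  \<open>v1\<close>.\<close>

definition neumann3 :: "'v \<Rightarrow> 'v \<Rightarrow> 'v \<Rightarrow> 'v \<Rightarrow> 'v wgraph \<Rightarrow> 'v wgraph \<Rightarrow> bool" where
  "neumann3 v0 v1 v2 v12 \<Gamma> \<Gamma>' \<longleftrightarrow>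
     v0 \<in> vertices \<Gamma> \<and> weight \<Gamma> v0 = 0 \<and>
     v1 \<noteq> v2 \<and> {u. {v0, u} \<in> edges \<Gamma>} = {v1, v2} \<and>
     v12 \<notin> vertices \<Gamma> - {v0, v1, v2} \<and>
     vertices \<Gamma>' = insert v12 (vertices \<Gamma> - {v0, v1, v2}) \<and>
     edges \<Gamma>' = {e \<in> edges \<Gamma>. e \<inter> {v0, v1, v2} = {}} \<union>
       {{v12, u} |u. u \<noteq> v0 \<and> ({v1, u} \<in> edges \<Gamma> \<or> {v2, u} \<in> edges \<Gamma>)} \<and>
     weight \<Gamma>' v12 = weight \<Gamma> v1 + weight \<Gamma> v2 \<and>
     (\<forall>v\<in>vertices \<Gamma> - {v0, v1, v2}. weight \<Gamma>' v = weight \<Gamma> v)"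

definition label_corr3 ::
    "'a::euclidean_space set \<Rightarrow> 'a set \<Rightarrow> 'v \<Rightarrow> 'v \<Rightarrow> 'v \<Rightarrow> 'v \<Rightarrow> 'v::finite wgraph \<Rightarrow> 'v wgraph
      \<Rightarrow> ('a ^ 'v) set \<Rightarrow> ('a ^ 'v) set \<Rightarrow> bool" where
  "label_corr3 \<Delta> \<Phi> v0 v1 v2 v12 \<Gamma> \<Gamma>' b b' \<longleftrightarrow>
     (let L = reach {e \<in> edges \<Gamma>. v0 \<notin> e} v1;
          R = reach {e \<in> edges \<Gamma>. v0 \<notin> e} v2
      in \<exists>l\<in>label_reps \<Delta> \<Phi> \<Gamma>.
           l $ v0 = 0 \<and>
           b = label_class \<Delta> \<Gamma> l \<and>
           b' = label_class \<Delta> \<Gamma>'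
             (\<chi> v. if v = v12 then l $ v1 - l $ v2
                   else if v \<in> L - {v1} then l $ v
                   else if v \<in> R - {v2} then - (l $ v)
                   else 0))"

definition neumann_related ::
    "'a::euclidean_space set \<Rightarrow> 'a set \<Rightarrow> 'v::finite wgraph \<Rightarrow> 'v wgraph
      \<Rightarrow> ('a ^ 'v) set \<Rightarrow> ('a ^ 'v) set \<Rightarrow> bool" where
  "neumann_related \<Delta> \<Phi> \<Gamma> \<Gamma>' b b' \<longleftrightarrow>
     (\<exists>\<epsilon>\<in>{1, -1}. \<exists>v0 v1 v2.
        neumann1 \<epsilon> v0 v1 v2 \<Gamma> \<Gamma>' \<and> label_corr1 \<Delta> \<Phi> \<epsilon> v0 v1 v2 \<Gamma> \<Gamma>' b b') \<or>
     (\<exists>\<epsilon>\<in>{1, -1}. \<exists>v0 v1.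
        neumann2 \<epsilon> v0 v1 \<Gamma> \<Gamma>' \<and> label_corr2 \<Delta> \<Phi> \<epsilon> v0 v1 \<Gamma> \<Gamma>' b b') \<or>
     (\<exists>v0 v1 v2 v12.
        neumann3 v0 v1 v2 v12 \<Gamma> \<Gamma>' \<and> label_corr3 \<Delta> \<Phi> v0 v1 v2 v12 \<Gamma> \<Gamma>' b b')"

end

(* By the Weyl denominator formula the alternating sum D equals x^rho prod (1 - x^-alpha), so
   multiplication by D lowers by one the number of geometric factors in the expansion of D^(2-d) in
   each chamber, and hence in the average: D * n^(d+1) = n^(d) for all d >= 0.  The longest element
   of the Weyl group exchanges opposite chambers, which gives
   n^(d)(-mu) = (-1)^(d |Delta+|) n^(d)(mu).

   Each move comes with a map l |-> l' from the contributing families of the top tree to those of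
   the bottom tree.  It preserves the exponent, as one sees by comparing solutions of B k = l and
   B' k' = l', and the sum of the coefficients over a fibre is a coefficient of a product
   D^(2-d1) D^(2-d2) in which one factor is a Laurent polynomial.  In the third move this needs one
   of the two merged vertices to have degree at most 2: a product of two averaged expansions would
   not be an averaged expansion, but then the form of B^-1 would not be definite.  The signs from
   negating the labels in R amount to (-1)^|Delta+|, because the degrees over R have an odd sum;
   they cancel the change of pi, which, like that of sigma, is found from definite subspaces
   (Sylvester's law of inertia).  The sums are finite because the form of B^-1 is definite in the
   vertices of degree >= 3 and the remaining labels take finitely many values. *)

theory Submission
  imports Defs
begin

section \<open>Reflections and the Weyl group\<close>

text \<open>The sign \<open>(-1) ^ (d * weyl_length \<Phi> w)\<close> in the average is exactly what
  keeps the recursion alive: D is multiplied by the sign of w under w, so multiplying the summand of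
  w in the average for d + 1 by D absorbs one of its d + 1 signs. The inverse matrix is never
  computed. If B k = l, the exponent needs only the inner product of l and k, and integrality of the
  transformed solutions is also what shows that the maps respect label classes. The same
  transformation of real families embeds the form of B' isometrically into the form of B, with a
  line or a plane orthogonal to the image. This gives lower bounds for both indices, which the
  number of vertices turns into equalities. A coefficient of the series is a sum over a set, and
  such a sum is 0 by convention when the set is infinite. Regrouping the terms into fibres therefore
  has to be preceded by a proof that the set is finite.\<close>

lemma reflect_linear: "linear (reflect \<alpha>)"
  unfolding reflect_def
  by (intro linearI) (simp_all add: inner_add_left algebra_simps add_divide_distrib scaleR_add_left)

lemma reflect_inner: "reflect \<alpha> x \<bullet> reflect \<alpha> y = x \<bullet> y"
proof (cases "\<alpha> = 0")
  case False
  then show ?thesis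
    unfolding reflect_def
    by (simp add: inner_diff_left inner_diff_right field_simps inner_commute)
qed (simp add: reflect_def)

lemma reflect_orthogonal: "orthogonal_transformation (reflect \<alpha>)"
  by (simp add: orthogonal_transformation_def reflect_linear reflect_inner)

lemma reflect_reflect [simp]: "reflect \<alpha> (reflect \<alpha> x) = x"
proof (cases "\<alpha> = 0")
  case False
  then show ?thesis
    unfolding reflect_def
    by (simp add: inner_diff_left field_simps scaleR_diff_left [symmetric] del: scaleR_diff_left)
qed (simp add: reflect_def)

lemma reflect_self: "\<alpha> \<noteq> 0 \<Longrightarrow> reflect \<alpha> \<alpha> = - \<alpha>"
  unfolding reflect_def by (simp add: scaleR_2)

lemma reflect_uminus: "reflect (- \<alpha>) = reflect \<alpha>"
  unfolding reflect_def by (intro ext) simp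

lemma reflect_inner_swap: "reflect \<alpha> x \<bullet> y = x \<bullet> reflect \<alpha> y"
  by (metis reflect_inner reflect_reflect)

lemma reflect_conj:
  assumes "orthogonal_transformation w"
  shows "w (reflect \<alpha> x) = reflect (w \<alpha>) (w x)"
proof -
  have "linear w" "\<And>x y. w x \<bullet> w y = x \<bullet> y"
    using assms by (auto simp: orthogonal_transformation_def)
  then show ?thesis
    by (simp add: reflect_def linear_diff linear_cmul)
qed

lemma reflect_word_Nil [simp]: "reflect_word [] = id"
  by (simp add: reflect_word_def)

lemma reflect_word_Cons [simp]: "reflect_word (\<alpha> # \<alpha>s) = reflect \<alpha> \<circ> reflect_word \<alpha>s"
  by (simp add: reflect_word_def)

lemma reflect_word_append: "reflect_word (\<alpha>s @ \<beta>s) = reflect_word \<alpha>s \<circ> reflect_word \<beta>s"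
  by (induction \<alpha>s) (simp_all add: o_assoc)

lemma reflect_word_orthogonal: "orthogonal_transformation (reflect_word \<alpha>s)"
proof (induction \<alpha>s)
  case (Cons \<alpha> \<alpha>s)
  then show ?case
    using orthogonal_transformation_compose[OF reflect_orthogonal Cons] by (simp add: o_def)
qed (simp add: orthogonal_transformation_def linear_id)

lemma reflect_word_rev: "reflect_word (rev \<alpha>s) (reflect_word \<alpha>s x) = x"
  by (induction \<alpha>s arbitrary: x) (simp_all add: reflect_word_append)

lemma inv_reflect_word: "inv (reflect_word \<alpha>s) = reflect_word (rev \<alpha>s)"
proof (rule inv_unique_comp)
  show "reflect_word \<alpha>s \<circ> reflect_word (rev \<alpha>s) = id"
    using reflect_word_rev[of "rev \<alpha>s"] by (auto simp: fun_eq_iff)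
  show "reflect_word (rev \<alpha>s) \<circ> reflect_word \<alpha>s = id"
    using reflect_word_rev[of "\<alpha>s"] by (auto simp: fun_eq_iff)
qed

section \<open>Positive and simple roots, the Weyl vector\<close>

locale based_root_system =
  fixes \<Delta> \<Phi> :: "'a::euclidean_space set"
  assumes root_system: "root_system \<Delta>" and simple_system: "simple_system \<Delta> \<Phi>"
begin

abbreviation "P \<equiv> pos_roots \<Delta> \<Phi>"
abbreviation "\<rho> \<equiv> weyl_vector \<Delta> \<Phi>"
abbreviation "W \<equiv> weyl_group \<Delta>"

lemma finite_roots: "finite \<Delta>" and zero_not_root: "0 \<notin> \<Delta>"
  and reflect_root: "\<alpha> \<in> \<Delta> \<Longrightarrow> \<beta> \<in> \<Delta> \<Longrightarrow> reflect \<alpha> \<beta> \<in> \<Delta>"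
  and cartan_int: "\<alpha> \<in> \<Delta> \<Longrightarrow> \<beta> \<in> \<Delta> \<Longrightarrow> 2 * (\<beta> \<bullet> \<alpha>) / (\<alpha> \<bullet> \<alpha>) \<in> \<int>"
  and root_multiple: "\<alpha> \<in> \<Delta> \<Longrightarrow> c *\<^sub>R \<alpha> \<in> \<Delta> \<Longrightarrow> c = 1 \<or> c = -1"
  using root_system unfolding root_system_def by blast+

lemma simple_subset: "\<Phi> \<subseteq> \<Delta>" and simple_independent: "independent \<Phi>"
  and root_cases: "\<alpha> \<in> \<Delta> \<Longrightarrow> \<alpha> \<in> P \<or> - \<alpha> \<in> P"
  using simple_system unfolding simple_system_def by blast+

lemma finite_simple: "finite \<Phi>"
  using finite_roots simple_subset finite_subset by blast

lemma pos_subset: "P \<subseteq> \<Delta>"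
  by (auto simp: pos_roots_def)

lemma finite_pos: "finite P"
  using finite_roots pos_subset finite_subset by blast

lemma simple_pos: "\<alpha> \<in> \<Phi> \<Longrightarrow> \<alpha> \<in> P"
  using simple_subset finite_simple
  by (auto simp: pos_roots_def if_distrib[of real] if_distrib[of "\<lambda>c. c *\<^sub>R _"]
      intro!: exI[of _ "\<lambda>\<beta>. if \<beta> = \<alpha> then 1 else 0"] cong: if_cong)

lemma pos_expand:
  assumes "\<alpha> \<in> P"
  obtains c :: "'a \<Rightarrow> nat" where "\<alpha> = (\<Sum>\<beta>\<in>\<Phi>. real (c \<beta>) *\<^sub>R \<beta>)" "\<exists>\<beta>\<in>\<Phi>. c \<beta> > 0"
proof -
  from assms obtain c :: "'a \<Rightarrow> nat" where c: "\<alpha> = (\<Sum>\<beta>\<in>\<Phi>. real (c \<beta>) *\<^sub>R \<beta>)"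
    by (auto simp: pos_roots_def)
  have "\<alpha> \<noteq> 0" using assms pos_subset zero_not_root by auto
  then have "\<exists>\<beta>\<in>\<Phi>. c \<beta> > 0"
    using c by (metis (no_types, lifting) gr0I of_nat_0 scaleR_eq_0_iff sum.not_neutral_contains_not_neutral)
  with c that show thesis by blast
qed

lemma pos_functional_pos:
  assumes "linear f" "\<And>\<beta>. \<beta> \<in> \<Phi> \<Longrightarrow> f \<beta> > (0::real)" "\<alpha> \<in> P"
  shows "f \<alpha> > 0"
proof -
  obtain c :: "'a \<Rightarrow> nat" where c: "\<alpha> = (\<Sum>\<beta>\<in>\<Phi>. real (c \<beta>) *\<^sub>R \<beta>)" "\<exists>\<beta>\<in>\<Phi>. c \<beta> > 0"
    using pos_expand assms(3) by blast
  have "f \<alpha> = (\<Sum>\<beta>\<in>\<Phi>. real (c \<beta>) * f \<beta>)"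
    using assms(1) by (simp add: c(1) linear_sum linear_cmul)
  also have "\<dots> > 0"
  proof -
    obtain \<beta> where "\<beta> \<in> \<Phi>" "c \<beta> > 0" using c(2) by blast
    then show ?thesis
      using assms(2) finite_simple by (intro sum_pos2[of _ \<beta>]) (auto simp: less_imp_le)
  qed
  finally show ?thesis .
qed

lemma pos_functional_nonneg:
  assumes "linear f" "\<And>\<beta>. \<beta> \<in> \<Phi> \<Longrightarrow> f \<beta> \<ge> (0::real)" "\<alpha> \<in> P"
  shows "f \<alpha> \<ge> 0"
proof -
  obtain c :: "'a \<Rightarrow> nat" where c: "\<alpha> = (\<Sum>\<beta>\<in>\<Phi>. real (c \<beta>) *\<^sub>R \<beta>)"
    using pos_expand assms(3) by blast
  have "f \<alpha> = (\<Sum>\<beta>\<in>\<Phi>. real (c \<beta>) * f \<beta>)"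
    using assms(1) by (simp add: c(1) linear_sum linear_cmul)
  then show ?thesis using assms(2) by (simp add: sum_nonneg)
qed

text \<open>The height, extended linearly from the independent set \<open>\<Phi>\<close>. It
  excludes cancellation among positive roots and bounds the number of terms of the series
  expansions.\<close>

lemma positive_functional:
  obtains ht :: "'a \<Rightarrow> real" where "linear ht" "\<And>\<alpha>. \<alpha> \<in> P \<Longrightarrow> ht \<alpha> > 0"
proof -
  obtain ht :: "'a \<Rightarrow> real" where "linear ht" "\<forall>\<beta>\<in>\<Phi>. ht \<beta> = 1"
    using linear_independent_extend[OF simple_independent, of "\<lambda>_. 1::real"] by blast
  then show thesis using that pos_functional_pos[of ht] by auto
qed

lemma pos_not_neg: "\<alpha> \<in> P \<Longrightarrow> - \<alpha> \<notin> P"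
proof
  assume "\<alpha> \<in> P" "- \<alpha> \<in> P"
  obtain ht :: "'a \<Rightarrow> real" where "linear ht" "\<And>\<alpha>. \<alpha> \<in> P \<Longrightarrow> ht \<alpha> > 0"
    using positive_functional by blast
  with \<open>\<alpha> \<in> P\<close> \<open>- \<alpha> \<in> P\<close> have "ht \<alpha> > 0" "ht (- \<alpha>) > 0" by auto
  with \<open>linear ht\<close> show False by (simp add: linear_neg)
qed

text \<open>The reflection changes only the coefficient of \<open>\<alpha>\<close>. If the image
  were negative, all other coefficients of \<open>\<beta>\<close> would vanish, and
  \<open>\<beta>\<close> would be a multiple of \<open>\<alpha>\<close>, hence
  \<open>\<alpha>\<close> itself since the system is reduced.\<close>

lemma simple_reflect_pos:
  assumes "\<alpha> \<in> \<Phi>" "\<beta> \<in> P" "\<beta> \<noteq> \<alpha>"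
  shows "reflect \<alpha> \<beta> \<in> P"
proof (rule ccontr)
  assume neg: "reflect \<alpha> \<beta> \<notin> P"
  have "reflect \<alpha> \<beta> \<in> \<Delta>"
    using assms simple_subset pos_subset reflect_root by blast
  with neg have "- reflect \<alpha> \<beta> \<in> P" using root_cases by blast
  then obtain d :: "'a \<Rightarrow> nat" where d: "- reflect \<alpha> \<beta> = (\<Sum>\<gamma>\<in>\<Phi>. real (d \<gamma>) *\<^sub>R \<gamma>)"
    by (rule pos_expand)
  obtain c :: "'a \<Rightarrow> nat" where c: "\<beta> = (\<Sum>\<gamma>\<in>\<Phi>. real (c \<gamma>) *\<^sub>R \<gamma>)"
    using assms(2) pos_expand by blast
  define m where "m = 2 * (\<beta> \<bullet> \<alpha>) / (\<alpha> \<bullet> \<alpha>)"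
  have "0 = \<beta> + - reflect \<alpha> \<beta> - m *\<^sub>R \<alpha>"
    by (simp add: reflect_def m_def)
  also have "\<dots> = (\<Sum>\<gamma>\<in>\<Phi>. real (c \<gamma>) *\<^sub>R \<gamma>) + (\<Sum>\<gamma>\<in>\<Phi>. real (d \<gamma>) *\<^sub>R \<gamma>) - m *\<^sub>R \<alpha>"
    using c d by simp
  also have "m *\<^sub>R \<alpha> = (\<Sum>\<gamma>\<in>\<Phi>. (if \<gamma> = \<alpha> then m else 0) *\<^sub>R \<gamma>)"
    using finite_simple assms(1) by (simp add: if_distrib[of "\<lambda>c. c *\<^sub>R _"] cong: if_cong)
  finally have "(\<Sum>\<gamma>\<in>\<Phi>. (real (c \<gamma>) + real (d \<gamma>) - (if \<gamma> = \<alpha> then m else 0)) *\<^sub>R \<gamma>) = 0"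
    by (simp add: sum_subtractf sum.distrib algebra_simps)
  \<comment> \<open>Away from \<open>\<alpha>\<close> this is a vanishing sum of two natural
    numbers.\<close>
  then have z: "real (c \<gamma>) + real (d \<gamma>) - (if \<gamma> = \<alpha> then m else 0) = 0" if "\<gamma> \<in> \<Phi>" for \<gamma>
    using independentD[OF simple_independent finite_simple order_refl,
        of "\<lambda>\<gamma>. real (c \<gamma>) + real (d \<gamma>) - (if \<gamma> = \<alpha> then m else 0)"] that by blast
  have "c \<gamma> = 0" if "\<gamma> \<in> \<Phi>" "\<gamma> \<noteq> \<alpha>" for \<gamma>
    using z[OF that(1)] that(2) by simp
  then have "\<beta> = (\<Sum>\<gamma>\<in>\<Phi>. if \<gamma> = \<alpha> then real (c \<alpha>) *\<^sub>R \<alpha> else 0)"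
    by (subst c) (intro sum.cong, auto)
  then have "\<beta> = real (c \<alpha>) *\<^sub>R \<alpha>"
    using finite_simple assms(1) by simp
  moreover have "\<alpha> \<in> \<Delta>" "\<beta> \<in> \<Delta>" using assms simple_subset pos_subset by auto
  ultimately have "real (c \<alpha>) = 1 \<or> real (c \<alpha>) = -1" using root_multiple by metis
  then have "real (c \<alpha>) = 1" by auto
  with \<open>\<beta> = real (c \<alpha>) *\<^sub>R \<alpha>\<close> assms(3) show False by simp
qed

lemma simple_reflect_pos_image:
  assumes "\<alpha> \<in> \<Phi>"
  shows "reflect \<alpha> ` (P - {\<alpha>}) = P - {\<alpha>}"
proof -
  have *: "reflect \<alpha> \<beta> \<in> P - {\<alpha>}" if "\<beta> \<in> P - {\<alpha>}" for \<beta>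
  proof -
    have "reflect \<alpha> \<beta> \<noteq> \<alpha>"
      using that assms pos_not_neg simple_pos reflect_self reflect_reflect
      by (metis Diff_iff pos_subset simple_subset subsetD zero_not_root)
    then show ?thesis using simple_reflect_pos assms that by auto
  qed
  show ?thesis
  proof (intro equalityI subsetI)
    fix \<beta> assume "\<beta> \<in> P - {\<alpha>}"
    then show "\<beta> \<in> reflect \<alpha> ` (P - {\<alpha>})"
      using *[of \<beta>] by (intro image_eqI[of _ _ "reflect \<alpha> \<beta>"]) simp_all
  next
    fix \<beta> assume "\<beta> \<in> reflect \<alpha> ` (P - {\<alpha>})"
    then obtain \<gamma> where "\<gamma> \<in> P - {\<alpha>}" "\<beta> = reflect \<alpha> \<gamma>" by (rule imageE)
    then show "\<beta> \<in> P - {\<alpha>}" using *[of \<gamma>] by simp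
  qed
qed

lemma simple_nonzero: "\<alpha> \<in> \<Phi> \<Longrightarrow> \<alpha> \<noteq> 0"
  using simple_subset zero_not_root by auto

text \<open>The other positive roots are permuted and \<open>\<alpha>\<close> is negated, so half
  the sum loses one copy of \<open>\<alpha>\<close>.\<close>

lemma reflect_rho:
  assumes "\<alpha> \<in> \<Phi>"
  shows "reflect \<alpha> \<rho> = \<rho> - \<alpha>"
proof -
  have inj: "inj_on (reflect \<alpha>) A" for A by (metis inj_onI reflect_reflect)
  have "(\<Sum>\<beta>\<in>P. \<beta>) = \<alpha> + (\<Sum>\<beta>\<in>P - {\<alpha>}. \<beta>)"
    using finite_pos simple_pos[OF assms] by (simp add: sum.remove)
  moreover have "(\<Sum>\<beta>\<in>P - {\<alpha>}. reflect \<alpha> \<beta>) = (\<Sum>\<beta>\<in>P - {\<alpha>}. \<beta>)"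
    using sum.reindex[OF inj, of "\<lambda>x. x" "P - {\<alpha>}"] simple_reflect_pos_image[OF assms] by simp
  ultimately have "reflect \<alpha> (\<Sum>\<beta>\<in>P. \<beta>) = (\<Sum>\<beta>\<in>P. \<beta>) - 2 *\<^sub>R \<alpha>"
    using reflect_linear[of \<alpha>] reflect_self[OF simple_nonzero[OF assms]]
    by (simp add: linear_add linear_sum scaleR_2)
  then show ?thesis
    using reflect_linear[of \<alpha>]
    by (simp add: weyl_vector_def linear_cmul scaleR_diff_right)
qed

lemma rho_simple:
  assumes "\<alpha> \<in> \<Phi>"
  shows "2 * (\<rho> \<bullet> \<alpha>) = \<alpha> \<bullet> \<alpha>"
proof -
  have "(2 * (\<rho> \<bullet> \<alpha>) / (\<alpha> \<bullet> \<alpha>)) *\<^sub>R \<alpha> = 1 *\<^sub>R \<alpha>"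
    using reflect_rho[OF assms] by (simp add: reflect_def)
  then have "2 * (\<rho> \<bullet> \<alpha>) / (\<alpha> \<bullet> \<alpha>) = 1"
    using simple_nonzero[OF assms] scaleR_right_imp_eq by blast
  then show ?thesis using simple_nonzero[OF assms] by (simp add: field_simps)
qed

lemma rho_pos: "\<alpha> \<in> P \<Longrightarrow> \<rho> \<bullet> \<alpha> > 0"
proof (rule pos_functional_pos)
  show "\<rho> \<bullet> \<beta> > 0" if "\<beta> \<in> \<Phi>" for \<beta>
  proof -
    have "\<beta> \<bullet> \<beta> > 0" using simple_nonzero[OF that] by simp
    then show ?thesis using rho_simple[OF that] by linarith
  qed
qed (auto intro: linearI simp: inner_add_right)

section \<open>The Weyl group: finiteness and dominant representatives\<close>

lemma weyl_group_induct [consumes 1, case_names id step]: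
  assumes "w \<in> W" "Q id" "\<And>\<alpha> w. \<alpha> \<in> \<Delta> \<Longrightarrow> w \<in> W \<Longrightarrow> Q w \<Longrightarrow> Q (reflect \<alpha> \<circ> w)"
  shows "Q w"
proof -
  have "Q (reflect_word \<alpha>s)" if "set \<alpha>s \<subseteq> \<Delta>" for \<alpha>s
    using that by (induction \<alpha>s) (auto simp: assms weyl_group_def)
  then show ?thesis using assms(1) by (auto simp: weyl_group_def)
qed

lemma weyl_orthogonal: "w \<in> W \<Longrightarrow> orthogonal_transformation w"
  by (auto simp: weyl_group_def reflect_word_orthogonal)

lemma weyl_linear: "w \<in> W \<Longrightarrow> linear w"
  and weyl_inner: "w \<in> W \<Longrightarrow> w x \<bullet> w y = x \<bullet> y"
  and weyl_bij: "w \<in> W \<Longrightarrow> bij w"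
  using weyl_orthogonal[of w] orthogonal_transformation_bij[of w]
  by (simp_all add: orthogonal_transformation_def)

lemma weyl_root: "w \<in> W \<Longrightarrow> \<alpha> \<in> \<Delta> \<Longrightarrow> w \<alpha> \<in> \<Delta>"
  by (induction arbitrary: \<alpha> rule: weyl_group_induct) (auto simp: reflect_root)

lemma weyl_id: "id \<in> W"
  by (auto simp: weyl_group_def intro: image_eqI[of _ _ "[]"])

lemma weyl_comp: "w \<in> W \<Longrightarrow> u \<in> W \<Longrightarrow> w \<circ> u \<in> W"
  unfolding weyl_group_def
  by (auto simp flip: reflect_word_append intro!: imageI)

lemma weyl_inv: "w \<in> W \<Longrightarrow> inv w \<in> W"
  unfolding weyl_group_def by (auto simp: inv_reflect_word intro!: image_eqI)

lemma weyl_reflect: "\<alpha> \<in> \<Delta> \<Longrightarrow> reflect \<alpha> \<in> W"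
  unfolding weyl_group_def by (auto intro!: image_eqI[of _ _ "[\<alpha>]"])

lemma weyl_inv_apply: "w \<in> W \<Longrightarrow> inv w (w x) = x" "w \<in> W \<Longrightarrow> w (inv w x) = x"
  using weyl_bij by (auto simp: bij_is_inj bij_is_surj surj_f_inv_f)

lemma weyl_inner_swap: "w \<in> W \<Longrightarrow> w x \<bullet> y = x \<bullet> inv w y"
  by (metis weyl_inner weyl_inv_apply(2))

text \<open>An element is determined by its permutation of the roots: it is linear on their span and
  fixes the orthogonal complement, which can be nonzero because the ambient space may be larger than
  the span.\<close>

lemma finite_weyl: "finite W"
proof -
  have fixes_orth: "w x = x" if "w \<in> W" "\<And>\<alpha>. \<alpha> \<in> \<Delta> \<Longrightarrow> x \<bullet> \<alpha> = 0" for w x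
    using that by (induction rule: weyl_group_induct) (auto simp: reflect_def)
  have "inj_on (\<lambda>w. restrict w \<Delta>) W"
  proof (rule inj_onI, rule ext)
    fix w u x
    assume w: "w \<in> W" and u: "u \<in> W" and eq: "restrict w \<Delta> = restrict u \<Delta>"
    obtain y z where yz: "y \<in> span \<Delta>" "\<And>v. v \<in> span \<Delta> \<Longrightarrow> orthogonal z v" "x = y + z"
      by (metis orthogonal_subspace_decomp_exists)
    have "w \<alpha> = u \<alpha>" if "\<alpha> \<in> \<Delta>" for \<alpha> using eq that by (metis restrict_apply')
    then have "w y = u y"
      using linear_eq_on_span[OF weyl_linear[OF w] weyl_linear[OF u] _ yz(1)] by blast
    moreover have "w z = z" "u z = z"
      using fixes_orth w u yz(2) by (auto simp: orthogonal_def span_base)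
    ultimately show "w x = u x"
      using w u by (simp add: yz(3) linear_add[OF weyl_linear])
  qed
  moreover have "(\<lambda>w. restrict w \<Delta>) ` W \<subseteq> Pi\<^sub>E \<Delta> (\<lambda>_. \<Delta>)"
    using weyl_root by auto
  ultimately show ?thesis
    by (meson finite_PiE finite_imageD finite_roots finite_subset)
qed

text \<open>Choose \<open>w\<close> so that \<open>w \<mu> \<bullet> \<rho>\<close> is maximal. A
  further simple reflection changes this value by \<open>- (w \<mu> \<bullet> \<alpha>)\<close>,
  which cannot be positive.\<close>

lemma dominant_exists:
  obtains w where "w \<in> W" "\<And>\<alpha>. \<alpha> \<in> \<Phi> \<Longrightarrow> w \<mu> \<bullet> \<alpha> \<ge> 0"
proof -
  obtain w where w: "w \<in> W" "\<And>u. u \<in> W \<Longrightarrow> u \<mu> \<bullet> \<rho> \<le> w \<mu> \<bullet> \<rho>"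
  proof -
    have "Max ((\<lambda>w. w \<mu> \<bullet> \<rho>) ` W) \<in> (\<lambda>w. w \<mu> \<bullet> \<rho>) ` W"
      using finite_weyl weyl_id by (intro Max_in) auto
    then obtain w where w: "w \<in> W" "w \<mu> \<bullet> \<rho> = Max ((\<lambda>w. w \<mu> \<bullet> \<rho>) ` W)" by auto
    with that[of w] finite_weyl show thesis by auto
  qed
  have "w \<mu> \<bullet> \<alpha> \<ge> 0" if a: "\<alpha> \<in> \<Phi>" for \<alpha>
  proof -
    have "(reflect \<alpha> \<circ> w) \<mu> \<bullet> \<rho> \<le> w \<mu> \<bullet> \<rho>"
      using w a simple_subset weyl_reflect weyl_comp by blast
    moreover have "(reflect \<alpha> \<circ> w) \<mu> \<bullet> \<rho> = w \<mu> \<bullet> \<rho> - w \<mu> \<bullet> \<alpha>"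
      by (simp add: reflect_inner_swap reflect_rho[OF a] inner_diff_right)
    ultimately show ?thesis by simp
  qed
  with w(1) that show thesis by blast
qed

text \<open>The parity of the number of inversions. It refers to no word, so it can be studied
  before simple reflections are known to generate the group; \<open>weyl_sgn_length\<close>
  identifies it with the sign of the length.\<close>

definition weyl_sgn :: "('a \<Rightarrow> 'a) \<Rightarrow> rat" where
  "weyl_sgn w = (-1) ^ card {\<beta> \<in> P. - w \<beta> \<in> P}"

lemma weyl_sgn_id: "weyl_sgn id = 1"
proof -
  have "{\<beta> \<in> P. - id \<beta> \<in> P} = {}" using pos_not_neg by auto
  then show ?thesis unfolding weyl_sgn_def by (metis card.empty power_0)
qed

text \<open>The reflection permutes the positive roots other than \<open>\<alpha>\<close>, which
  matches the inversions of both maps there; \<open>\<alpha>\<close> itself is an inversion of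
  exactly one of them.\<close>

lemma weyl_sgn_comp_simple:
  assumes w: "w \<in> W" and \<alpha>: "\<alpha> \<in> \<Phi>"
  shows "weyl_sgn (w \<circ> reflect \<alpha>) = - weyl_sgn w"
proof -
  define A where "A = {\<beta> \<in> P - {\<alpha>}. - w \<beta> \<in> P}"
  define B where "B = {\<beta> \<in> P - {\<alpha>}. - (w \<circ> reflect \<alpha>) \<beta> \<in> P}"
  have fin: "finite A" "finite B" using finite_pos by (auto simp: A_def B_def)
  have inj: "inj_on (reflect \<alpha>) A" by (metis inj_onI reflect_reflect)
  have mem: "reflect \<alpha> \<beta> \<in> P - {\<alpha>}" if "\<beta> \<in> P - {\<alpha>}" for \<beta>
    using simple_reflect_pos_image[OF \<alpha>] that by blast
  have "reflect \<alpha> ` A = B"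
  proof (intro equalityI subsetI)
    fix \<beta> assume "\<beta> \<in> B"
    then have "reflect \<alpha> \<beta> \<in> A" using mem[of \<beta>] by (simp add: A_def B_def)
    then show "\<beta> \<in> reflect \<alpha> ` A" by (intro image_eqI[of _ _ "reflect \<alpha> \<beta>"]) simp_all
  next
    fix \<beta> assume "\<beta> \<in> reflect \<alpha> ` A"
    then obtain \<gamma> where "\<gamma> \<in> A" "\<beta> = reflect \<alpha> \<gamma>" by (rule imageE)
    then show "\<beta> \<in> B" using mem[of \<gamma>] by (simp add: A_def B_def)
  qed
  then have card_eq: "card A = card B" using card_image[OF inj] by simp
  have \<alpha>P: "\<alpha> \<in> P" using \<alpha> by (rule simple_pos)
  have w\<alpha>: "w \<alpha> \<in> \<Delta>" using w \<alpha>P pos_subset weyl_root by blast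
  have neg: "- (w \<circ> reflect \<alpha>) \<alpha> = w \<alpha>"
    using reflect_self[OF simple_nonzero[OF \<alpha>]] weyl_linear[OF w] by (simp add: linear_neg)
  show ?thesis
  proof (cases "w \<alpha> \<in> P")
    case True
    have "{\<beta> \<in> P. - (w \<circ> reflect \<alpha>) \<beta> \<in> P} = insert \<alpha> B"
      using True neg \<alpha>P by (auto simp: B_def)
    moreover have "{\<beta> \<in> P. - w \<beta> \<in> P} = A"
      using pos_not_neg[OF True] by (auto simp: A_def)
    moreover have "card (insert \<alpha> B) = Suc (card B)"
      using fin by (simp add: B_def)
    ultimately show ?thesis by (simp add: weyl_sgn_def card_eq)
  next
    case False
    have "{\<beta> \<in> P. - w \<beta> \<in> P} = insert \<alpha> A"
      using False root_cases[OF w\<alpha>] \<alpha>P by (auto simp: A_def)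
    moreover have "{\<beta> \<in> P. - (w \<circ> reflect \<alpha>) \<beta> \<in> P} = B"
      using False neg by (auto simp: B_def)
    moreover have "card (insert \<alpha> A) = Suc (card A)"
      using fin by (simp add: A_def)
    ultimately show ?thesis by (simp add: weyl_sgn_def card_eq)
  qed
qed

lemma reflect_conj_eq:
  assumes "w \<in> W"
  shows "reflect (w \<alpha>) = w \<circ> reflect \<alpha> \<circ> inv w"
  using reflect_conj[OF weyl_orthogonal[OF assms], of \<alpha>] weyl_inv_apply[OF assms]
  by (auto simp: fun_eq_iff)

section \<open>Generation by simple reflections and the sign character\<close>

definition simple_words :: "('a \<Rightarrow> 'a) set" where
  "simple_words = reflect_word ` {\<alpha>s. set \<alpha>s \<subseteq> \<Phi>}"

lemma simple_words_subset: "simple_words \<subseteq> W"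
  using simple_subset by (auto simp: simple_words_def weyl_group_def)

lemma simple_words_comp: "w \<in> simple_words \<Longrightarrow> u \<in> simple_words \<Longrightarrow> w \<circ> u \<in> simple_words"
  unfolding simple_words_def by (auto simp flip: reflect_word_append intro!: imageI)

lemma simple_words_inv: "w \<in> simple_words \<Longrightarrow> inv w \<in> simple_words"
  unfolding simple_words_def by (auto simp: inv_reflect_word intro!: image_eqI)

lemma simple_words_reflect: "\<alpha> \<in> \<Phi> \<Longrightarrow> reflect \<alpha> \<in> simple_words"
  unfolding simple_words_def by (auto intro!: image_eqI[of _ _ "[\<alpha>]"])

text \<open>A positive root of minimal height among those whose reflection is not a product of simple
  reflections would become lower under a simple reflection.\<close>

lemma pos_reflect_simple_words:
  assumes "\<alpha> \<in> P"
  shows "reflect \<alpha> \<in> simple_words"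
proof (rule ccontr)
  assume bad: "reflect \<alpha> \<notin> simple_words"
  obtain ht :: "'a \<Rightarrow> real" where ht: "linear ht" "\<And>\<alpha>. \<alpha> \<in> P \<Longrightarrow> ht \<alpha> > 0"
    using positive_functional by blast
  define S where "S = {\<alpha> \<in> P. reflect \<alpha> \<notin> simple_words}"
  have S: "finite S" "S \<noteq> {}" using finite_pos assms bad by (auto simp: S_def)
  have "Min (ht ` S) \<in> ht ` S" using S by (intro Min_in) auto
  then obtain \<beta> where \<beta>: "\<beta> \<in> S" "ht \<beta> = Min (ht ` S)" by auto
  have min: "ht \<beta> \<le> ht \<gamma>" if "\<gamma> \<in> S" for \<gamma> using \<beta>(2) S that by simp
  have \<beta>P: "\<beta> \<in> P" and \<beta>bad: "reflect \<beta> \<notin> simple_words" using \<beta> by (auto simp: S_def)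
  \<comment> \<open>Otherwise expanding one factor in simple roots would give
    \<open>\<beta> \<bullet> \<beta> \<le> 0\<close>.\<close>
  have "\<exists>\<gamma>\<in>\<Phi>. \<beta> \<bullet> \<gamma> > 0"
  proof (rule ccontr)
    assume "\<not> ?thesis"
    then have "\<forall>\<gamma>\<in>\<Phi>. - (\<beta> \<bullet> \<gamma>) \<ge> 0" by (auto simp: not_less)
    then have "- \<beta> \<bullet> \<beta> \<ge> 0"
      by (intro pos_functional_nonneg[OF bounded_linear.linear[OF bounded_linear_inner_right] _ \<beta>P]) auto
    moreover have "\<beta> \<noteq> 0" using \<beta>P pos_subset zero_not_root by auto
    ultimately show False by (metis inner_gt_zero_iff inner_minus_left neg_0_le_iff_le not_le)
  qed
  then obtain \<gamma> where \<gamma>: "\<gamma> \<in> \<Phi>" "\<beta> \<bullet> \<gamma> > 0" by blast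
  have "\<beta> \<noteq> \<gamma>" using \<beta>bad simple_words_reflect[OF \<gamma>(1)] by auto
  then have pos: "reflect \<gamma> \<beta> \<in> P" using simple_reflect_pos \<gamma>(1) \<beta>P by blast
  have "ht (reflect \<gamma> \<beta>) = ht \<beta> - 2 * (\<beta> \<bullet> \<gamma>) / (\<gamma> \<bullet> \<gamma>) * ht \<gamma>"
    using ht(1) by (simp add: reflect_def linear_diff linear_cmul)
  moreover have "2 * (\<beta> \<bullet> \<gamma>) / (\<gamma> \<bullet> \<gamma>) * ht \<gamma> > 0"
    using \<gamma> ht(2)[OF simple_pos[OF \<gamma>(1)]] simple_nonzero[OF \<gamma>(1)] by simp
  ultimately have "reflect \<gamma> \<beta> \<notin> S" using min[of "reflect \<gamma> \<beta>"] by auto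
  then have *: "reflect (reflect \<gamma> \<beta>) \<in> simple_words" using pos by (simp add: S_def)
  have sW: "reflect \<gamma> \<in> simple_words" using \<gamma>(1) by (rule simple_words_reflect)
  \<comment> \<open>The reflection in the lower root is conjugate to the one in
    \<open>\<beta>\<close> by a simple reflection.\<close>
  have "reflect \<beta> = reflect \<gamma> \<circ> reflect (reflect \<gamma> \<beta>) \<circ> inv (reflect \<gamma>)"
    using reflect_conj_eq[of "reflect \<gamma>" "reflect \<gamma> \<beta>"] sW simple_words_subset by auto
  then have "reflect \<beta> \<in> simple_words"
    using * sW by (auto intro!: simple_words_comp simple_words_inv)
  with \<beta>bad show False ..
qed

lemma weyl_group_simple_words: "W = simple_words"
proof (intro equalityI subsetI)
  fix w assume "w \<in> W"
  then show "w \<in> simple_words"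
  proof (induction rule: weyl_group_induct)
    case id
    show ?case unfolding simple_words_def by (rule image_eqI[of _ _ "[]"]) (simp_all add: id_def)
  next
    case (step \<alpha> w)
    have "reflect \<alpha> \<in> simple_words"
      using root_cases[OF step(1)] pos_reflect_simple_words reflect_uminus by metis
    with step(3) show ?case by (rule simple_words_comp[rotated])
  qed
qed (use simple_words_subset in blast)

lemma weyl_sgn_word: "set \<alpha>s \<subseteq> \<Phi> \<Longrightarrow> weyl_sgn (reflect_word \<alpha>s) = (-1) ^ length \<alpha>s"
proof (induction \<alpha>s rule: rev_induct)
  case (snoc \<alpha> \<alpha>s)
  then have "reflect_word \<alpha>s \<in> W" using simple_words_subset by (auto simp: simple_words_def)
  with snoc show ?case
    using weyl_sgn_comp_simple[of "reflect_word \<alpha>s" \<alpha>]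
    by (simp add: reflect_word_append o_def)
qed (simp add: weyl_sgn_id del: id_apply)

lemma weyl_word:
  assumes "w \<in> W"
  obtains \<alpha>s where "set \<alpha>s \<subseteq> \<Phi>" "w = reflect_word \<alpha>s"
  using assms by (auto simp: weyl_group_simple_words simple_words_def)

lemma weyl_sgn_comp:
  assumes "w \<in> W" "u \<in> W"
  shows "weyl_sgn (w \<circ> u) = weyl_sgn w * weyl_sgn u"
proof -
  obtain \<alpha>s where a: "set \<alpha>s \<subseteq> \<Phi>" "w = reflect_word \<alpha>s" using assms(1) by (rule weyl_word)
  obtain \<beta>s where b: "set \<beta>s \<subseteq> \<Phi>" "u = reflect_word \<beta>s" using assms(2) by (rule weyl_word)
  have "weyl_sgn (reflect_word (\<alpha>s @ \<beta>s)) = (-1) ^ length (\<alpha>s @ \<beta>s)"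
    using a b by (intro weyl_sgn_word) auto
  then show ?thesis using a b by (simp add: reflect_word_append weyl_sgn_word power_add)
qed

text \<open>Generation by simple reflections makes the \<open>LEAST\<close> in the length attained,
  and every word for \<open>w\<close> has the parity of the inversion count.\<close>

lemma weyl_sgn_length:
  assumes "w \<in> W"
  shows "(-1) ^ weyl_length \<Phi> w = weyl_sgn w"
proof -
  have "\<exists>n \<alpha>s. length \<alpha>s = n \<and> set \<alpha>s \<subseteq> \<Phi> \<and> reflect_word \<alpha>s = w"
    using assms by (metis weyl_word)
  then have "\<exists>\<alpha>s. length \<alpha>s = weyl_length \<Phi> w \<and> set \<alpha>s \<subseteq> \<Phi> \<and> reflect_word \<alpha>s = w"
    unfolding weyl_length_def by (rule LeastI_ex)
  then show ?thesis using weyl_sgn_word by auto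
qed

lemma weyl_sgn_square: "weyl_sgn w * weyl_sgn w = 1"
  by (simp add: weyl_sgn_def flip: power_add)

lemma weyl_sgn_inv:
  assumes "w \<in> W"
  shows "weyl_sgn (inv w) = weyl_sgn w"
proof -
  have "weyl_sgn (inv w) * weyl_sgn w = 1"
    using weyl_sgn_comp[OF weyl_inv[OF assms] assms] weyl_sgn_id weyl_bij[OF assms]
    by (simp add: bij_is_inj)
  then show ?thesis using weyl_sgn_square[of w]
    by (metis mult.assoc mult.commute mult_1)
qed

text \<open>The exchange condition. Let the letters act on \<open>\<alpha>\<close> one after the
  other. A simple reflection makes only its own root negative, so just before the sign changes the
  image of \<open>\<alpha>\<close> is the simple root of the next letter. That letter is then
  conjugate to the reflection in \<open>\<alpha>\<close> and cancels against it.\<close>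

lemma exchange:
  assumes "\<alpha> \<in> \<Phi>" "set \<alpha>s \<subseteq> \<Phi>" "- reflect_word \<alpha>s \<alpha> \<in> P"
  shows "\<exists>\<beta>s. length \<beta>s < length \<alpha>s \<and> set \<beta>s \<subseteq> \<Phi> \<and> reflect_word \<alpha>s \<circ> reflect \<alpha> = reflect_word \<beta>s"
  using assms(2,3)
proof (induction \<alpha>s)
  case Nil
  then show ?case using pos_not_neg[OF simple_pos[OF assms(1)]] by simp
next
  case (Cons \<gamma> \<alpha>s)
  define v where "v = reflect_word \<alpha>s"
  have \<gamma>: "\<gamma> \<in> \<Phi>" and \<alpha>s: "set \<alpha>s \<subseteq> \<Phi>" using Cons.prems by auto
  have vW: "v \<in> W" using \<alpha>s simple_words_subset by (auto simp: v_def simple_words_def)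
  have v\<alpha>: "v \<alpha> \<in> \<Delta>" using vW assms(1) simple_subset weyl_root by blast
  show ?case
  proof (cases "v \<alpha> \<in> P")
    case True
    have "- reflect \<gamma> (v \<alpha>) \<in> P" using Cons.prems(2) by (simp add: v_def)
    then have "v \<alpha> = \<gamma>"
      using simple_reflect_pos[OF \<gamma> True] pos_not_neg by blast
    then have "reflect \<gamma> = v \<circ> reflect \<alpha> \<circ> inv v" using reflect_conj_eq[OF vW, of \<alpha>] by simp
    then have "reflect \<gamma> \<circ> v \<circ> reflect \<alpha> = v"
      using weyl_inv_apply[OF vW] by (auto simp: fun_eq_iff)
    then show ?thesis using \<alpha>s by (intro exI[of _ \<alpha>s]) (simp add: v_def fun_eq_iff)
  next
    case False
    then have "- v \<alpha> \<in> P" using root_cases[OF v\<alpha>] by blast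
    then obtain \<beta>s where "length \<beta>s < length \<alpha>s" "set \<beta>s \<subseteq> \<Phi>" "v \<circ> reflect \<alpha> = reflect_word \<beta>s"
      using Cons.IH \<alpha>s unfolding v_def by blast
    then show ?thesis
      using \<gamma> by (intro exI[of _ "\<gamma> # \<beta>s"]) (auto simp: v_def fun_eq_iff)
  qed
qed

text \<open>If \<open>\<alpha>\<close> is the last letter of a nonempty word, positivity of its
  image says that the rest of the word makes \<open>\<alpha>\<close> negative. The exchange
  condition then yields a shorter word for the same element.\<close>

lemma no_inversions_imp_id:
  assumes "w \<in> W" "\<And>\<beta>. \<beta> \<in> P \<Longrightarrow> w \<beta> \<in> P"
  shows "w = id"
proof -
  have "reflect_word \<alpha>s = id"
    if "set \<alpha>s \<subseteq> \<Phi>" "\<And>\<beta>. \<beta> \<in> P \<Longrightarrow> reflect_word \<alpha>s \<beta> \<in> P" for \<alpha>s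
    using that
  proof (induction "length \<alpha>s" arbitrary: \<alpha>s rule: less_induct)
    case less
    show ?case
    proof (cases \<alpha>s rule: rev_cases)
      case (snoc \<beta>s \<alpha>)
      have \<alpha>: "\<alpha> \<in> \<Phi>" and \<beta>s: "set \<beta>s \<subseteq> \<Phi>" using less.prems(1) snoc by auto
      have "reflect_word \<alpha>s \<alpha> = - reflect_word \<beta>s \<alpha>"
        using reflect_word_orthogonal[of \<beta>s] reflect_self[OF simple_nonzero[OF \<alpha>]]
        by (simp add: snoc reflect_word_append orthogonal_transformation_def linear_neg)
      then have "- reflect_word \<beta>s \<alpha> \<in> P" using less.prems(2)[OF simple_pos[OF \<alpha>]] by simp
      from exchange[OF \<alpha> \<beta>s this] obtain \<gamma>s where
        \<gamma>s: "length \<gamma>s < length \<beta>s" "set \<gamma>s \<subseteq> \<Phi>" "reflect_word \<alpha>s = reflect_word \<gamma>s"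
        by (auto simp: snoc reflect_word_append)
      with less snoc show ?thesis by simp
    qed simp
  qed
  then show ?thesis using assms weyl_word by metis
qed

text \<open>Among the roots, the positive ones are those with positive inner product with
  \<open>\<rho>\<close>, and \<open>w\<close> preserves these inner products.\<close>

lemma weyl_rho_stabilizer:
  assumes "w \<in> W" "w \<rho> = \<rho>"
  shows "w = id"
proof (rule no_inversions_imp_id[OF assms(1)])
  fix \<beta> assume \<beta>: "\<beta> \<in> P"
  have "\<rho> \<bullet> w \<beta> = \<rho> \<bullet> \<beta>" using weyl_inner[OF assms(1), of \<rho> \<beta>] assms(2) by simp
  then have "\<rho> \<bullet> w \<beta> > 0" using rho_pos[OF \<beta>] by simp
  moreover have "w \<beta> \<in> \<Delta>" using \<beta> assms(1) pos_subset weyl_root by blast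
  ultimately show "w \<beta> \<in> P" using root_cases rho_pos[of "- w \<beta>"] by force
qed

text \<open>Obtained as the inverse of an element that makes \<open>- \<rho>\<close> dominant: it
  sends every positive root to a root with negative inner product with
  \<open>\<rho>\<close>.\<close>

lemma longest_element:
  obtains w where "w \<in> W" "\<And>\<beta>. \<beta> \<in> P \<Longrightarrow> - w \<beta> \<in> P" "w \<rho> = - \<rho>"
    "weyl_sgn w = (-1) ^ card P" "bij_betw (\<lambda>\<beta>. - w \<beta>) P P"
proof -
  obtain u where u: "u \<in> W" "\<And>\<alpha>. \<alpha> \<in> \<Phi> \<Longrightarrow> u (- \<rho>) \<bullet> \<alpha> \<ge> 0"
    using dominant_exists by blast
  define w where "w = inv u"
  have wW: "w \<in> W" using u weyl_inv by (simp add: w_def)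
  have neg: "- w \<beta> \<in> P" if \<beta>: "\<beta> \<in> P" for \<beta>
  proof -
    have "u (- \<rho>) \<bullet> \<beta> \<ge> 0"
      using pos_functional_nonneg[OF bounded_linear.linear[OF bounded_linear_inner_right] u(2) \<beta>] .
    then have "- \<rho> \<bullet> w \<beta> \<ge> 0" using weyl_inner_swap[OF u(1)] by (simp add: w_def)
    moreover have "w \<beta> \<in> \<Delta>" using \<beta> wW pos_subset weyl_root by blast
    ultimately show ?thesis using root_cases rho_pos[of "w \<beta>"] by force
  qed
  have inj: "inj_on (\<lambda>\<beta>. - w \<beta>) P"
    using weyl_inv_apply(1)[OF wW] by (intro inj_onI) (metis neg_equal_iff_equal)
  have img: "(\<lambda>\<beta>. - w \<beta>) ` P = P"
    using neg inj finite_pos by (intro endo_inj_surj) auto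
  have bij: "bij_betw (\<lambda>\<beta>. - w \<beta>) P P" using inj img by (simp add: bij_betw_def)
  have "- (\<Sum>\<beta>\<in>P. w \<beta>) = (\<Sum>\<beta>\<in>P. \<beta>)"
    using sum.reindex_bij_betw[OF bij, of "\<lambda>x. x"] by (simp add: sum_negf)
  then have "(\<Sum>\<beta>\<in>P. w \<beta>) = - (\<Sum>\<beta>\<in>P. \<beta>)"
    by (rule minus_equation_iff[THEN iffD1, symmetric])
  then have "w \<rho> = - \<rho>"
    using weyl_linear[OF wW]
    by (simp add: weyl_vector_def linear_cmul linear_sum[of w])
  moreover have "{\<beta> \<in> P. - w \<beta> \<in> P} = P" using neg by auto
  then have "weyl_sgn w = (-1) ^ card P" by (simp add: weyl_sgn_def)
  ultimately show thesis using that wW neg bij by blast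
qed

end

section \<open>The Weyl denominator formula\<close>

lemma lookup_single_mult:
  fixes p :: "'a::ab_group_add \<Rightarrow>\<^sub>0 'b::semiring_0"
  shows "Poly_Mapping.lookup (Poly_Mapping.single a c * p) \<mu> = c * Poly_Mapping.lookup p (\<mu> - a)"
proof -
  have "(\<Sum>q. Poly_Mapping.lookup p q when \<mu> = l + q) = Poly_Mapping.lookup p (\<mu> - l)" for l
  proof -
    have "(\<lambda>q. Poly_Mapping.lookup p q when \<mu> = l + q) = (\<lambda>q. Poly_Mapping.lookup p q when q = \<mu> - l)"
      by (intro ext arg_cong2[of _ _ _ _ "(when)"]) (auto simp: algebra_simps)
    then show ?thesis by (simp only: Sum_any_when_equal)
  qed
  then have "Poly_Mapping.lookup (Poly_Mapping.single a c * p) \<mu>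
      = (\<Sum>l. Poly_Mapping.lookup (Poly_Mapping.single a c) l * Poly_Mapping.lookup p (\<mu> - l))"
    by (simp add: lookup_mult)
  also have "\<dots> = (\<Sum>l. c * Poly_Mapping.lookup p (\<mu> - a) when a = l)"
    by (intro arg_cong[of _ _ Sum_any] ext) (auto simp: lookup_single when_def)
  also have "\<dots> = c * Poly_Mapping.lookup p (\<mu> - a)" by simp
  finally show ?thesis .
qed

section \<open>The product side of the denominator formula and multiplication by D\<close>

context based_root_system
begin

text \<open>The coefficient of \<open>x^\<mu>\<close> in the product
  \<open>x^\<rho> \<Prod>(1 - x^-\<alpha>)\<close> over positive roots, multiplied out over
  subsets.\<close>

definition denom_coeff :: "'a \<Rightarrow> rat" where
  "denom_coeff \<mu> = (\<Sum>S\<in>Pow P. if \<rho> - \<Sum>S = \<mu> then (-1) ^ card S else 0)"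

lemma denom_coeff_support:
  assumes "denom_coeff \<mu> \<noteq> 0"
  obtains S where "S \<subseteq> P" "\<mu> = \<rho> - \<Sum>S"
proof -
  from assms obtain S where "S \<in> Pow P" "(if \<rho> - \<Sum>S = \<mu> then (-1) ^ card S else (0::rat)) \<noteq> 0"
    unfolding denom_coeff_def by (rule sum.not_neutral_contains_not_neutral)
  then show thesis using that[of S] by (auto split: if_splits)
qed

text \<open>A nonempty sum of positive roots has positive height, so only the empty subset
  contributes.\<close>

lemma denom_coeff_rho: "denom_coeff \<rho> = 1"
proof -
  obtain ht :: "'a \<Rightarrow> real" where ht: "linear ht" "\<And>\<alpha>. \<alpha> \<in> P \<Longrightarrow> ht \<alpha> > 0"
    using positive_functional by blast
  have "S = {}" if "S \<subseteq> P" "\<Sum>S = 0" for S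
  proof (rule ccontr)
    assume "S \<noteq> {}"
    then have "(\<Sum>\<alpha>\<in>S. ht \<alpha>) > 0"
      using that ht finite_subset[OF that(1) finite_pos] by (intro sum_pos) auto
    moreover have "(\<Sum>\<alpha>\<in>S. ht \<alpha>) = ht (\<Sum>S)" using ht(1) by (simp add: linear_sum)
    ultimately show False using that(2) ht(1) by (simp add: linear_0)
  qed
  then have "denom_coeff \<rho> = (\<Sum>S\<in>Pow P. if S = {} then 1 else 0)"
    unfolding denom_coeff_def by (intro sum.cong) auto
  then show ?thesis using finite_pos by simp
qed

text \<open>Complementation of subsets replaces \<open>\<Sum>S\<close> by
  \<open>2 \<rho> - \<Sum>S\<close>, which negates the exponent
  \<open>\<rho> - \<Sum>S\<close>.\<close>

lemma denom_coeff_uminus: "denom_coeff (- \<mu>) = (-1) ^ card P * denom_coeff \<mu>"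
proof -
  have two: "\<Sum>P = 2 *\<^sub>R \<rho>" by (simp add: weyl_vector_def)
  have "denom_coeff (- \<mu>) = (\<Sum>S\<in>Pow P. if \<rho> - \<Sum>(P - S) = - \<mu> then (-1) ^ card (P - S) else 0)"
    unfolding denom_coeff_def
    by (rule sum.reindex_bij_witness[of _ "\<lambda>S. P - S" "\<lambda>S. P - S"]) (auto simp: double_diff)
  also have "\<dots> = (\<Sum>S\<in>Pow P. if \<rho> - \<Sum>S = \<mu> then (-1) ^ card P * (-1) ^ card S else 0)"
  proof (intro sum.cong refl)
    fix S assume "S \<in> Pow P"
    then have S: "S \<subseteq> P" "finite S" using finite_pos finite_subset by auto
    have "\<rho> - \<Sum>(P - S) = - (\<rho> - \<Sum>S)"
      using sum_diff[OF finite_pos S(1), of "\<lambda>x. x"] two by (simp add: scaleR_2)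
    moreover have "(-1) ^ card P = (-1) ^ card (P - S) * ((-1::rat) ^ card S)"
      using card_Diff_subset[OF S(2,1)] card_mono[OF finite_pos S(1)] by (simp flip: power_add)
    then have "(-1) ^ card (P - S) = (-1) ^ card P * ((-1::rat) ^ card S)"
      by (simp add: mult.assoc flip: power_mult_distrib)
    ultimately show "(if \<rho> - \<Sum>(P - S) = - \<mu> then (-1) ^ card (P - S) else 0) =
        (if \<rho> - \<Sum>S = \<mu> then (-1) ^ card P * (-1) ^ card S else (0::rat))"
      by (simp only: neg_equal_iff_equal)
  qed
  also have "\<dots> = (-1) ^ card P * denom_coeff \<mu>"
    by (simp add: denom_coeff_def sum_distrib_left if_distrib[of "(*) _"] cong: if_cong)
  finally show ?thesis .
qed

text \<open>Written as a product of \<open>x^(\<beta>/2) - x^(-\<beta>/2)\<close>, the denominator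
  has its factor for \<open>\<alpha>\<close> negated and the other factors permuted.\<close>

lemma denom_coeff_reflect:
  assumes \<alpha>: "\<alpha> \<in> \<Phi>"
  shows "denom_coeff (reflect \<alpha> \<mu>) = - denom_coeff \<mu>"
proof -
  \<comment> \<open>On subsets: toggle \<open>\<alpha>\<close> and reflect the rest. Toggling
    accounts both for the sign and for the \<open>\<alpha>\<close> that \<open>\<rho>\<close> loses
    under the reflection.\<close>
  define \<tau> where "\<tau> S = (if \<alpha> \<in> S then reflect \<alpha> ` (S - {\<alpha>}) else insert \<alpha> (reflect \<alpha> ` S))" for S
  have inj: "inj (reflect \<alpha>)" by (metis injI reflect_reflect)
  have refl_img: "reflect \<alpha> ` reflect \<alpha> ` S = S" for S by (simp add: image_image)
  have \<alpha>P: "\<alpha> \<in> P" using \<alpha> by (rule simple_pos)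
  have mem: "reflect \<alpha> \<beta> \<in> P" "reflect \<alpha> \<beta> \<noteq> \<alpha>" if "\<beta> \<in> P" "\<beta> \<noteq> \<alpha>" for \<beta>
  proof -
    have "reflect \<alpha> \<beta> \<in> reflect \<alpha> ` (P - {\<alpha>})" using that by (intro imageI) auto
    then show "reflect \<alpha> \<beta> \<in> P" "reflect \<alpha> \<beta> \<noteq> \<alpha>"
      unfolding simple_reflect_pos_image[OF \<alpha>] by auto
  qed
  have \<tau>P: "\<tau> S \<in> Pow P" if "S \<in> Pow P" for S
  proof -
    have "reflect \<alpha> ` (S - {\<alpha>}) \<subseteq> P" using that mem(1) by blast
    then show ?thesis using that \<alpha>P by (cases "\<alpha> \<in> S") (simp_all add: \<tau>_def)
  qed
  have nin: "\<alpha> \<notin> reflect \<alpha> ` S" if "S \<subseteq> P - {\<alpha>}" for S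
  proof
    assume "\<alpha> \<in> reflect \<alpha> ` S"
    then obtain \<beta> where "\<beta> \<in> S" "\<alpha> = reflect \<alpha> \<beta>" by (rule imageE)
    moreover from this have "\<beta> \<in> P" "\<beta> \<noteq> \<alpha>" using that by auto
    ultimately show False using mem(2)[of \<beta>] by simp
  qed
  have \<tau>\<tau>: "\<tau> (\<tau> S) = S" if "S \<in> Pow P" for S
  proof (cases "\<alpha> \<in> S")
    case True
    then have "\<alpha> \<notin> reflect \<alpha> ` (S - {\<alpha>})" using nin that by blast
    with True show ?thesis by (simp add: \<tau>_def refl_img insert_absorb)
  next
    case False
    then have "\<alpha> \<notin> reflect \<alpha> ` S" using nin[of S] that by blast
    with False show ?thesis by (simp add: \<tau>_def refl_img)
  qed
  have key: "\<rho> - \<Sum>(\<tau> S) = reflect \<alpha> (\<rho> - \<Sum>S) \<and> (-1::rat) ^ card (\<tau> S) = - ((-1) ^ card S)"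
    if "S \<in> Pow P" for S
  proof -
    have fin: "finite S" using that finite_pos finite_subset by auto
    have sum: "\<Sum>(reflect \<alpha> ` T) = reflect \<alpha> (\<Sum>T)" for T
      using sum.reindex[OF inj_on_subset[OF inj subset_UNIV], of "\<lambda>x. x" T]
      by (simp add: linear_sum[OF reflect_linear])
    have lin: "reflect \<alpha> (\<rho> - \<Sum>S) = \<rho> - \<alpha> - reflect \<alpha> (\<Sum>S)"
      using reflect_linear[of \<alpha>] reflect_rho[OF \<alpha>] by (simp add: linear_diff)
    have cardr: "card (reflect \<alpha> ` T) = card T" for T
      using inj by (simp add: card_image inj_on_subset)
    show ?thesis
    proof (cases "\<alpha> \<in> S")
      case True
      then obtain T where T: "S = insert \<alpha> T" "\<alpha> \<notin> T" by (rule mk_disjoint_insert[THEN exE]) auto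
      then have "finite T" "\<tau> S = reflect \<alpha> ` T" using fin by (auto simp: \<tau>_def)
      moreover have "reflect \<alpha> (\<alpha> + \<Sum>T) = - \<alpha> + reflect \<alpha> (\<Sum>T)"
        using linear_add[OF reflect_linear] reflect_self[OF simple_nonzero[OF \<alpha>]] by metis
      ultimately show ?thesis using T lin by (simp add: sum cardr)
    next
      case False
      then have "\<alpha> \<notin> reflect \<alpha> ` S" using nin[of S] that by blast
      with False fin lin show ?thesis by (simp add: \<tau>_def sum cardr)
    qed
  qed
  have "denom_coeff (reflect \<alpha> \<mu>) =
      (\<Sum>S\<in>Pow P. if \<rho> - \<Sum>(\<tau> S) = reflect \<alpha> \<mu> then (-1) ^ card (\<tau> S) else 0)"
    unfolding denom_coeff_def
    by (rule sum.reindex_bij_witness[of _ \<tau> \<tau>]) (simp_all add: \<tau>\<tau> \<tau>P del: Pow_iff)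
  also have "\<dots> = (\<Sum>S\<in>Pow P. - (if \<rho> - \<Sum>S = \<mu> then (-1) ^ card S else 0))"
    using key inj by (intro sum.cong) (auto simp: inj_eq)
  also have "\<dots> = - denom_coeff \<mu>" by (simp add: denom_coeff_def sum_negf)
  finally show ?thesis .
qed

lemma denom_coeff_weyl:
  assumes "w \<in> W"
  shows "denom_coeff (w \<mu>) = weyl_sgn w * denom_coeff \<mu>"
proof -
  have "denom_coeff (reflect_word \<alpha>s \<mu>) = (-1) ^ length \<alpha>s * denom_coeff \<mu>" if "set \<alpha>s \<subseteq> \<Phi>" for \<alpha>s
    using that by (induction \<alpha>s) (auto simp: denom_coeff_reflect)
  then show ?thesis using assms weyl_word weyl_sgn_word by metis
qed

text \<open>An exponent in the support that is dominant is regular, hence of the form \<open>\<rho> + \<nu>\<close> with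
  \<open>\<nu>\<close> dominant; being minus a sum of positive roots, \<open>\<nu>\<close> satisfies \<open>\<nu> \<bullet> \<nu> \<le> 0\<close>.\<close>

lemma denom_coeff_support_orbit:
  assumes "denom_coeff \<mu> \<noteq> 0"
  obtains w where "w \<in> W" "w \<mu> = \<rho>"
proof -
  obtain w where w: "w \<in> W" "\<And>\<alpha>. \<alpha> \<in> \<Phi> \<Longrightarrow> w \<mu> \<bullet> \<alpha> \<ge> 0"
    using dominant_exists by blast
  have nz: "denom_coeff (w \<mu>) \<noteq> 0"
    using assms denom_coeff_weyl[OF w(1)] weyl_sgn_square[of w] by auto
  then obtain S where S: "S \<subseteq> P" "w \<mu> = \<rho> - \<Sum>S" by (rule denom_coeff_support)
  define \<nu> where "\<nu> = - \<Sum>S"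
  have dom: "\<nu> \<bullet> \<alpha> \<ge> 0" if \<alpha>: "\<alpha> \<in> \<Phi>" for \<alpha>
  proof -
    have aa: "\<alpha> \<bullet> \<alpha> > 0" using simple_nonzero[OF \<alpha>] by simp
    have "w \<mu> \<bullet> \<alpha> \<noteq> 0"
    proof
      assume "w \<mu> \<bullet> \<alpha> = 0"
      \<comment> \<open>On a wall, antisymmetry makes the coefficient equal to its own
        negative.\<close>
      then have "reflect \<alpha> (w \<mu>) = w \<mu>" by (simp add: reflect_def)
      then have "denom_coeff (w \<mu>) = - denom_coeff (w \<mu>)"
        using denom_coeff_reflect[OF \<alpha>, of "w \<mu>"] by simp
      with nz show False by simp
    qed
    with w(2)[OF \<alpha>] have "w \<mu> \<bullet> \<alpha> > 0" by linarith
    moreover have "w \<mu> \<bullet> \<alpha> = \<rho> \<bullet> \<alpha> - (\<Sum>\<beta>\<in>S. \<beta> \<bullet> \<alpha>)"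
      by (simp add: S(2) inner_diff_left inner_sum_left)
    ultimately have "2 * (\<rho> \<bullet> \<alpha>) - (\<Sum>\<beta>\<in>S. 2 * (\<beta> \<bullet> \<alpha>)) > 0"
      by (simp add: sum_distrib_left[symmetric])
    then have "\<alpha> \<bullet> \<alpha> - (\<Sum>\<beta>\<in>S. 2 * (\<beta> \<bullet> \<alpha>)) > 0" by (simp add: rho_simple[OF \<alpha>])
    then have "(\<Sum>\<beta>\<in>S. 2 * (\<beta> \<bullet> \<alpha>)) / (\<alpha> \<bullet> \<alpha>) < 1" using aa by simp
    then have lt: "(\<Sum>\<beta>\<in>S. 2 * (\<beta> \<bullet> \<alpha>) / (\<alpha> \<bullet> \<alpha>)) < 1" by (simp add: sum_divide_distrib)
    \<comment> \<open>As \<open>\<rho>\<close> pairs to 1 with the simple coroot, regularity only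
      gives the bound 1; integrality lowers a value below 1 to at most 0.\<close>
    have "(\<Sum>\<beta>\<in>S. 2 * (\<beta> \<bullet> \<alpha>) / (\<alpha> \<bullet> \<alpha>)) \<in> \<int>"
      using S(1) \<alpha> simple_subset pos_subset by (intro Ints_sum cartan_int) auto
    then obtain n where n: "(\<Sum>\<beta>\<in>S. 2 * (\<beta> \<bullet> \<alpha>) / (\<alpha> \<bullet> \<alpha>)) = of_int n" by (auto elim: Ints_cases)
    with lt have "n \<le> 0" by simp
    then have "(\<Sum>\<beta>\<in>S. 2 * (\<beta> \<bullet> \<alpha>) / (\<alpha> \<bullet> \<alpha>)) \<le> 0" using n by simp
    moreover have "(\<Sum>\<beta>\<in>S. 2 * (\<beta> \<bullet> \<alpha>) / (\<alpha> \<bullet> \<alpha>)) = 2 * (\<Sum>\<beta>\<in>S. \<beta> \<bullet> \<alpha>) / (\<alpha> \<bullet> \<alpha>)"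
      by (simp only: sum_divide_distrib[symmetric] sum_distrib_left[symmetric])
    ultimately have "(\<Sum>\<beta>\<in>S. \<beta> \<bullet> \<alpha>) \<le> 0" using aa by (simp add: divide_le_0_iff)
    then show ?thesis by (simp add: \<nu>_def inner_sum_left)
  qed
  have "\<nu> \<bullet> \<beta> \<ge> 0" if "\<beta> \<in> P" for \<beta>
    by (rule pos_functional_nonneg[OF bounded_linear.linear[OF bounded_linear_inner_right] dom that])
  then have "(\<Sum>\<beta>\<in>S. \<nu> \<bullet> \<beta>) \<ge> 0" using S(1) by (intro sum_nonneg) auto
  then have "\<nu> \<bullet> \<nu> \<le> 0" by (simp add: \<nu>_def inner_sum_right)
  then have "\<nu> = 0" by (metis inner_gt_zero_iff not_le)
  then have "w \<mu> = \<rho>" using S(2) by (simp add: \<nu>_def)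
  with w(1) that show thesis by blast
qed

lemma weyl_denom_lookup: "Poly_Mapping.lookup (weyl_denom \<Delta> \<Phi>) \<mu> = (\<Sum>w\<in>W. if w \<rho> = \<mu> then weyl_sgn w else 0)"
  by (simp add: weyl_denom_def lookup_sum lookup_single when_def weyl_sgn_length)

text \<open>The product is antisymmetric, supported in the orbit of \<open>\<rho>\<close> and has
  coefficient 1 at \<open>\<rho>\<close>. Since the stabilizer of \<open>\<rho>\<close> is trivial,
  each orbit point comes from exactly one term of the alternating sum, with the same sign.\<close>

theorem weyl_denominator_formula: "Poly_Mapping.lookup (weyl_denom \<Delta> \<Phi>) \<mu> = denom_coeff \<mu>"
proof (cases "\<exists>w\<in>W. w \<rho> = \<mu>")
  case True
  then obtain w where w: "w \<in> W" "w \<rho> = \<mu>" by blast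
  have uniq: "u = w" if "u \<in> W" "u \<rho> = \<mu>" for u
  proof -
    have "inv w \<circ> u = id"
      using that w weyl_inv_apply(1)[OF w(1), of \<rho>] by (intro weyl_rho_stabilizer weyl_comp weyl_inv) auto
    then show "u = w" using weyl_inv_apply(2)[OF w(1)] by (metis comp_apply ext id_apply)
  qed
  then have "(\<Sum>u\<in>W. if u \<rho> = \<mu> then weyl_sgn u else 0) = (\<Sum>u\<in>W. if u = w then weyl_sgn u else 0)"
  proof (intro sum.cong refl)
    fix u assume "u \<in> W"
    then have "u \<rho> = \<mu> \<longleftrightarrow> u = w" using uniq w(2) by blast
    then show "(if u \<rho> = \<mu> then weyl_sgn u else 0) = (if u = w then weyl_sgn u else 0)" by simp
  qed
  also have "\<dots> = denom_coeff \<mu>"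
    using w finite_weyl denom_coeff_weyl[OF w(1), of \<rho>] by (simp add: denom_coeff_rho)
  finally show ?thesis by (simp add: weyl_denom_lookup)
next
  case False
  have "denom_coeff \<mu> = 0"
  proof (rule ccontr)
    assume "denom_coeff \<mu> \<noteq> 0"
    then obtain w where w: "w \<in> W" "w \<mu> = \<rho>" by (rule denom_coeff_support_orbit)
    then have "inv w \<rho> = \<mu>" using weyl_inv_apply(1) by metis
    with False w(1) weyl_inv show False by blast
  qed
  with False show ?thesis by (auto simp: weyl_denom_lookup intro: sum.neutral)
qed

text \<open>Multiplication of a possibly infinite series by D, always a finite sum because D has
  finite support. The form \<open>denom_mult_weyl\<close> suits symmetry arguments,
  \<open>denom_mult_product\<close> the cancellation of geometric series.\<close>

definition denom_mult :: "('a \<Rightarrow> rat) \<Rightarrow> 'a \<Rightarrow> rat" where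
  "denom_mult f \<mu> = (\<Sum>\<nu>\<in>Poly_Mapping.keys (weyl_denom \<Delta> \<Phi>). denom_coeff \<nu> * f (\<mu> - \<nu>))"

lemma denom_mult_superset:
  assumes "finite K" "\<And>\<nu>. denom_coeff \<nu> \<noteq> 0 \<Longrightarrow> \<nu> \<in> K"
  shows "denom_mult f \<mu> = (\<Sum>\<nu>\<in>K. denom_coeff \<nu> * f (\<mu> - \<nu>))"
  unfolding denom_mult_def using assms
  by (intro sum.mono_neutral_left) (auto simp: in_keys_iff weyl_denominator_formula)

lemma denom_mult_weyl: "denom_mult f \<mu> = (\<Sum>w\<in>W. weyl_sgn w * f (\<mu> - w \<rho>))"
proof -
  define K where "K = (\<lambda>w. w \<rho>) ` W"
  have K: "finite K" using finite_weyl by (simp add: K_def)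
  have "denom_mult f \<mu> = (\<Sum>\<nu>\<in>K. denom_coeff \<nu> * f (\<mu> - \<nu>))"
    using K
  proof (rule denom_mult_superset)
    fix \<nu> assume "denom_coeff \<nu> \<noteq> 0"
    then obtain w where w: "w \<in> W" "w \<nu> = \<rho>" by (rule denom_coeff_support_orbit)
    then have "inv w \<rho> = \<nu>" using weyl_inv_apply(1) by metis
    then show "\<nu> \<in> K" using weyl_inv[OF w(1)] by (auto simp: K_def)
  qed
  also have "\<dots> = (\<Sum>\<nu>\<in>K. \<Sum>w\<in>W. if w \<rho> = \<nu> then weyl_sgn w * f (\<mu> - \<nu>) else 0)"
    by (intro sum.cong refl, subst weyl_denominator_formula[symmetric])
      (auto simp: weyl_denom_lookup sum_distrib_right intro!: sum.cong)
  also have "\<dots> = (\<Sum>w\<in>W. \<Sum>\<nu>\<in>K. if w \<rho> = \<nu> then weyl_sgn w * f (\<mu> - \<nu>) else 0)"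
    by (rule sum.swap)
  also have "\<dots> = (\<Sum>w\<in>W. weyl_sgn w * f (\<mu> - w \<rho>))"
    using K by (intro sum.cong refl) (auto simp: K_def)
  finally show ?thesis .
qed

lemma denom_mult_product: "denom_mult f \<mu> = (\<Sum>S\<in>Pow P. (-1) ^ card S * f (\<mu> - \<rho> + \<Sum>S))"
proof -
  define K where "K = (\<lambda>S. \<rho> - \<Sum>S) ` Pow P"
  have K: "finite K" using finite_pos by (simp add: K_def)
  have "denom_mult f \<mu> = (\<Sum>\<nu>\<in>K. denom_coeff \<nu> * f (\<mu> - \<nu>))"
    using K by (rule denom_mult_superset) (auto simp: K_def elim!: denom_coeff_support)
  also have "\<dots> = (\<Sum>\<nu>\<in>K. \<Sum>S\<in>Pow P. if \<rho> - \<Sum>S = \<nu> then (-1) ^ card S * f (\<mu> - \<nu>) else 0)"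
    by (auto simp: denom_coeff_def sum_distrib_right intro!: sum.cong)
  also have "\<dots> = (\<Sum>S\<in>Pow P. \<Sum>\<nu>\<in>K. if \<rho> - \<Sum>S = \<nu> then (-1) ^ card S * f (\<mu> - \<nu>) else 0)"
    by (rule sum.swap)
  also have "\<dots> = (\<Sum>S\<in>Pow P. (-1) ^ card S * f (\<mu> - \<rho> + \<Sum>S))"
  proof (intro sum.cong refl)
    fix S assume "S \<in> Pow P"
    then have "\<rho> - \<Sum>S \<in> K" by (auto simp: K_def)
    then show "(\<Sum>\<nu>\<in>K. if \<rho> - \<Sum>S = \<nu> then (-1) ^ card S * f (\<mu> - \<nu>) else 0) =
        (-1) ^ card S * f (\<mu> - \<rho> + \<Sum>S)"
      using K by (simp add: diff_diff_eq2 diff_add_eq)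
  qed
  finally show ?thesis .
qed

lemma lookup_denom_mult:
  "Poly_Mapping.lookup (weyl_denom \<Delta> \<Phi> * p) \<mu> = denom_mult (Poly_Mapping.lookup p) \<mu>"
  by (simp add: denom_mult_weyl weyl_denom_def sum_distrib_right lookup_sum lookup_single_mult
      weyl_sgn_length)

end

section \<open>Vertex coefficients\<close>

lemma geom_series_nonzero: "{\<beta>. geom_series \<gamma> \<beta> \<noteq> 0} = range (\<lambda>k::nat. real k *\<^sub>R \<gamma>)"
  by (auto simp: geom_series_def split: if_splits)

text \<open>The terms that make up the coefficient of \<open>x^\<mu>\<close> in the product of the
  series in \<open>x^(- a i)\<close>. Tuples of exponents, rather than of multiplicities, agree with
  the index set of \<open>series_prod\<close>.\<close>

definition geom_terms :: "'i set \<Rightarrow> ('i \<Rightarrow> 'a::euclidean_space) \<Rightarrow> 'a \<Rightarrow> ('i \<Rightarrow> 'a) set" where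
  "geom_terms I a \<mu> =
     {\<nu> \<in> Pi\<^sub>E I (\<lambda>i. range (\<lambda>k::nat. real k *\<^sub>R - a i)). (\<Sum>i\<in>I. \<nu> i) = \<mu>}"

lemma series_prod_geom:
  assumes "finite I"
  shows "series_prod I (\<lambda>i. geom_series (- a i)) \<mu> = of_nat (card (geom_terms I a \<mu>))"
proof -
  have "series_prod I (\<lambda>i. geom_series (- a i)) \<mu> = (\<Sum>\<nu>\<in>geom_terms I a \<mu>. 1)"
    unfolding series_prod_def geom_series_nonzero geom_terms_def
  proof (intro sum.cong refl prod.neutral ballI)
    fix \<nu> i
    assume "\<nu> \<in> {\<nu> \<in> \<Pi>\<^sub>E i\<in>I. range (\<lambda>k. real k *\<^sub>R - a i). sum \<nu> I = \<mu>}" and "i \<in> I"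
    then have "\<nu> i \<in> range (\<lambda>k. real k *\<^sub>R - a i)" by auto
    then show "geom_series (- a i) (\<nu> i) = 1" unfolding geom_series_def by auto
  qed
  then show ?thesis by simp
qed

text \<open>All components have height at most 0 and the heights add up to \<open>ht \<mu>\<close>,
  so no single multiplicity exceeds \<open>- ht \<mu> / ht (a i)\<close>.\<close>

lemma finite_geom_terms:
  assumes "finite I" and ht: "linear ht" "\<And>i. i \<in> I \<Longrightarrow> ht (a i) > (0::real)"
  shows "finite (geom_terms I a \<mu>)"
proof -
  define K where "K i = (\<lambda>k::nat. real k *\<^sub>R - a i) ` {..nat \<lceil>- ht \<mu> / ht (a i)\<rceil>}" for i
  have "geom_terms I a \<mu> \<subseteq> Pi\<^sub>E I K"
  proof
    fix \<nu> assume \<nu>: "\<nu> \<in> geom_terms I a \<mu>"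
    have sum: "(\<Sum>i\<in>I. - ht (\<nu> i)) = - ht \<mu>"
      using \<nu> ht(1) by (auto simp: geom_terms_def linear_sum sum_negf)
    have val: "\<exists>k::nat. \<nu> i = real k *\<^sub>R - a i" if "i \<in> I" for i
      using \<nu> that unfolding geom_terms_def by auto
    have htval: "ht (real k *\<^sub>R - a i) = - (real k * ht (a i))" for k i
      using ht(1) by (simp add: linear_cmul linear_neg)
    have nonneg: "- ht (\<nu> i) \<ge> 0" if "i \<in> I" for i
      using val[OF that] ht(2)[OF that] htval by (auto simp del: scaleR_minus_right)
    have "\<nu> i \<in> K i" if i: "i \<in> I" for i
    proof -
      obtain k :: nat where k: "\<nu> i = real k *\<^sub>R - a i" using val[OF i] by blast
      have "- ht (\<nu> i) \<le> - ht \<mu>"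
        unfolding sum[symmetric] using nonneg assms(1) i by (intro member_le_sum) auto
      then have "real k * ht (a i) \<le> - ht \<mu>" by (simp add: k htval del: scaleR_minus_right)
      then have "real k \<le> - ht \<mu> / ht (a i)" using ht(2)[OF i] by (simp add: field_simps)
      then have "k \<le> nat \<lceil>- ht \<mu> / ht (a i)\<rceil>" by linarith
      then show ?thesis unfolding K_def k by blast
    qed
    then show "\<nu> \<in> Pi\<^sub>E I K" using \<nu> by (auto simp: geom_terms_def PiE_iff)
  qed
  moreover have "finite (Pi\<^sub>E I K)" using assms(1) by (intro finite_PiE) (auto simp: K_def)
  ultimately show ?thesis by (rule finite_subset)
qed

text \<open>In terms of series: multiplication by \<open>1 - x\<^sup>-\<^sup>a\<close> cancels one geometric series.\<close>

lemma card_geom_terms_insert: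
  assumes I: "finite I" "i \<notin> I" and ht: "linear ht" "\<And>j. j \<in> insert i I \<Longrightarrow> ht (a j) > (0::real)"
  shows "card (geom_terms (insert i I) a \<mu>)
    = card (geom_terms (insert i I) a (\<mu> + a i)) + card (geom_terms I a \<mu>)"
proof -
  let ?T = "geom_terms (insert i I) a"
  define A where "A = {\<nu> \<in> ?T \<mu>. \<nu> i = 0}"
  define B where "B = {\<nu> \<in> ?T \<mu>. \<nu> i \<noteq> 0}"
  have fin: "finite (?T \<mu>)" using I ht by (intro finite_geom_terms) auto
  have ai: "a i \<noteq> 0" using ht(2)[of i] linear_0[OF ht(1)] by auto
  have sum_upd: "(\<Sum>j\<in>I. if j = i then x else \<nu> j) = (\<Sum>j\<in>I. \<nu> j)" for \<nu> x
    using I by (intro sum.cong) auto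
  \<comment> \<open>Terms without the factor \<open>i\<close>. Members of \<open>Pi\<^sub>E\<close>
    are \<open>undefined\<close> off the index set, so this value drops a coordinate.\<close>
  have "bij_betw (\<lambda>\<nu>. \<nu>(i := undefined)) A (geom_terms I a \<mu>)"
  proof (rule bij_betw_byWitness[where f' = "\<lambda>\<nu>. \<nu>(i := 0)"])
    show "\<forall>\<nu>\<in>A. (\<nu>(i := undefined))(i := 0) = \<nu>" by (auto simp: A_def)
    show "\<forall>\<nu>\<in>geom_terms I a \<mu>. (\<nu>(i := 0))(i := undefined) = \<nu>"
      using I(2) by (auto simp: geom_terms_def PiE_iff extensional_def fun_eq_iff)
    show "(\<lambda>\<nu>. \<nu>(i := undefined)) ` A \<subseteq> geom_terms I a \<mu>"
      using I by (auto simp: A_def geom_terms_def PiE_iff extensional_def sum_upd)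
    show "(\<lambda>\<nu>. \<nu>(i := 0)) ` geom_terms I a \<mu> \<subseteq> A"
    proof (rule image_subsetI)
      fix \<nu> assume \<nu>: "\<nu> \<in> geom_terms I a \<mu>"
      have "(0::'b) \<in> range (\<lambda>k::nat. real k *\<^sub>R - a i)" by (rule image_eqI[of _ _ 0]) auto
      then show "\<nu>(i := 0) \<in> A"
        using \<nu> I by (auto simp: A_def geom_terms_def PiE_iff extensional_def sum_upd)
    qed
  qed
  then have cA: "card A = card (geom_terms I a \<mu>)" by (rule bij_betw_same_card)
  \<comment> \<open>Terms in which the factor \<open>i\<close> occurs: remove it once, lowering its
    multiplicity by one.\<close>
  have "bij_betw (\<lambda>\<nu>. \<nu>(i := \<nu> i + a i)) B (?T (\<mu> + a i))"
  proof (rule bij_betw_byWitness[where f' = "\<lambda>\<nu>. \<nu>(i := \<nu> i - a i)"])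
    show "\<forall>\<nu>\<in>B. (\<nu>(i := \<nu> i + a i))(i := (\<nu>(i := \<nu> i + a i)) i - a i) = \<nu>"
      and "\<forall>\<nu>\<in>?T (\<mu> + a i). (\<nu>(i := \<nu> i - a i))(i := (\<nu>(i := \<nu> i - a i)) i + a i) = \<nu>"
      by auto
    show "(\<lambda>\<nu>. \<nu>(i := \<nu> i + a i)) ` B \<subseteq> ?T (\<mu> + a i)"
    proof (rule image_subsetI)
      fix \<nu> assume \<nu>: "\<nu> \<in> B"
      then obtain k :: nat where k: "\<nu> i = real k *\<^sub>R - a i"
        unfolding B_def geom_terms_def by (auto simp: PiE_iff)
      have "k \<noteq> 0" using \<nu> k by (auto simp: B_def)
      then obtain m where m: "k = Suc m" using not0_implies_Suc by blast
      have "\<nu> i + a i = real m *\<^sub>R - a i" by (simp add: k m algebra_simps)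
      then have "\<nu> i + a i \<in> range (\<lambda>k::nat. real k *\<^sub>R - a i)" by blast
      moreover have "\<nu> i + (\<Sum>j\<in>I. \<nu> j) = \<mu>" using \<nu> I by (simp add: B_def geom_terms_def)
      ultimately show "\<nu>(i := \<nu> i + a i) \<in> ?T (\<mu> + a i)"
        using \<nu> I unfolding B_def geom_terms_def
        by (auto simp: PiE_iff extensional_def sum_upd algebra_simps)
    qed
    show "(\<lambda>\<nu>. \<nu>(i := \<nu> i - a i)) ` ?T (\<mu> + a i) \<subseteq> B"
    proof (rule image_subsetI)
      fix \<nu> assume \<nu>: "\<nu> \<in> ?T (\<mu> + a i)"
      then obtain k :: nat where k: "\<nu> i = real k *\<^sub>R - a i"
        unfolding geom_terms_def by (auto simp: PiE_iff)
      have m: "\<nu> i - a i = real (Suc k) *\<^sub>R - a i" by (simp add: k algebra_simps)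
      then have "\<nu> i - a i \<in> range (\<lambda>k::nat. real k *\<^sub>R - a i)" by blast
      moreover have "\<nu> i - a i \<noteq> 0" unfolding m using ai by simp
      moreover have "\<nu> i + (\<Sum>j\<in>I. \<nu> j) = \<mu> + a i" using \<nu> I by (simp add: geom_terms_def)
      then have "\<nu> i - a i + (\<Sum>j\<in>I. \<nu> j) = \<mu>" by (simp add: algebra_simps)
      ultimately show "\<nu>(i := \<nu> i - a i) \<in> B"
        using \<nu> I unfolding B_def geom_terms_def
        by (auto simp: PiE_iff extensional_def sum_upd)
    qed
  qed
  then have cB: "card B = card (?T (\<mu> + a i))" by (rule bij_betw_same_card)
  have "?T \<mu> = A \<union> B" "A \<inter> B = {}" by (auto simp: A_def B_def)
  moreover have "finite A" "finite B" using fin by (simp_all add: A_def B_def)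
  ultimately have "card (?T \<mu>) = card A + card B" by (simp add: card_Un_disjoint)
  then show ?thesis by (simp add: cA cB)
qed

text \<open>Subsets of \<open>insert j J\<close> are paired as \<open>S\<close> and
  \<open>insert j S\<close>; the difference of the two counts is the cancellation of the single
  factor \<open>j\<close>, after which the factors in \<open>J\<close> remain.\<close>

lemma geom_terms_alternating_sum:
  assumes "finite J" "finite I" "I \<inter> J = {}"
    and ht: "linear ht" "\<And>i. i \<in> I \<union> J \<Longrightarrow> ht (a i) > (0::real)"
  shows "(\<Sum>S\<in>Pow J. (-1) ^ card S * of_nat (card (geom_terms (I \<union> J) a (\<mu> + (\<Sum>i\<in>S. a i)))))
    = (of_nat (card (geom_terms I a \<mu>)) :: rat)"
  using assms(1,3) ht(2)
proof (induction J)
  case (insert j J)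
  let ?g = "\<lambda>x. of_nat (card (geom_terms (I \<union> insert j J) a x)) :: rat"
  let ?h = "\<lambda>x. of_nat (card (geom_terms (I \<union> J) a x)) :: rat"
  have fin: "finite S" if "S \<in> Pow J" for S using that insert.hyps(1) finite_subset by auto
  have nin: "j \<notin> S" if "S \<in> Pow J" for S using that insert.hyps(2) by auto
  have step: "?g x = ?g (x + a j) + ?h x" for x
    using card_geom_terms_insert[of "I \<union> J" j ht a x] insert assms(2) ht(1) by simp
  have inj: "inj_on (insert j) (Pow J)" using insert.hyps(2) by (auto simp: inj_on_def)
  have "(\<Sum>S\<in>Pow (insert j J). (-1) ^ card S * ?g (\<mu> + (\<Sum>i\<in>S. a i)))
    = (\<Sum>S\<in>Pow J. (-1) ^ card S * ?g (\<mu> + (\<Sum>i\<in>S. a i)))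
      + (\<Sum>S\<in>insert j ` Pow J. (-1) ^ card S * ?g (\<mu> + (\<Sum>i\<in>S. a i)))"
    unfolding Pow_insert using insert.hyps by (intro sum.union_disjoint) auto
  also have "(\<Sum>S\<in>insert j ` Pow J. (-1) ^ card S * ?g (\<mu> + (\<Sum>i\<in>S. a i)))
    = (\<Sum>S\<in>Pow J. - ((-1) ^ card S * ?g (\<mu> + (\<Sum>i\<in>S. a i) + a j)))"
    unfolding sum.reindex[OF inj] o_def
    using fin nin by (intro sum.cong refl) (simp add: add.commute add.left_commute)
  also have "(\<Sum>S\<in>Pow J. (-1) ^ card S * ?g (\<mu> + (\<Sum>i\<in>S. a i))) + \<dots>
    = (\<Sum>S\<in>Pow J. (-1) ^ card S * ?h (\<mu> + (\<Sum>i\<in>S. a i)))"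
    unfolding sum.distrib[symmetric] by (intro sum.cong refl, subst step) (simp add: algebra_simps)
  also have "\<dots> = of_nat (card (geom_terms I a \<mu>))" using insert by auto
  finally show ?case .
qed simp

text \<open>A linear bijection that permutes the directions \<open>a i\<close> carries terms to
  terms. It is applied to minus the longest element, which permutes the positive roots.\<close>

lemma card_geom_terms_permute:
  assumes L: "linear L" "bij L" and \<sigma>: "bij_betw \<sigma> I I" "\<And>i. i \<in> I \<Longrightarrow> a (\<sigma> i) = L (a i)"
  shows "card (geom_terms I a (L \<mu>)) = card (geom_terms I a \<mu>)"
proof (rule bij_betw_same_card[OF bij_betw_byWitness])
  let ?f = "\<lambda>\<nu>. \<lambda>i\<in>I. inv L (\<nu> (\<sigma> i))" and ?g = "\<lambda>\<nu>. \<lambda>j\<in>I. L (\<nu> (inv_into I \<sigma> j))"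
  have \<sigma>I: "\<sigma> i \<in> I" "inv_into I \<sigma> (\<sigma> i) = i" if "i \<in> I" for i
    using \<sigma>(1) that by (auto simp: bij_betw_def)
  have \<tau>I: "inv_into I \<sigma> i \<in> I" "\<sigma> (inv_into I \<sigma> i) = i" if "i \<in> I" for i
    using \<sigma>(1) that by (auto simp: bij_betw_def inv_into_into f_inv_into_f)
  have invL: "inv L (L x) = x" "L (inv L x) = x" for x
    using L(2) by (simp_all add: bij_is_inj bij_is_surj surj_f_inv_f)
  have linv: "linear (inv L)" using L bij_is_inj inj_linear_imp_inv_linear by blast
  have mult: "L (real k *\<^sub>R - x) = real k *\<^sub>R - L x" "inv L (real k *\<^sub>R - x) = real k *\<^sub>R - inv L x" for k x
    using L(1) linv by (simp_all only: linear_cmul linear_neg)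
  show "\<forall>\<nu>\<in>geom_terms I a (L \<mu>). ?g (?f \<nu>) = \<nu>" "\<forall>\<nu>\<in>geom_terms I a \<mu>. ?f (?g \<nu>) = \<nu>"
    using \<sigma>I \<tau>I invL by (auto simp: geom_terms_def PiE_iff extensional_def fun_eq_iff)
  show "?f ` geom_terms I a (L \<mu>) \<subseteq> geom_terms I a \<mu>"
  proof (rule image_subsetI)
    fix \<nu> assume \<nu>: "\<nu> \<in> geom_terms I a (L \<mu>)"
    have "inv L (\<nu> (\<sigma> i)) \<in> range (\<lambda>k::nat. real k *\<^sub>R - a i)" if i: "i \<in> I" for i
    proof -
      obtain k :: nat where "\<nu> (\<sigma> i) = real k *\<^sub>R - a (\<sigma> i)"
        using \<nu> \<sigma>I(1)[OF i] unfolding geom_terms_def by (auto simp: PiE_iff)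
      then have "inv L (\<nu> (\<sigma> i)) = real k *\<^sub>R - a i"
        by (simp only: mult \<sigma>(2)[OF i] invL)
      then show ?thesis by blast
    qed
    moreover have "(\<Sum>i\<in>I. inv L (\<nu> (\<sigma> i))) = inv L (\<Sum>i\<in>I. \<nu> i)"
      using sum.reindex_bij_betw[OF \<sigma>(1), of \<nu>] by (simp only: linear_sum[OF linv, symmetric])
    ultimately show "?f \<nu> \<in> geom_terms I a \<mu>"
      using \<nu> invL unfolding geom_terms_def by (auto simp: PiE_iff)
  qed
  show "?g ` geom_terms I a \<mu> \<subseteq> geom_terms I a (L \<mu>)"
  proof (rule image_subsetI)
    fix \<nu> assume \<nu>: "\<nu> \<in> geom_terms I a \<mu>"
    have "L (\<nu> (inv_into I \<sigma> j)) \<in> range (\<lambda>k::nat. real k *\<^sub>R - a j)" if j: "j \<in> I" for j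
    proof -
      obtain k :: nat where "\<nu> (inv_into I \<sigma> j) = real k *\<^sub>R - a (inv_into I \<sigma> j)"
        using \<nu> \<tau>I(1)[OF j] unfolding geom_terms_def by (auto simp: PiE_iff)
      then have "L (\<nu> (inv_into I \<sigma> j)) = real k *\<^sub>R - a j"
        using \<sigma>(2)[OF \<tau>I(1)[OF j]] \<tau>I(2)[OF j] by (simp only: mult)
      then show ?thesis by blast
    qed
    moreover have "(\<Sum>j\<in>I. L (\<nu> (inv_into I \<sigma> j))) = L (\<Sum>i\<in>I. \<nu> i)"
      using sum.reindex_bij_betw[OF bij_betw_inv_into[OF \<sigma>(1)], of \<nu>]
      by (simp only: linear_sum[OF L(1), symmetric])
    ultimately show "?g \<nu> \<in> geom_terms I a (L \<mu>)"
      using \<nu> unfolding geom_terms_def by (auto simp: PiE_iff)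
  qed
qed

section \<open>Recursion and parity of the vertex coefficients\<close>

context based_root_system
begin

lemma chamber_expansion_card:
  "chamber_expansion \<Delta> \<Phi> d \<mu> =
     of_nat (card (geom_terms (P \<times> {..<d - 2}) fst (\<mu> + real (d - 2) *\<^sub>R \<rho>)))"
proof -
  have "(\<lambda>(\<alpha>, i). geom_series (- \<alpha>)) = (\<lambda>p::'a \<times> nat. geom_series (- fst p))" by auto
  then show ?thesis
    unfolding chamber_expansion_def using finite_pos by (simp add: series_prod_geom)
qed

text \<open>The product form of D cancels one of the layers \<open>P \<times> {i}\<close> of
  geometric series, and its factor \<open>x^\<rho>\<close> cancels one of the shifts by
  \<open>\<rho>\<close>.\<close>

lemma denom_mult_chamber_expansion:
  assumes "d \<ge> 2"
  shows "denom_mult (chamber_expansion \<Delta> \<Phi> (Suc d)) \<mu> = chamber_expansion \<Delta> \<Phi> d \<mu>"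
proof -
  obtain n where n: "d = n + 2" using assms by (metis add.commute le_Suc_ex)
  obtain ht :: "'a \<Rightarrow> real" where ht: "linear ht" "\<And>\<alpha>. \<alpha> \<in> P \<Longrightarrow> ht \<alpha> > 0"
    using positive_functional by blast
  define I where "I = P \<times> {..<n}"
  define J where "J = P \<times> {n}"
  have IJ: "P \<times> {..<Suc n} = I \<union> J" by (auto simp: I_def J_def)
  \<comment> \<open>The argument \<open>\<mu> - \<rho> + \<Sum>S\<close> of the product form,
    shifted by \<open>n + 1\<close> copies of \<open>\<rho>\<close>, is
    \<open>x + \<Sum>S\<close>.\<close>
  define x where "x = \<mu> + real n *\<^sub>R \<rho>"
  have "denom_mult (chamber_expansion \<Delta> \<Phi> (Suc d)) \<mu>
    = (\<Sum>S\<in>Pow P. (-1) ^ card S * of_nat (card (geom_terms (I \<union> J) fst (x + \<Sum>S))))"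
    by (simp add: denom_mult_product chamber_expansion_card n x_def IJ algebra_simps)
  also have "\<dots> = (\<Sum>S\<in>Pow J. (-1) ^ card S * of_nat (card (geom_terms (I \<union> J) fst (x + (\<Sum>i\<in>S. fst i)))))"
  proof (rule sum.reindex_bij_witness[of _ "\<lambda>S. fst ` S" "\<lambda>S. S \<times> {n}"])
    fix S assume "S \<in> Pow P"
    have "(\<Sum>i\<in>S \<times> {n}. fst i) = \<Sum>S"
      by (rule sum.reindex_bij_witness[of _ "\<lambda>\<alpha>. (\<alpha>, n)" fst]) auto
    then show "(-1) ^ card (S \<times> {n}) * of_nat (card (geom_terms (I \<union> J) fst (x + (\<Sum>i\<in>S \<times> {n}. fst i))))
      = (-1) ^ card S * (of_nat (card (geom_terms (I \<union> J) fst (x + \<Sum>S))) :: rat)"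
      by (simp add: card_cartesian_product_singleton card_cartesian_product)
    show "fst ` (S \<times> {n}) = S" by simp
    show "S \<times> {n} \<in> Pow J" using \<open>S \<in> Pow P\<close> by (auto simp: J_def)
  next
    fix S assume "S \<in> Pow J"
    then have S: "\<alpha> \<in> P \<and> i = n" if "(\<alpha>, i) \<in> S" for \<alpha> i using that by (auto simp: J_def)
    show "fst ` S \<in> Pow P" using S by auto
    have eq: "p = (fst p, n)" if "p \<in> S" for p
      using S[of "fst p" "snd p"] that by (simp add: prod_eq_iff)
    show "fst ` S \<times> {n} = S"
    proof (intro equalityI subsetI)
      fix p assume "p \<in> fst ` S \<times> {n}"
      then obtain q where q: "q \<in> S" "p = (fst q, n)" by auto
      with eq[OF q(1)] show "p \<in> S" by simp
    next
      fix p assume p: "p \<in> S"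
      then have "fst p \<in> fst ` S" by (rule imageI)
      then have "(fst p, n) \<in> fst ` S \<times> {n}" by simp
      then show "p \<in> fst ` S \<times> {n}" using eq[OF p] by simp
    qed
  qed
  also have "\<dots> = of_nat (card (geom_terms I fst x))"
    using finite_pos ht by (intro geom_terms_alternating_sum) (auto simp: I_def J_def)
  finally show ?thesis by (simp add: chamber_expansion_card n I_def x_def)
qed

lemma vertex_coeff_2: "vertex_coeff \<Delta> \<Phi> 2 \<mu> = (if \<mu> = 0 then 1 else 0)"
  by (simp add: vertex_coeff_def lookup_one when_def)

lemma vertex_coeff_1: "vertex_coeff \<Delta> \<Phi> 1 \<mu> = denom_coeff \<mu>"
  by (simp add: vertex_coeff_def weyl_denominator_formula)

text \<open>At \<open>d = 2\<close> every chamber expansion is the constant 1 and the signs are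
  squares, so the averaged formula extends to this case. The recursion can then step from 3 down to
  2 inside the averages.\<close>

lemma vertex_coeff_average:
  assumes "d \<ge> 2"
  shows "vertex_coeff \<Delta> \<Phi> d \<mu> =
    (1 / of_nat (card W)) * (\<Sum>w\<in>W. weyl_sgn w ^ d * chamber_expansion \<Delta> \<Phi> d (inv w \<mu>))"
proof (cases "d = 2")
  case False
  then show ?thesis
    using assms by (auto simp: vertex_coeff_def weyl_sgn_length power_mult mult.commute[of d]
        intro!: sum.cong)
next
  case True
  have E2: "chamber_expansion \<Delta> \<Phi> 2 x = (if x = 0 then 1 else 0)" for x
  proof -
    have "geom_terms ({} :: ('a \<times> nat) set) fst x = (if x = 0 then {\<lambda>_. undefined} else {})"
      by (auto simp: geom_terms_def)
    then show ?thesis by (simp add: chamber_expansion_card)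
  qed
  have "inv w \<mu> = 0 \<longleftrightarrow> \<mu> = 0" if "w \<in> W" for w
    using weyl_inv_apply[OF that] weyl_linear[OF that] weyl_linear[OF weyl_inv[OF that]] linear_0 by metis
  then have "(\<Sum>w\<in>W. weyl_sgn w ^ 2 * chamber_expansion \<Delta> \<Phi> 2 (inv w \<mu>)) = (\<Sum>w\<in>W. if \<mu> = 0 then 1 else 0)"
    using weyl_sgn_square by (intro sum.cong) (auto simp: E2 power2_eq_square)
  moreover have "card W \<noteq> 0" using finite_weyl weyl_id by auto
  ultimately show ?thesis by (simp only: True vertex_coeff_2) simp
qed

text \<open>For \<open>d < 2\<close> this is multiplication of powers in the group ring. For larger
  \<open>d\<close>, antisymmetry of D reduces the summand of each chamber to the expansion in the
  fundamental one.\<close>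

lemma denom_mult_vertex_coeff: "denom_mult (vertex_coeff \<Delta> \<Phi> (Suc d)) \<mu> = vertex_coeff \<Delta> \<Phi> d \<mu>"
proof (cases "d \<ge> 2")
  case False
  then have d: "2 - d = Suc (2 - Suc d)" "Suc d \<le> 2" by auto
  have "vertex_coeff \<Delta> \<Phi> (Suc d) = Poly_Mapping.lookup (weyl_denom \<Delta> \<Phi> ^ (2 - Suc d))"
    using d by (auto simp: vertex_coeff_def fun_eq_iff)
  then show ?thesis
    using d by (simp add: vertex_coeff_def flip: lookup_denom_mult)
next
  case True
  let ?E = "chamber_expansion \<Delta> \<Phi>"
  have "denom_mult (vertex_coeff \<Delta> \<Phi> (Suc d)) \<mu> = (\<Sum>w\<in>W. weyl_sgn w *
      ((1 / of_nat (card W)) * (\<Sum>u\<in>W. weyl_sgn u ^ Suc d * ?E (Suc d) (inv u (\<mu> - w \<rho>)))))"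
    using True by (simp add: denom_mult_weyl vertex_coeff_average)
  also have "\<dots> = (1 / of_nat (card W)) *
      (\<Sum>w\<in>W. \<Sum>u\<in>W. weyl_sgn w * (weyl_sgn u ^ Suc d * ?E (Suc d) (inv u (\<mu> - w \<rho>))))"
    by (simp add: sum_distrib_left mult_ac)
  also have "(\<Sum>w\<in>W. \<Sum>u\<in>W. weyl_sgn w * (weyl_sgn u ^ Suc d * ?E (Suc d) (inv u (\<mu> - w \<rho>))))
    = (\<Sum>u\<in>W. \<Sum>w\<in>W. weyl_sgn w * (weyl_sgn u ^ Suc d * ?E (Suc d) (inv u (\<mu> - w \<rho>))))"
    by (rule sum.swap)
  also have "\<dots> = (\<Sum>u\<in>W. weyl_sgn u ^ d * ?E d (inv u \<mu>))"
  proof (intro sum.cong refl)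
    fix u assume u: "u \<in> W"
    \<comment> \<open>Reindexing by \<open>inv u \<circ> w\<close> moves \<open>u\<close> past D;
      the sign of the new index absorbs one of the \<open>Suc d\<close> signs of
      \<open>u\<close>.\<close>
    have "(\<Sum>w\<in>W. weyl_sgn w * (weyl_sgn u ^ Suc d * ?E (Suc d) (inv u (\<mu> - w \<rho>))))
      = (\<Sum>w\<in>W. weyl_sgn u ^ d * (weyl_sgn w * ?E (Suc d) (inv u \<mu> - w \<rho>)))"
    proof (rule sum.reindex_bij_witness[of _ "\<lambda>w. u \<circ> w" "\<lambda>w. inv u \<circ> w"])
      fix w assume w: "w \<in> W"
      show "u \<circ> (inv u \<circ> w) = w" "inv u \<circ> (u \<circ> w) = w"
        using weyl_inv_apply[OF u] by (auto simp: fun_eq_iff)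
      show "inv u \<circ> w \<in> W" "u \<circ> w \<in> W" using u w by (auto intro: weyl_comp weyl_inv)
      have "inv u (\<mu> - w \<rho>) = inv u \<mu> - (inv u \<circ> w) \<rho>"
        using weyl_linear[OF weyl_inv[OF u]] by (simp add: linear_diff)
      moreover have "weyl_sgn (inv u \<circ> w) = weyl_sgn u * weyl_sgn w"
        using u w by (simp add: weyl_sgn_comp weyl_inv weyl_sgn_inv)
      ultimately show "weyl_sgn u ^ d * (weyl_sgn (inv u \<circ> w) * ?E (Suc d) (inv u \<mu> - (inv u \<circ> w) \<rho>)) =
          weyl_sgn w * (weyl_sgn u ^ Suc d * ?E (Suc d) (inv u (\<mu> - w \<rho>)))"
        by simp
    qed
    also have "\<dots> = weyl_sgn u ^ d * denom_mult (?E (Suc d)) (inv u \<mu>)"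
      by (simp add: denom_mult_weyl sum_distrib_left)
    finally show "(\<Sum>w\<in>W. weyl_sgn w * (weyl_sgn u ^ Suc d * ?E (Suc d) (inv u (\<mu> - w \<rho>))))
      = weyl_sgn u ^ d * ?E d (inv u \<mu>)"
      using True by (simp only: denom_mult_chamber_expansion)
  qed
  finally show ?thesis by (simp only: vertex_coeff_average[OF True])
qed

text \<open>Minus the longest element \<open>w0\<close> permutes the positive roots and fixes
  \<open>\<rho>\<close>, so \<open>E(-x) = E(w0 x)\<close>. Shifting the average by
  \<open>w0\<close> then costs the \<open>d\<close>-th power of its sign.\<close>

lemma vertex_coeff_uminus_ge2:
  assumes "d \<ge> 2"
  shows "vertex_coeff \<Delta> \<Phi> d (- \<mu>) = (-1) ^ (d * card P) * vertex_coeff \<Delta> \<Phi> d \<mu>"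
proof -
  let ?E = "chamber_expansion \<Delta> \<Phi>"
  obtain w0 where w0: "w0 \<in> W" "w0 \<rho> = - \<rho>" "weyl_sgn w0 = (-1) ^ card P" "bij_betw (\<lambda>\<beta>. - w0 \<beta>) P P"
    using longest_element by blast
  define I where "I = P \<times> {..<d - 2}"
  have E: "?E d (- x) = ?E d (w0 x)" for x
  proof -
    define L where "L x = - w0 x" for x
    define \<sigma> where "\<sigma> p = (L (fst p), snd p)" for p :: "'a \<times> nat"
    have "linear L" unfolding L_def
      using linear_compose_neg[OF weyl_linear[OF w0(1)]] .
    moreover have "bij L"
      using weyl_inv_apply[OF w0(1)] weyl_linear[OF weyl_inv[OF w0(1)]]
      by (intro bij_betw_byWitness[of _ "\<lambda>x. inv w0 (- x)"]) (auto simp: L_def)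
    moreover have "bij_betw \<sigma> I I"
    proof -
      have "bij_betw (map_prod L id) (P \<times> {..<d - 2}) (P \<times> {..<d - 2})"
        using w0(4) by (intro bij_betw_map_prod) (auto simp: L_def[abs_def])
      moreover have "map_prod L id = \<sigma>" by (auto simp: \<sigma>_def)
      ultimately show ?thesis by (simp add: I_def)
    qed
    ultimately have "card (geom_terms I fst (L (- x + real (d - 2) *\<^sub>R \<rho>)))
      = card (geom_terms I fst (- x + real (d - 2) *\<^sub>R \<rho>))"
      by (rule card_geom_terms_permute) (simp add: \<sigma>_def)
    moreover have "L (- x + real (d - 2) *\<^sub>R \<rho>) = w0 x + real (d - 2) *\<^sub>R \<rho>"
      using weyl_linear[OF w0(1)] by (simp add: L_def linear_diff linear_cmul w0(2))
    ultimately show ?thesis by (simp add: chamber_expansion_card I_def)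
  qed
  have "(\<Sum>w\<in>W. weyl_sgn w ^ d * ?E d (inv w (- \<mu>)))
    = (\<Sum>w\<in>W. (-1) ^ (d * card P) * (weyl_sgn w ^ d * ?E d (inv w \<mu>)))"
  proof (rule sum.reindex_bij_witness[of _ "\<lambda>w. w \<circ> w0" "\<lambda>w. w \<circ> inv w0"])
    fix w assume w: "w \<in> W"
    show "w \<circ> inv w0 \<circ> w0 = w" "w \<circ> w0 \<circ> inv w0 = w"
      using weyl_inv_apply[OF w0(1)] by (auto simp: fun_eq_iff)
    show wW: "w \<circ> inv w0 \<in> W" "w \<circ> w0 \<in> W" using w w0(1) by (auto intro: weyl_comp weyl_inv)
    have "inv (w \<circ> inv w0) = w0 \<circ> inv w"
      using weyl_inv_apply[OF w] weyl_inv_apply[OF w0(1)]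
      by (intro inv_unique_comp) (auto simp: fun_eq_iff)
    then have "?E d (inv (w \<circ> inv w0) \<mu>) = ?E d (inv w (- \<mu>))"
      using E[of "inv w \<mu>"] weyl_linear[OF weyl_inv[OF w]] by (simp add: linear_neg)
    moreover have "weyl_sgn w ^ d = (-1) ^ (d * card P) * weyl_sgn (w \<circ> inv w0) ^ d"
    proof -
      have "weyl_sgn w = (-1) ^ card P * weyl_sgn (w \<circ> inv w0)"
        using w w0(1) weyl_sgn_square[of w0]
        by (simp add: weyl_sgn_comp weyl_inv weyl_sgn_inv flip: w0(3))
      then show ?thesis by (simp add: power_mult_distrib power_mult mult.commute[of d])
    qed
    ultimately show "(-1) ^ (d * card P) * (weyl_sgn (w \<circ> inv w0) ^ d * ?E d (inv (w \<circ> inv w0) \<mu>))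
      = weyl_sgn w ^ d * ?E d (inv w (- \<mu>))" by simp
  qed
  then show ?thesis using assms by (simp add: vertex_coeff_average flip: sum_distrib_left)
qed

text \<open>Below 2 there is no average to shift. The parity descends from \<open>d = 2\<close>
  along the recursion instead, each multiplication by D contributing a factor
  \<open>(-1) ^ card P\<close>.\<close>

lemma vertex_coeff_uminus:
  "vertex_coeff \<Delta> \<Phi> d (- \<mu>) = (-1) ^ (d * card P) * vertex_coeff \<Delta> \<Phi> d \<mu>"
proof -
  have step: "denom_mult f (- \<mu>) = (-1) ^ (Suc d * card P) * denom_mult f \<mu>"
    if f: "\<And>x. f (- x) = (-1) ^ (d * card P) * f x" for f d \<mu>
  proof -
    define K where "K = Poly_Mapping.keys (weyl_denom \<Delta> \<Phi>)"
    have K: "\<nu> \<in> K \<longleftrightarrow> denom_coeff \<nu> \<noteq> 0" for \<nu>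
      by (simp add: K_def in_keys_iff weyl_denominator_formula)
    have "(\<Sum>\<nu>\<in>K. denom_coeff \<nu> * f (- \<mu> - \<nu>)) =
      (\<Sum>\<nu>\<in>K. (-1) ^ (Suc d * card P) * (denom_coeff \<nu> * f (\<mu> - \<nu>)))"
    proof (rule sum.reindex_bij_witness[of _ uminus uminus])
      fix \<nu>
      have "f (- \<mu> - \<nu>) = (-1) ^ (d * card P) * f (\<mu> - - \<nu>)" using f[of "\<mu> - - \<nu>"] by simp
      moreover have "denom_coeff \<nu> = (-1) ^ card P * denom_coeff (- \<nu>)"
        using denom_coeff_uminus[of "- \<nu>"] by simp
      ultimately show "(-1) ^ (Suc d * card P) * (denom_coeff (- \<nu>) * f (\<mu> - - \<nu>)) =
          denom_coeff \<nu> * f (- \<mu> - \<nu>)" by (simp add: power_add mult_ac)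
    qed (auto simp: K denom_coeff_uminus)
    then show ?thesis by (simp add: denom_mult_def K_def sum_distrib_left)
  qed
  have down: "vertex_coeff \<Delta> \<Phi> d (- \<mu>) = (-1) ^ (d * card P) * vertex_coeff \<Delta> \<Phi> d \<mu>"
    if IH: "\<And>\<mu>. vertex_coeff \<Delta> \<Phi> (Suc d) (- \<mu>) = (-1) ^ (Suc d * card P) * vertex_coeff \<Delta> \<Phi> (Suc d) \<mu>" for d \<mu>
  proof -
    \<comment> \<open>Multiplying by D raises the sign exponent although it lowers the degree; two
      steps apart, the signs agree.\<close>
    have "(-1::rat) ^ (Suc (Suc d) * card P) = (-1) ^ (d * card P)"
      by (simp add: power_add flip: mult.assoc power_mult_distrib)
    then show ?thesis using step[of "vertex_coeff \<Delta> \<Phi> (Suc d)" "Suc d" \<mu>, OF IH]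
      by (simp only: denom_mult_vertex_coeff)
  qed
  consider "d \<ge> 2" | "d = 1" | "d = 0" by linarith
  then show ?thesis
  proof cases
    case 1 then show ?thesis by (rule vertex_coeff_uminus_ge2)
  next
    case 2
    show ?thesis unfolding 2 by (rule down, rule vertex_coeff_uminus_ge2) simp
  next
    case 3
    show ?thesis unfolding 3 by (rule down, rule down, rule vertex_coeff_uminus_ge2) simp
  qed
qed

end

section \<open>Inertia of symmetric operators\<close>

text \<open>The operator acts on the whole space but is studied on \<open>S\<close> only: linking
  matrices are extended by zero off the vertex set, and the kernel created in this way must not
  count.\<close>

locale self_adjoint_on =
  fixes f :: "'a::euclidean_space \<Rightarrow> 'a" and S :: "'a set"
  assumes linear: "linear f" and subspace: "subspace S"
    and invariant: "x \<in> S \<Longrightarrow> f x \<in> S"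
    and self_adjoint: "f x \<bullet> y = x \<bullet> f y"
begin

text \<open>A maximiser of the Rayleigh quotient on the unit sphere is an eigenvector.\<close>

lemma eigenvector_exists:
  assumes U: "subspace U" "U \<subseteq> S" "\<And>x. x \<in> U \<Longrightarrow> f x \<in> U" and nz: "y0 \<in> U" "y0 \<noteq> 0"
  obtains x t where "x \<in> U" "x \<noteq> 0" "f x = t *\<^sub>R x"
proof -
  define K where "K = U \<inter> sphere 0 1"
  have "compact K" unfolding K_def using closed_subspace[OF U(1)] by (simp add: closed_Int_compact)
  moreover have "(1 / norm y0) *\<^sub>R y0 \<in> K"
    using nz subspace_scale[OF U(1)] by (simp add: K_def)
  then have "K \<noteq> {}" by blast
  moreover have "continuous_on K (\<lambda>x. x \<bullet> f x)"
    by (intro continuous_intros linear_continuous_on linear_conv_bounded_linear[THEN iffD1] linear)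
  ultimately obtain x where x: "x \<in> K" and max: "\<And>y. y \<in> K \<Longrightarrow> y \<bullet> f y \<le> x \<bullet> f x"
    using continuous_attains_sup[of K "\<lambda>x. x \<bullet> f x"] by blast
  have xU: "x \<in> U" and x1: "x \<bullet> x = 1" using x by (auto simp: K_def dot_square_norm)
  define t where "t = x \<bullet> f x"
  have max': "y \<bullet> f y \<le> t * (y \<bullet> y)" if "y \<in> U" for y
  proof (cases "y = 0")
    case False
    have "(1 / norm y) *\<^sub>R y \<in> K" using False that subspace_scale[OF U(1)] by (simp add: K_def)
    then have "((1 / norm y) *\<^sub>R y) \<bullet> f ((1 / norm y) *\<^sub>R y) \<le> t"
      unfolding t_def by (rule max)
    then have "(y \<bullet> f y) / (norm y)\<^sup>2 \<le> t"
      using linear by (simp add: linear_cmul power2_eq_square)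
    then show ?thesis using False by (simp add: field_simps dot_square_norm)
  qed simp
  \<comment> \<open>The residual of the eigenvector equation. Maximality along the line
    \<open>x + s *\<^sub>R z\<close> gives the quadratic inequality below, whose linear coefficient
    is twice the squared norm of \<open>z\<close>.\<close>
  define z where "z = t *\<^sub>R x - f x"
  have zU: "z \<in> U" using xU U by (simp add: z_def subspace_diff subspace_scale)
  define c where "c = t * (z \<bullet> z) - z \<bullet> f z"
  have c0: "c \<ge> 0" using max'[OF zU] by (simp add: c_def)
  have quad: "2 * s * (z \<bullet> z) + s\<^sup>2 * c \<ge> 0" for s
  proof -
    have "x + s *\<^sub>R z \<in> U" using xU zU U(1) by (simp add: subspace_add subspace_scale)
    then have "(x + s *\<^sub>R z) \<bullet> f (x + s *\<^sub>R z) \<le> t * ((x + s *\<^sub>R z) \<bullet> (x + s *\<^sub>R z))" by (rule max')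
    moreover have "z \<bullet> f x = f x \<bullet> z" by (rule inner_commute)
    moreover have "x \<bullet> f z = f x \<bullet> z" by (rule self_adjoint[symmetric])
    moreover have "z \<bullet> z = t * (x \<bullet> z) - f x \<bullet> z"
      by (simp add: z_def inner_diff_left)
    moreover have "z \<bullet> x = x \<bullet> z" by (rule inner_commute)
    ultimately show ?thesis using linear x1
      by (simp add: linear_add linear_cmul inner_add_left inner_add_right c_def t_def[symmetric]
          power2_eq_square) (simp add: algebra_simps)
  qed
  have "z \<bullet> z = 0"
  proof (rule ccontr)
    assume nz: "z \<bullet> z \<noteq> 0"
    define b where "b = z \<bullet> z"
    have b: "b > 0" using nz by (simp add: b_def)
    \<comment> \<open>Close to the minimizer \<open>- b / c\<close> of the quadratic, but also
      defined when \<open>c = 0\<close>.\<close>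
    define s where "s = - b / (c + 1)"
    have b_eq: "b = - s * (c + 1)" and "s \<noteq> 0" using b c0 by (auto simp: s_def)
    have "2 * s * b + s\<^sup>2 * c = - (s\<^sup>2 * (c + 2))"
      unfolding b_eq by (simp add: algebra_simps power2_eq_square)
    also have "\<dots> < 0" using \<open>s \<noteq> 0\<close> c0 by simp
    finally show False using quad[of s] by (simp add: b_def)
  qed
  then have "f x = t *\<^sub>R x" by (simp add: z_def)
  moreover have "x \<noteq> 0" using x1 by auto
  ultimately show thesis using xU that by blast
qed

section \<open>Eigenspaces and the law of inertia\<close>

definition eig :: "real \<Rightarrow> 'a set" where
  "eig t = {x \<in> S. f x = t *\<^sub>R x}"

lemma subspace_eig: "subspace (eig t)"
  unfolding eig_def subspace_def using subspace linear
  by (auto simp: subspace_0 subspace_add subspace_scale linear_0 linear_add linear_cmul algebra_simps)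

lemma eig_orthogonal:
  assumes "x \<in> eig s" "y \<in> eig t" "s \<noteq> t"
  shows "x \<bullet> y = 0"
proof -
  have "s * (x \<bullet> y) = t * (x \<bullet> y)"
    using self_adjoint[of x y] assms by (simp add: eig_def)
  with assms(3) show ?thesis by simp
qed

text \<open>The orthogonal complement of all eigenvectors within \<open>S\<close> is invariant. If
  it were nonzero, it would contain an eigenvector, which would be orthogonal to itself.\<close>

lemma span_eig: "span (\<Union>t. eig t) = S"
proof
  show "span (\<Union>t. eig t) \<subseteq> S" using subspace by (intro span_minimal) (auto simp: eig_def)
  define U where "U = {y \<in> S. \<forall>x\<in>\<Union>t. eig t. y \<bullet> x = 0}"
  have "subspace U" unfolding U_def subspace_def using subspace
    by (auto simp: subspace_0 subspace_add subspace_scale inner_add_left)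
  moreover have "U \<subseteq> S" by (auto simp: U_def)
  moreover have "f y \<in> U" if "y \<in> U" for y
    using that invariant by (auto simp: U_def eig_def self_adjoint)
  ultimately have U0: "y = 0" if "y \<in> U" for y
  proof (rule_tac ccontr)
    assume "subspace U" "U \<subseteq> S" "\<And>y. y \<in> U \<Longrightarrow> f y \<in> U" "y \<noteq> 0"
    from eigenvector_exists[OF this(1-3) that this(4)]
    obtain x t where x: "x \<in> U" "x \<noteq> 0" "f x = t *\<^sub>R x" by metis
    then have "x \<in> eig t" by (auto simp: U_def eig_def)
    with x have "x \<bullet> x = 0" by (auto simp: U_def)
    with x(2) show False by simp
  qed
  show "S \<subseteq> span (\<Union>t. eig t)"
  proof
    fix x assume x: "x \<in> S"
    obtain y z where yz: "y \<in> span (\<Union>t. eig t)" "\<And>w. w \<in> span (\<Union>t. eig t) \<Longrightarrow> orthogonal z w" "x = y + z"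
      by (metis orthogonal_subspace_decomp_exists)
    have "y \<in> S" using yz(1) \<open>span (\<Union>t. eig t) \<subseteq> S\<close> by blast
    then have "z \<in> S" using x yz(3) subspace_diff[OF subspace, of x y] by simp
    moreover have "z \<bullet> w = 0" if "w \<in> (\<Union>t. eig t)" for w
      using yz(2)[OF span_base[OF that]] by (simp add: orthogonal_def)
    ultimately have "z \<in> U" unfolding U_def by blast
    then have "x = y" using U0[of z] yz(3) by simp
    with yz(1) show "x \<in> span (\<Union>t. eig t)" by simp
  qed
qed

text \<open>One eigenvector per eigenvalue gives an orthogonal, hence independent, family.\<close>

lemma finite_eigenvalues: "finite {t. \<exists>x\<in>eig t. x \<noteq> 0}"
proof -
  define T where "T = {t. \<exists>x\<in>eig t. x \<noteq> 0}"
  obtain e where e: "\<And>t. t \<in> T \<Longrightarrow> e t \<in> eig t \<and> e t \<noteq> 0"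
    using that[of "\<lambda>t. SOME x. x \<in> eig t \<and> x \<noteq> 0"] by (metis (mono_tags, lifting) T_def mem_Collect_eq someI_ex)
  have orth: "e s \<bullet> e t = 0" if "s \<in> T" "t \<in> T" "s \<noteq> t" for s t
    using e that eig_orthogonal by blast
  have inj: "inj_on e T"
  proof (rule inj_onI, rule ccontr)
    fix s t assume st: "s \<in> T" "t \<in> T" "e s = e t" "s \<noteq> t"
    with orth[of s t] have "e t \<bullet> e t = 0" by simp
    with e[OF st(2)] show False by simp
  qed
  have "independent (e ` T)"
    using orth e by (intro pairwise_orthogonal_independent) (auto simp: pairwise_def orthogonal_def)
  then have "finite (e ` T)" by (rule independent_imp_finite)
  then show ?thesis using finite_imageD[OF _ inj] by (simp add: T_def)
qed

text \<open>Both parts come from one induction: a new eigenspace is orthogonal to the span of the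
  others, so dimensions add and the mixed terms of the form vanish.\<close>

lemma dim_span_eig:
  assumes "finite A"
  shows "dim (span (\<Union>t\<in>A. eig t)) = (\<Sum>t\<in>A. dim (eig t))"
    and "\<And>x c. (\<And>t. t \<in> A \<Longrightarrow> c * t > 0) \<Longrightarrow> x \<in> span (\<Union>t\<in>A. eig t) \<Longrightarrow> x \<noteq> 0 \<Longrightarrow> c * (x \<bullet> f x) > 0"
proof -
  have "dim (span (\<Union>t\<in>A. eig t)) = (\<Sum>t\<in>A. dim (eig t)) \<and>
    (\<forall>x c. (\<forall>t\<in>A. c * t > 0) \<longrightarrow> x \<in> span (\<Union>t\<in>A. eig t) \<longrightarrow> x \<noteq> 0 \<longrightarrow> c * (x \<bullet> f x) > 0)"
    using assms
  proof (induction A)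
    case empty
    then show ?case by simp
  next
    case (insert t A)
    define U where "U = span (\<Union>s\<in>A. eig s)"
    have sU: "subspace U" by (simp add: U_def)
    have orth: "u \<bullet> v = 0" if "u \<in> eig t" "v \<in> U" for u v
    proof -
      have "orthogonal u v"
      proof (rule orthogonal_to_span[OF that(2)[unfolded U_def]])
        fix y assume "y \<in> (\<Union>s\<in>A. eig s)"
        then obtain s where "s \<in> A" "y \<in> eig s" by blast
        moreover have "t \<noteq> s" using \<open>s \<in> A\<close> insert.hyps(2) by blast
        ultimately show "orthogonal u y"
          using eig_orthogonal[OF that(1)] by (simp add: orthogonal_def)
      qed
      then show ?thesis by (simp add: orthogonal_def)
    qed
    have eq: "span (\<Union>s\<in>insert t A. eig s) = {x + y | x y. x \<in> eig t \<and> y \<in> U}"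
      unfolding UN_insert span_Un span_eq_iff[THEN iffD2, OF subspace_eig] U_def ..
    have "eig t \<inter> U = {0}"
    proof
      show "eig t \<inter> U \<subseteq> {0}"
      proof
        fix x assume "x \<in> eig t \<inter> U"
        then have "x \<bullet> x = 0" using orth by blast
        then show "x \<in> {0}" by simp
      qed
    qed (use subspace_0[OF subspace_eig] subspace_0[OF sU] in auto)
    then have "dim {x + y | x y. x \<in> eig t \<and> y \<in> U} = dim (eig t) + dim U"
      using dim_sums_Int[OF subspace_eig sU, of t] by simp
    then have 1: "dim (span (\<Union>s\<in>insert t A. eig s)) = (\<Sum>s\<in>insert t A. dim (eig s))"
      using insert by (simp only: eq U_def) simp
    have 2: "c * (x \<bullet> f x) > 0"
      if c: "\<forall>s\<in>insert t A. c * s > 0" and x: "x \<in> span (\<Union>s\<in>insert t A. eig s)" "x \<noteq> 0" for x c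
    proof -
      obtain u v where uv: "x = u + v" "u \<in> eig t" "v \<in> U" using x(1) eq by blast
      have fu: "f u = t *\<^sub>R u" using uv(2) by (simp add: eig_def)
      have fx: "x \<bullet> f x = t * (u \<bullet> u) + v \<bullet> f v"
        using orth[OF uv(2,3)] self_adjoint[of u v] linear
        by (simp add: uv(1) linear_add inner_add_left inner_add_right fu inner_commute)
      have "c * (v \<bullet> f v) > 0" if "v \<noteq> 0"
        using insert.IH c uv(3) that by (auto simp: U_def)
      moreover have "c * (t * (u \<bullet> u)) > 0" if "u \<noteq> 0"
        using c that by (simp add: mult.assoc[symmetric])
      moreover have "u \<noteq> 0 \<or> v \<noteq> 0" using x(2) uv(1) by auto
      ultimately show ?thesis
        by (cases "u = 0"; cases "v = 0") (auto simp: fx distrib_left)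
    qed
    show ?case using 1 2 by blast
  qed
  then show "dim (span (\<Union>t\<in>A. eig t)) = (\<Sum>t\<in>A. dim (eig t))"
    and "\<And>x c. (\<And>t. t \<in> A \<Longrightarrow> c * t > 0) \<Longrightarrow> x \<in> span (\<Union>t\<in>A. eig t) \<Longrightarrow> x \<noteq> 0 \<Longrightarrow> c * (x \<bullet> f x) > 0"
    by blast+
qed

text \<open>The positive index of inertia for \<open>c = 1\<close> and the negative one for
  \<open>c = -1\<close>, so that each argument is carried out once for both signs.\<close>

definition index :: "real \<Rightarrow> nat" where
  "index c = (\<Sum>t\<in>{t. c * t > 0 \<and> (\<exists>x\<in>eig t. x \<noteq> 0)}. dim (eig t))"

lemma index_subspace:
  obtains U where "subspace U" "U \<subseteq> S" "dim U = index c"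
    "\<And>x. x \<in> U \<Longrightarrow> x \<noteq> 0 \<Longrightarrow> c * (x \<bullet> f x) > 0"
proof -
  define A where "A = {t. c * t > 0 \<and> (\<exists>x\<in>eig t. x \<noteq> 0)}"
  have fin: "finite A" using finite_eigenvalues by (rule rev_finite_subset) (auto simp: A_def)
  have "span (\<Union>t\<in>A. eig t) \<subseteq> S" using subspace by (intro span_minimal) (auto simp: eig_def)
  moreover have "dim (span (\<Union>t\<in>A. eig t)) = index c"
    using dim_span_eig(1)[OF fin] by (simp only: index_def A_def)
  ultimately show thesis
    using that[OF subspace_span] dim_span_eig(2)[OF fin] by (auto simp: A_def)
qed

lemma index_sum:
  assumes nondeg: "\<And>x. x \<in> S \<Longrightarrow> f x = 0 \<Longrightarrow> x = 0"
  shows "index 1 + index (-1) = dim S"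
proof -
  define T where "T = {t. \<exists>x\<in>eig t. x \<noteq> 0}"
  define A where "A c = {t. c * t > 0 \<and> (\<exists>x\<in>eig t. x \<noteq> 0)}" for c :: real
  have "0 \<notin> T" using nondeg by (auto simp: T_def eig_def)
  then have T: "T = A 1 \<union> A (-1)" "A 1 \<inter> A (-1) = {}"
    by (auto simp: T_def A_def) (metis not_less_iff_gr_or_eq)
  have "span (\<Union>t. eig t) = span (\<Union>t\<in>T. eig t)"
  proof
    have "x \<in> span (\<Union>t\<in>T. eig t)" if "x \<in> eig t" for x t
    proof (cases "x = 0")
      case False
      then show ?thesis using that by (intro span_base) (auto simp: T_def)
    qed (simp add: span_zero)
    then show "span (\<Union>t. eig t) \<subseteq> span (\<Union>t\<in>T. eig t)" by (intro span_minimal) auto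
  qed (auto intro!: span_mono)
  then have "dim S = dim (span (\<Union>t\<in>T. eig t))" using span_eig by simp
  also have "\<dots> = (\<Sum>t\<in>T. dim (eig t))" using finite_eigenvalues by (intro dim_span_eig) (simp add: T_def)
  also have "\<dots> = index 1 + index (-1)"
    unfolding index_def A_def[symmetric] T(1) using finite_eigenvalues T
    by (intro sum.union_disjoint) (auto simp: T_def[symmetric])
  finally show ?thesis by simp
qed

text \<open>A subspace on which the form has the sign of \<open>c\<close> meets the sum of the
  eigenspaces of opposite sign only in 0, and the two indices add up to
  \<open>dim S\<close>.\<close>

lemma dim_le_index:
  assumes nondeg: "\<And>x. x \<in> S \<Longrightarrow> f x = 0 \<Longrightarrow> x = 0"
    and U: "subspace U" "U \<subseteq> S" "\<And>x. x \<in> U \<Longrightarrow> x \<noteq> 0 \<Longrightarrow> c * (x \<bullet> f x) > 0" and c: "c \<in> {1, -1}"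
  shows "dim U \<le> index c"
proof -
  obtain N where N: "subspace N" "N \<subseteq> S" "dim N = index (- c)"
    "\<And>x. x \<in> N \<Longrightarrow> x \<noteq> 0 \<Longrightarrow> - c * (x \<bullet> f x) > 0"
    using index_subspace[of "- c"] by blast
  have "x = 0" if "x \<in> U" "x \<in> N" for x
  proof (rule ccontr)
    assume "x \<noteq> 0"
    then show False using U(3)[OF that(1)] N(4)[OF that(2)] by simp
  qed
  then have "U \<inter> N = {0}" using subspace_0[OF U(1)] subspace_0[OF N(1)] by auto
  then have "dim {x + y | x y. x \<in> U \<and> y \<in> N} = dim U + dim N"
    using dim_sums_Int[OF U(1) N(1)] by simp
  moreover have "{x + y | x y. x \<in> U \<and> y \<in> N} \<subseteq> S"
    using U(2) N(2) subspace_add[OF subspace] by blast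
  then have "dim {x + y | x y. x \<in> U \<and> y \<in> N} \<le> dim S" by (rule dim_subset)
  ultimately show ?thesis using index_sum[OF nondeg] N(3) c by auto
qed

end

text \<open>The map \<open>h\<close> is an isometry for the forms, so it is injective on a subspace
  realizing the index of \<open>f'\<close>, where the form is definite. The subspace
  \<open>U\<close> is orthogonal to the image with respect to the form and adds its
  dimension.\<close>

lemma index_mono:
  assumes "self_adjoint_on f S" "self_adjoint_on f' S'" and c: "c \<in> {1, -1}"
    and nondeg: "\<And>x. x \<in> S \<Longrightarrow> f x = 0 \<Longrightarrow> x = 0"
    and h: "linear h" "\<And>x. x \<in> S' \<Longrightarrow> h x \<in> S" "\<And>x. x \<in> S' \<Longrightarrow> h x \<bullet> f (h x) = x \<bullet> f' x"
    and U: "subspace U" "U \<subseteq> S" "\<And>u. u \<in> U \<Longrightarrow> u \<noteq> 0 \<Longrightarrow> c * (u \<bullet> f u) > 0"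
      "\<And>u x. u \<in> U \<Longrightarrow> x \<in> S' \<Longrightarrow> u \<bullet> f (h x) = 0"
  shows "self_adjoint_on.index f' S' c + dim U \<le> self_adjoint_on.index f S c"
proof -
  interpret A: self_adjoint_on f S by fact
  interpret B: self_adjoint_on f' S' by fact
  obtain N where N: "subspace N" "N \<subseteq> S'" "dim N = B.index c"
    "\<And>x. x \<in> N \<Longrightarrow> x \<noteq> 0 \<Longrightarrow> c * (x \<bullet> f' x) > 0"
    using B.index_subspace[of c] by blast
  have hN: "c * (h x \<bullet> f (h x)) > 0" if "x \<in> N" "x \<noteq> 0" for x
    using N that h(3) by auto
  have h0: "x = 0" if "x \<in> N" "h x = 0" for x using hN[OF that(1)] that(2) by auto
  have "inj_on h (span N)"
    using N(1) h0 linear_diff[OF h(1)] subspace_diff[OF N(1)]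
    by (intro inj_onI) (metis eq_iff_diff_eq_0 span_eq_iff)
  then have dimN: "dim (h ` N) = B.index c" using dim_image_eq[OF h(1), of N] N(3) by simp
  have sN: "subspace (h ` N)" using h(1) N(1) by (rule linear_subspace_image)
  have "h ` N \<inter> U = {0}"
  proof
    show "h ` N \<inter> U \<subseteq> {0}"
    proof
      fix u assume "u \<in> h ` N \<inter> U"
      then obtain x where x: "x \<in> N" "u = h x" "u \<in> U" by blast
      then have "u \<bullet> f u = 0" using U(4)[of u x] N(2) by auto
      then show "u \<in> {0}" using U(3)[OF x(3)] by auto
    qed
  qed (use subspace_0[OF sN] subspace_0[OF U(1)] in auto)
  then have dims: "dim {x + y | x y. x \<in> h ` N \<and> y \<in> U} = B.index c + dim U"
    using dim_sums_Int[OF sN U(1)] dimN by simp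
  have "dim {x + y | x y. x \<in> h ` N \<and> y \<in> U} \<le> A.index c"
  proof (rule A.dim_le_index[OF nondeg _ _ _ c])
    show "subspace {x + y | x y. x \<in> h ` N \<and> y \<in> U}" using sN U(1) by (rule subspace_sums)
    show "{x + y | x y. x \<in> h ` N \<and> y \<in> U} \<subseteq> S"
      using N(2) h(2) U(2) subspace_add[OF A.subspace] by blast
    fix z assume "z \<in> {x + y | x y. x \<in> h ` N \<and> y \<in> U}" "z \<noteq> 0"
    then obtain x u where z: "z = h x + u" "x \<in> N" "u \<in> U" by blast
    have "u \<bullet> f (h x) = 0" using z U(4) N(2) by blast
    moreover from this have "h x \<bullet> f u = 0" by (metis A.self_adjoint inner_commute)
    ultimately have q: "z \<bullet> f z = h x \<bullet> f (h x) + u \<bullet> f u"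
      using A.linear by (simp add: z(1) linear_add inner_add_left inner_add_right)
    have "x \<noteq> 0 \<or> u \<noteq> 0" using \<open>z \<noteq> 0\<close> z(1) linear_0[OF h(1)] by auto
    then show "c * (z \<bullet> f z) > 0"
      using hN[OF z(2)] U(3)[OF z(3)] linear_0[OF h(1)] linear_0[OF A.linear]
      by (cases "x = 0"; cases "u = 0") (auto simp: q distrib_left)
  qed auto
  with dims show ?thesis by simp
qed

section \<open>Linking matrices\<close>

lemma families_iff: "x \<in> families S A \<longleftrightarrow> (\<forall>v\<in>S. x $ v \<in> A) \<and> (\<forall>v. v \<notin> S \<longrightarrow> x $ v = 0)"
  by (auto simp: families_def)

lemma subspace_families: "subspace (families S UNIV :: ('a::real_vector ^ 'v::finite) set)"
  by (auto simp: subspace_def families_iff)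

lemma dim_families: "dim (families S UNIV :: (real ^ 'v::finite) set) = card S"
proof -
  have "vec.dim {x :: real ^ 'v. \<forall>i. i \<notin> S \<longrightarrow> x $ i = 0} = card S" by (rule dim_substandard_cart)
  then show ?thesis by (simp add: families_def dim_vec_eq)
qed

lemma linking_matrix_sym: "linking_matrix \<Gamma> $ u $ v = linking_matrix \<Gamma> $ v $ u"
  by (auto simp: linking_matrix_def insert_commute)

lemma linear_mat_act: "linear (mat_act M :: 'a::euclidean_space ^ 'v \<Rightarrow> _)"
  by (intro linearI)
    (simp_all add: mat_act_def vec_eq_iff scaleR_add_right sum.distrib scaleR_sum_right mult.commute)

lemma mat_act_inner:
  assumes "\<And>u v. M $ u $ v = M $ v $ u"
  shows "mat_act M x \<bullet> y = x \<bullet> mat_act M y"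
proof -
  have "mat_act M x \<bullet> y = (\<Sum>u\<in>UNIV. \<Sum>v\<in>UNIV. M $ u $ v * (x $ v \<bullet> y $ u))"
    by (simp add: inner_vec_def mat_act_def inner_sum_left)
  also have "\<dots> = (\<Sum>v\<in>UNIV. \<Sum>u\<in>UNIV. M $ v $ u * (x $ v \<bullet> y $ u))"
    by (subst sum.swap) (simp add: assms[of _ _])
  also have "\<dots> = x \<bullet> mat_act M y"
    by (simp add: inner_vec_def mat_act_def inner_sum_right)
  finally show ?thesis .
qed

lemma mat_act_real: "mat_act M x = M *v (x :: real ^ 'v::finite)"
  by (simp add: mat_act_def matrix_vector_mult_def vec_eq_iff)

lemma mat_act_mult: "mat_act M (mat_act N x) = mat_act (M ** N) x"
proof -
  have "(\<Sum>v\<in>UNIV. M $ u $ v *\<^sub>R (\<Sum>w\<in>UNIV. N $ v $ w *\<^sub>R x $ w))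
    = (\<Sum>w\<in>UNIV. (\<Sum>v\<in>UNIV. M $ u $ v * N $ v $ w) *\<^sub>R x $ w)" for u
    by (simp add: scaleR_sum_right scaleR_sum_left) (rule sum.swap)
  then show ?thesis by (simp add: mat_act_def matrix_matrix_mult_def vec_eq_iff)
qed

lemma mat_act_linking_families: "mat_act (linking_matrix \<Gamma>) x \<in> families (vertices \<Gamma>) UNIV"
  by (auto simp: families_iff mat_act_def linking_matrix_def)

text \<open>The usual argument for inverses, with \<open>e\<close> in place of the identity; it is
  neutral only for matrices that vanish off the vertex set.\<close>

lemma is_linking_inverse_unique:
  assumes "is_linking_inverse \<Gamma> C" "is_linking_inverse \<Gamma> D"
  shows "C = D"
proof -
  define e :: "real ^ 'a ^ 'a" where "e = (\<chi> u v. if u = v \<and> u \<in> vertices \<Gamma> then 1 else 0)"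
  have C: "C \<in> families (vertices \<Gamma>) (families (vertices \<Gamma>) UNIV)" "C ** linking_matrix \<Gamma> = e"
    and D: "D \<in> families (vertices \<Gamma>) (families (vertices \<Gamma>) UNIV)" "linking_matrix \<Gamma> ** D = e"
    using assms by (simp_all add: is_linking_inverse_def Let_def e_def)
  have e1: "e ** M = M" if "M \<in> families (vertices \<Gamma>) (families (vertices \<Gamma>) UNIV)" for M
  proof -
    have "(\<Sum>w\<in>UNIV. (if u = w \<and> u \<in> vertices \<Gamma> then 1 else 0) * M $ w $ v) = M $ u $ v" for u v
    proof -
      have "(\<Sum>w\<in>UNIV. (if u = w \<and> u \<in> vertices \<Gamma> then 1 else 0) * M $ w $ v)
        = (\<Sum>w\<in>UNIV. if w = u then M $ u $ v else 0)"
        using that by (intro sum.cong) (auto simp: families_iff)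
      then show ?thesis by simp
    qed
    then show ?thesis by (simp add: e_def matrix_matrix_mult_def vec_eq_iff)
  qed
  have e2: "M ** e = M" if "M \<in> families (vertices \<Gamma>) (families (vertices \<Gamma>) UNIV)" for M
  proof -
    have "(\<Sum>w\<in>UNIV. M $ u $ w * (if w = v \<and> w \<in> vertices \<Gamma> then 1 else 0)) = M $ u $ v" for u v
    proof -
      have "(\<Sum>w\<in>UNIV. M $ u $ w * (if w = v \<and> w \<in> vertices \<Gamma> then 1 else 0))
        = (\<Sum>w\<in>UNIV. if w = v then M $ u $ v else 0)"
      proof (intro sum.cong refl)
        have "M $ u $ v = 0" if "v \<notin> vertices \<Gamma>"
          using that \<open>M \<in> _\<close> by (cases "u \<in> vertices \<Gamma>") (auto simp: families_iff)
        then show "M $ u $ w * (if w = v \<and> w \<in> vertices \<Gamma> then 1 else 0) = (if w = v then M $ u $ v else 0)" for w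
          by auto
      qed
      then show ?thesis by simp
    qed
    then show ?thesis by (simp add: e_def matrix_matrix_mult_def vec_eq_iff)
  qed
  have "C = C ** (linking_matrix \<Gamma> ** D)" using C(1) by (simp add: D(2) e2)
  also have "\<dots> = (C ** linking_matrix \<Gamma>) ** D" by (rule matrix_mul_assoc)
  also have "\<dots> = D" using D(1) by (simp add: C(2) e1)
  finally show ?thesis .
qed

lemma linking_inverse:
  assumes "\<exists>C. is_linking_inverse \<Gamma> C"
  shows "is_linking_inverse \<Gamma> (linking_inverse \<Gamma>)"
  using theI'[of "is_linking_inverse \<Gamma>"] assms is_linking_inverse_unique
  unfolding linking_inverse_def by blast

lemma mat_act_linking_inverse:
  fixes x :: "'a::euclidean_space ^ 'v::finite"
  assumes "\<exists>C. is_linking_inverse \<Gamma> C" "x \<in> families (vertices \<Gamma>) UNIV"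
  shows "mat_act (linking_inverse \<Gamma>) (mat_act (linking_matrix \<Gamma>) x) = x"
    and "mat_act (linking_matrix \<Gamma>) (mat_act (linking_inverse \<Gamma>) x) = x"
    and "mat_act (linking_inverse \<Gamma>) x \<in> families (vertices \<Gamma>) UNIV"
proof -
  define e :: "real ^ 'v ^ 'v" where "e = (\<chi> u v. if u = v \<and> u \<in> vertices \<Gamma> then 1 else 0)"
  have C: "linking_inverse \<Gamma> \<in> families (vertices \<Gamma>) (families (vertices \<Gamma>) UNIV)"
      "linking_inverse \<Gamma> ** linking_matrix \<Gamma> = e" "linking_matrix \<Gamma> ** linking_inverse \<Gamma> = e"
    using linking_inverse[OF assms(1)] by (simp_all add: is_linking_inverse_def Let_def e_def)
  have "(\<Sum>w\<in>UNIV. (if u = w \<and> u \<in> vertices \<Gamma> then 1 else 0) *\<^sub>R x $ w) = x $ u" for u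
  proof -
    have "(\<Sum>w\<in>UNIV. (if u = w \<and> u \<in> vertices \<Gamma> then 1 else 0) *\<^sub>R x $ w)
      = (\<Sum>w\<in>UNIV. if w = u then x $ u else 0)"
      using assms(2) by (intro sum.cong) (auto simp: families_iff)
    then show ?thesis by simp
  qed
  then have "mat_act e x = x" by (simp add: mat_act_def e_def vec_eq_iff)
  then show "mat_act (linking_inverse \<Gamma>) (mat_act (linking_matrix \<Gamma>) x) = x"
    and "mat_act (linking_matrix \<Gamma>) (mat_act (linking_inverse \<Gamma>) x) = x"
    by (simp_all add: mat_act_mult C)
  show "mat_act (linking_inverse \<Gamma>) x \<in> families (vertices \<Gamma>) UNIV"
    using C(1) by (auto simp: families_iff mat_act_def)
qed

lemma self_adjoint_linking:
  "self_adjoint_on (mat_act (linking_matrix \<Gamma>)) (families (vertices \<Gamma>) UNIV :: (real ^ 'v::finite) set)"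
  by (intro self_adjoint_on.intro linear_mat_act subspace_families mat_act_linking_families
      mat_act_inner linking_matrix_sym)

lemma index_linking:
  "self_adjoint_on.index (mat_act (linking_matrix \<Gamma>)) (families (vertices \<Gamma>) UNIV :: (real ^ 'v::finite) set) c
    = count_eigenvalues \<Gamma> {t. c * t > 0}"
proof -
  interpret self_adjoint_on "mat_act (linking_matrix \<Gamma>)" "families (vertices \<Gamma>) UNIV :: (real ^ 'v) set"
    by (rule self_adjoint_linking)
  have "eig t = eigenspace \<Gamma> t" for t by (simp add: eig_def eigenspace_def mat_act_real)
  then show ?thesis by (simp add: index_def count_eigenvalues_def)
qed

lemma linking_nondegenerate:
  assumes "\<exists>C. is_linking_inverse \<Gamma> C" "x \<in> families (vertices \<Gamma>) UNIV"
    "mat_act (linking_matrix \<Gamma>) x = 0"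
  shows "x = 0"
  using mat_act_linking_inverse(1)[OF assms(1,2)] assms(3) by (simp add: linear_0[OF linear_mat_act])

text \<open>The cases of \<open>index_mono\<close> with \<open>U\<close> zero and with
  \<open>U\<close> the line through \<open>e\<close>; in the moves, \<open>e\<close> is a vector of
  the part that is split off.\<close>

lemma count_eigenvalues_mono:
  fixes \<Gamma> \<Gamma>' :: "'v::finite wgraph" and h :: "real ^ 'v \<Rightarrow> real ^ 'v"
  assumes inv: "\<exists>C. is_linking_inverse \<Gamma> C" and c: "c \<in> {1, -1}"
    and h: "linear h" "\<And>x. x \<in> families (vertices \<Gamma>') UNIV \<Longrightarrow> h x \<in> families (vertices \<Gamma>) UNIV"
      "\<And>x. x \<in> families (vertices \<Gamma>') UNIV \<Longrightarrow>
         h x \<bullet> mat_act (linking_matrix \<Gamma>) (h x) = x \<bullet> mat_act (linking_matrix \<Gamma>') x"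
  shows "count_eigenvalues \<Gamma>' {t. c * t > 0} \<le> count_eigenvalues \<Gamma> {t. c * t > 0}"
    and "e \<in> families (vertices \<Gamma>) UNIV \<Longrightarrow> c * (e \<bullet> mat_act (linking_matrix \<Gamma>) e) > 0 \<Longrightarrow>
      (\<And>x. x \<in> families (vertices \<Gamma>') UNIV \<Longrightarrow> e \<bullet> mat_act (linking_matrix \<Gamma>) (h x) = 0) \<Longrightarrow>
      count_eigenvalues \<Gamma>' {t. c * t > 0} + 1 \<le> count_eigenvalues \<Gamma> {t. c * t > 0}"
proof -
  let ?f = "mat_act (linking_matrix \<Gamma>) :: real ^ 'v \<Rightarrow> _"
  note mono = index_mono[OF self_adjoint_linking self_adjoint_linking c linking_nondegenerate[OF inv] h,
      unfolded index_linking]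
  show "count_eigenvalues \<Gamma>' {t. c * t > 0} \<le> count_eigenvalues \<Gamma> {t. c * t > 0}"
    using mono[of "{0}"] by (simp add: subspace_def subspace_0[OF subspace_families])
  assume e: "e \<in> families (vertices \<Gamma>) UNIV" "c * (e \<bullet> ?f e) > 0"
    "\<And>x. x \<in> families (vertices \<Gamma>') UNIV \<Longrightarrow> e \<bullet> ?f (h x) = 0"
  have "e \<noteq> 0" using e(2) by auto
  then have "dim (span {e}) = 1" by (simp add: dim_eq_card_independent)
  moreover have "span {e} \<subseteq> families (vertices \<Gamma>) UNIV"
    using e(1) subspace_families by (intro span_minimal) auto
  moreover have "c * (u \<bullet> ?f u) > 0" if "u \<in> span {e}" "u \<noteq> 0" for u
  proof -
    obtain k where k: "u = k *\<^sub>R e" using \<open>u \<in> span {e}\<close> by (auto simp: span_singleton)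
    have "c * (u \<bullet> ?f u) = k\<^sup>2 * (c * (e \<bullet> ?f e))"
      by (simp add: k linear_cmul[OF linear_mat_act] power2_eq_square)
    moreover have "k\<^sup>2 * (c * (e \<bullet> ?f e)) > 0"
      using that(2) k by (intro mult_pos_pos[OF _ e(2)]) auto
    ultimately show ?thesis by (simp only:)
  qed
  moreover have "u \<bullet> ?f (h x) = 0" if "u \<in> span {e}" "x \<in> families (vertices \<Gamma>') UNIV" for u x
    using that e(3) by (auto simp: span_singleton)
  ultimately show "count_eigenvalues \<Gamma>' {t. c * t > 0} + 1 \<le> count_eigenvalues \<Gamma> {t. c * t > 0}"
    using mono[of "span {e}"] by simp
qed

text \<open>The unsimplified factors keep these sets instances of
  \<open>{t. c * t > 0}\<close>.\<close>

lemma num_positive_alt: "num_positive \<Gamma> = count_eigenvalues \<Gamma> {t. 1 * t > 0}"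
  and signature_alt: "signature \<Gamma> =
    int (count_eigenvalues \<Gamma> {t. 1 * t > 0}) - int (count_eigenvalues \<Gamma> {t. (-1) * t > 0})"
  by (simp_all add: num_positive_def signature_def greaterThan_def lessThan_def)

lemma count_eigenvalues_sum:
  assumes "\<exists>C. is_linking_inverse \<Gamma> C"
  shows "count_eigenvalues \<Gamma> {t. 1 * t > 0} + count_eigenvalues \<Gamma> {t. (-1) * t > 0} = card (vertices \<Gamma>)"
  using self_adjoint_on.index_sum[OF self_adjoint_linking linking_nondegenerate[OF assms]]
  unfolding index_linking dim_families by blast

section \<open>Trees\<close>

definition nbrs :: "'v wgraph \<Rightarrow> 'v \<Rightarrow> 'v set" where
  "nbrs \<Gamma> v = {u. {u, v} \<in> edges \<Gamma>}"

lemma degree_nbrs: "degree \<Gamma> v = card (nbrs \<Gamma> v)"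
  by (simp add: degree_def nbrs_def)

lemma nbrs_sym: "u \<in> nbrs \<Gamma> v \<longleftrightarrow> v \<in> nbrs \<Gamma> u"
  by (simp add: nbrs_def insert_commute)

lemma weighted_treeD:
  assumes "weighted_tree \<Gamma>"
  shows "e \<in> edges \<Gamma> \<Longrightarrow> e \<subseteq> vertices \<Gamma>" "e \<in> edges \<Gamma> \<Longrightarrow> card e = 2"
    "u \<in> vertices \<Gamma> \<Longrightarrow> v \<in> vertices \<Gamma> \<Longrightarrow> v \<in> reach (edges \<Gamma>) u"
    "\<not> is_cycle (edges \<Gamma>) p"
  using assms by (auto simp: weighted_tree_def)

lemma nbrsD:
  assumes "weighted_tree \<Gamma>" "u \<in> nbrs \<Gamma> v"
  shows "u \<in> vertices \<Gamma>" "v \<in> vertices \<Gamma>" "u \<noteq> v"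
proof -
  have e: "{u, v} \<in> edges \<Gamma>" using assms(2) by (simp add: nbrs_def)
  then show "u \<in> vertices \<Gamma>" "v \<in> vertices \<Gamma>" using weighted_treeD(1)[OF assms(1) e] by auto
  show "u \<noteq> v" using weighted_treeD(2)[OF assms(1) e] by auto
qed

lemma mat_act_linking:
  assumes "weighted_tree \<Gamma>" "v \<in> vertices \<Gamma>"
  shows "mat_act (linking_matrix \<Gamma>) k $ v =
    of_int (weight \<Gamma> v) *\<^sub>R k $ v + (\<Sum>u\<in>nbrs \<Gamma> v. k $ u)"
proof -
  have "linking_matrix \<Gamma> $ v $ u *\<^sub>R k $ u =
      (if u = v then of_int (weight \<Gamma> v) *\<^sub>R k $ v else 0) + (if u \<in> nbrs \<Gamma> v then k $ u else 0)" for u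
    using assms nbrsD[OF assms(1), of u v]
    by (auto simp: linking_matrix_def nbrs_def insert_commute)
  then have "mat_act (linking_matrix \<Gamma>) k $ v =
      (\<Sum>u\<in>UNIV. if u = v then of_int (weight \<Gamma> v) *\<^sub>R k $ v else 0)
      + (\<Sum>u\<in>UNIV. if u \<in> nbrs \<Gamma> v then k $ u else 0)"
    by (simp add: mat_act_def sum.distrib)
  then show ?thesis by (simp add: sum.If_cases)
qed

lemma mat_act_linking_outside: "v \<notin> vertices \<Gamma> \<Longrightarrow> mat_act (linking_matrix \<Gamma>) k $ v = 0"
  using mat_act_linking_families[of \<Gamma> k] by (simp add: families_iff)

lemma reach_self: "v \<in> reach F v"
  by (simp add: reach_def)

lemma reach_step: "x \<in> reach F v \<Longrightarrow> {x, y} \<in> F \<Longrightarrow> y \<in> reach F v"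
  by (auto simp: reach_def adj_def intro: rtrancl_into_rtrancl)

lemma reach_induct [consumes 1, case_names self step]:
  assumes "x \<in> reach F v" "Q v" "\<And>y z. y \<in> reach F v \<Longrightarrow> Q y \<Longrightarrow> {y, z} \<in> F \<Longrightarrow> Q z"
  shows "Q x"
proof -
  have "(v, x) \<in> (adj F)\<^sup>*" using assms(1) by (simp add: reach_def)
  then show ?thesis
    by (induction rule: rtrancl_induct) (auto simp: assms(2) reach_def adj_def intro: assms(3))
qed

lemma reach_sym:
  assumes "x \<in> reach F v"
  shows "v \<in> reach F x"
proof -
  have "sym (adj F)" by (auto simp: adj_def sym_def insert_commute)
  then show ?thesis using assms sym_rtrancl unfolding reach_def by (metis Image_singleton_iff symD)
qed

lemma reach_trans: "y \<in> reach F x \<Longrightarrow> z \<in> reach F y \<Longrightarrow> z \<in> reach F x"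
  by (auto simp: reach_def)

lemma reach_mono: "F \<subseteq> G \<Longrightarrow> reach F v \<subseteq> reach G v"
proof
  fix x assume "F \<subseteq> G" "x \<in> reach F v"
  then show "x \<in> reach G v"
    by (induction rule: reach_induct[OF \<open>x \<in> reach F v\<close>]) (auto simp: reach_self intro: reach_step)
qed

text \<open>A path is extended edge by edge; when the new vertex already lies on it, the path is cut
  back to that vertex.\<close>

lemma simple_path:
  assumes "y \<in> reach F x"
  obtains p where "p \<noteq> []" "distinct p" "hd p = x" "last p = y" "successively (\<lambda>u v. {u, v} \<in> F) p"
proof -
  have "\<exists>p. p \<noteq> [] \<and> distinct p \<and> hd p = x \<and> last p = y \<and> successively (\<lambda>u v. {u, v} \<in> F) p"
    using assms
  proof (induction rule: reach_induct)
    case self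
    show ?case by (intro exI[of _ "[x]"]) auto
  next
    case (step y z)
    then obtain p where p: "p \<noteq> []" "distinct p" "hd p = x" "last p = y" "successively (\<lambda>u v. {u, v} \<in> F) p"
      by blast
    show ?case
    proof (cases "z \<in> set p")
      case True
      then obtain as bs where split: "p = as @ z # bs" by (meson split_list)
      then have "p = (as @ [z]) @ bs" by simp
      then have "successively (\<lambda>u v. {u, v} \<in> F) (as @ [z])"
        using p(5) successively_append_iff by blast
      moreover have "hd (as @ [z]) = x" using p(3) split by (cases as) auto
      ultimately show ?thesis using p(2) split by (intro exI[of _ "as @ [z]"]) auto
    next
      case False
      then show ?thesis using p step(2,3)
        by (intro exI[of _ "p @ [z]"]) (auto simp: successively_append_iff)
    qed
  qed
  then show thesis using that by blast
qed

text \<open>A simple path from \<open>a\<close> to \<open>b\<close> that avoids the edge has at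
  least three vertices, and the edge closes it to a cycle.\<close>

lemma bridge:
  assumes "\<nexists>p. is_cycle F p" "{a, b} \<in> F" "a \<noteq> b"
  shows "b \<notin> reach (F - {{a, b}}) a"
proof
  assume "b \<in> reach (F - {{a, b}}) a"
  then obtain p where p: "p \<noteq> []" "distinct p" "hd p = a" "last p = b"
    "successively (\<lambda>u v. {u, v} \<in> F - {{a, b}}) p" by (rule simple_path)
  have "3 \<le> length p"
  proof (rule ccontr)
    assume "\<not> 3 \<le> length p"
    moreover have "length p \<noteq> 0" using p(1) by simp
    ultimately consider "length p = 1" | "length p = 2" by linarith
    then show False
    proof cases
      case 1
      then obtain c where "p = [c]" by (auto simp: length_Suc_conv)
      then show False using p assms(3) by auto
    next
      case 2
      then obtain c d where "p = [c, d]" by (auto simp: numeral_2_eq_2 length_Suc_conv)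
      then show False using p by auto
    qed
  qed
  moreover have "successively (\<lambda>u v. {u, v} \<in> F) p"
    using p(5) by (rule successively_mono) auto
  ultimately have "is_cycle F p" using p assms(2) by (simp add: is_cycle_def insert_commute)
  with assms(1) show False by blast
qed

lemma reach_remove_edge:
  assumes "x \<in> reach F a"
  shows "x \<in> reach (F - {{a, b}}) a \<union> reach (F - {{a, b}}) b"
  using assms
proof (induction rule: reach_induct)
  case (step y z)
  show ?case
  proof (cases "{y, z} = {a, b}")
    case True
    then show ?thesis by (auto simp: doubleton_eq_iff reach_self)
  next
    case False
    then have "{y, z} \<in> F - {{a, b}}" using step(2) by simp
    then have "z \<in> reach (F - {{a, b}}) v" if "y \<in> reach (F - {{a, b}}) v" for v
      using that by (rule reach_step[rotated])
    then show ?thesis using step(3) by blast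
  qed
qed (simp add: reach_self)

text \<open>Count the ordered pairs on an edge whose second vertex lies in \<open>R\<close>: an edge
  inside \<open>R\<close> is counted twice, one that leaves \<open>R\<close> once. The sum is odd
  when a single edge leaves \<open>R\<close>, as for one side of a cut edge.\<close>

lemma sum_degree:
  assumes "weighted_tree \<Gamma>"
  shows "(\<Sum>v\<in>R. degree \<Gamma> v) =
    2 * card {e \<in> edges \<Gamma>. e \<subseteq> R} + card {(u, v). {u, v} \<in> edges \<Gamma> \<and> v \<in> R \<and> u \<notin> R}"
proof -
  define A where "A = {(u, v). {u, v} \<in> {e \<in> edges \<Gamma>. e \<subseteq> R}}"
  define B where "B = {(u, v). {u, v} \<in> edges \<Gamma> \<and> v \<in> R \<and> u \<notin> R}"
  define C where "C = (\<Union>v\<in>R. (\<lambda>u. (u, v)) ` {u. {u, v} \<in> edges \<Gamma>})"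
  have "card C = (\<Sum>v\<in>R. card ((\<lambda>u. (u, v)) ` {u. {u, v} \<in> edges \<Gamma>}))"
    unfolding C_def by (rule card_UN_disjoint) auto
  also have "\<dots> = (\<Sum>v\<in>R. degree \<Gamma> v)"
    by (simp add: degree_def card_image inj_on_def)
  finally have C: "(\<Sum>v\<in>R. degree \<Gamma> v) = card C" ..
  have "C = A \<union> B" "A \<inter> B = {}" by (auto simp: A_def B_def C_def)
  then have "card C = card A + card B" by (simp add: card_Un_disjoint)
  moreover have "card A = 2 * card {e \<in> edges \<Gamma>. e \<subseteq> R}"
  proof -
    have "A = (\<Union>e\<in>{e \<in> edges \<Gamma>. e \<subseteq> R}. {(u, v). {u, v} = e})" by (auto simp: A_def)
    then have "card A = (\<Sum>e\<in>{e \<in> edges \<Gamma>. e \<subseteq> R}. card {(u, v). {u, v} = e})"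
      by (simp only:) (intro card_UN_disjoint, auto)
    also have "\<dots> = (\<Sum>e\<in>{e \<in> edges \<Gamma>. e \<subseteq> R}. 2)"
    proof (intro sum.cong refl)
      fix e assume "e \<in> {e \<in> edges \<Gamma>. e \<subseteq> R}"
      then obtain a b where e: "e = {a, b}" "a \<noteq> b"
        using weighted_treeD(2)[OF assms, of e] card_2_iff[of e] by blast
      have "{(u, v). {u, v} = e} = {(a, b), (b, a)}" by (auto simp: e doubleton_eq_iff)
      then show "card {(u, v). {u, v} = e} = 2" using e(2) by simp
    qed
    finally show ?thesis by simp
  qed
  ultimately show ?thesis by (simp add: C B_def)
qed

lemma odd_sum_degree:
  assumes "weighted_tree \<Gamma>" "{(u, v). {u, v} \<in> edges \<Gamma> \<and> v \<in> R \<and> u \<notin> R} = {p}"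
  shows "odd (\<Sum>v\<in>R. degree \<Gamma> v)"
  using sum_degree[OF assms(1), of R] assms(2) by simp

lemma trace_linking: "trace (linking_matrix \<Gamma>) = (\<Sum>v\<in>vertices \<Gamma>. of_int (weight \<Gamma> v))"
proof -
  have "trace (linking_matrix \<Gamma>) = (\<Sum>v\<in>UNIV. if v \<in> vertices \<Gamma> then of_int (weight \<Gamma> v) else 0)"
    unfolding trace_def by (intro sum.cong) (auto simp: linking_matrix_def)
  then show ?thesis by (simp add: sum.If_cases)
qed

section \<open>Finiteness of the summation set\<close>

lemma root_lattice_0: "0 \<in> root_lattice \<Delta>"
  unfolding root_lattice_def by (rule image_eqI[of _ _ "\<lambda>_. 0"]) auto

lemma root_lattice_add: "x \<in> root_lattice \<Delta> \<Longrightarrow> y \<in> root_lattice \<Delta> \<Longrightarrow> x + y \<in> root_lattice \<Delta>"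
  unfolding root_lattice_def
proof (elim rangeE)
  fix c d :: "'a \<Rightarrow> int"
  assume "x = (\<Sum>\<alpha>\<in>\<Delta>. of_int (c \<alpha>) *\<^sub>R \<alpha>)" "y = (\<Sum>\<alpha>\<in>\<Delta>. of_int (d \<alpha>) *\<^sub>R \<alpha>)"
  then show "x + y \<in> range (\<lambda>c. \<Sum>\<alpha>\<in>\<Delta>. of_int (c \<alpha>) *\<^sub>R \<alpha>)"
    by (intro image_eqI[of _ _ "\<lambda>\<alpha>. c \<alpha> + d \<alpha>"]) (simp_all add: scaleR_add_left sum.distrib)
qed

lemma root_lattice_scale: "x \<in> root_lattice \<Delta> \<Longrightarrow> of_int n *\<^sub>R x \<in> root_lattice \<Delta>"
  unfolding root_lattice_def
proof (elim rangeE)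
  fix c :: "'a \<Rightarrow> int"
  assume "x = (\<Sum>\<alpha>\<in>\<Delta>. of_int (c \<alpha>) *\<^sub>R \<alpha>)"
  then show "of_int n *\<^sub>R x \<in> range (\<lambda>c. \<Sum>\<alpha>\<in>\<Delta>. of_int (c \<alpha>) *\<^sub>R \<alpha>)"
    by (intro image_eqI[of _ _ "\<lambda>\<alpha>. n * c \<alpha>"]) (simp_all add: scaleR_sum_right)
qed

lemma root_lattice_uminus: "x \<in> root_lattice \<Delta> \<Longrightarrow> - x \<in> root_lattice \<Delta>"
  using root_lattice_scale[of x \<Delta> "-1"] by simp

lemma root_lattice_diff: "x \<in> root_lattice \<Delta> \<Longrightarrow> y \<in> root_lattice \<Delta> \<Longrightarrow> x - y \<in> root_lattice \<Delta>"
  using root_lattice_add[of x \<Delta> "- y"] root_lattice_uminus[of y \<Delta>] by simp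

lemma root_lattice_sum: "(\<And>i. i \<in> I \<Longrightarrow> f i \<in> root_lattice \<Delta>) \<Longrightarrow> sum f I \<in> root_lattice \<Delta>"
  by (induction I rule: infinite_finite_induct) (auto simp: root_lattice_0 root_lattice_add)

lemma root_lattice_root: "finite \<Delta> \<Longrightarrow> \<alpha> \<in> \<Delta> \<Longrightarrow> \<alpha> \<in> root_lattice \<Delta>"
  unfolding root_lattice_def
  by (rule image_eqI[of _ _ "\<lambda>\<beta>. if \<beta> = \<alpha> then 1 else 0"])
    (auto simp: if_distrib[of of_int] if_distrib[of "\<lambda>c. c *\<^sub>R _"] cong: if_cong)

lemma families_root_lattice_nth:
  assumes "k \<in> families V (root_lattice \<Delta>)"
  shows "k $ v \<in> root_lattice \<Delta>"
  using assms root_lattice_0 by (cases "v \<in> V") (auto simp: families_iff)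

lemma mat_act_linking_lattice:
  assumes "k \<in> families (vertices \<Gamma>) (root_lattice \<Delta>)"
  shows "mat_act (linking_matrix \<Gamma>) k \<in> families (vertices \<Gamma>) (root_lattice \<Delta>)"
proof -
  have "linking_matrix \<Gamma> $ u $ v *\<^sub>R k $ v \<in> root_lattice \<Delta>" for u v
    using root_lattice_scale[OF families_root_lattice_nth[OF assms, of v], of "weight \<Gamma> v"]
      families_root_lattice_nth[OF assms, of v] root_lattice_0
    by (auto simp: linking_matrix_def)
  then have "mat_act (linking_matrix \<Gamma>) k $ u \<in> root_lattice \<Delta>" for u
    by (simp add: mat_act_def root_lattice_sum)
  then show ?thesis using mat_act_linking_families[of \<Gamma> k] by (simp add: families_iff)
qed

text \<open>The matrix acts on each coordinate of the labels separately, so the form splits over an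
  orthonormal basis. This carries weak negative definiteness from real families to vector-valued
  ones.\<close>

lemma mat_act_inner_Basis:
  "x \<bullet> mat_act M x = (\<Sum>b\<in>Basis. (\<chi> v. x $ v \<bullet> b) \<bullet> mat_act M (\<chi> v. x $ v \<bullet> b))"
proof -
  have "x \<bullet> mat_act M x = (\<Sum>u\<in>UNIV. \<Sum>b\<in>Basis. (x $ u \<bullet> b) * (mat_act M x $ u \<bullet> b))"
    by (simp only: inner_vec_def euclidean_inner[symmetric])
  also have "\<dots> = (\<Sum>b\<in>Basis. \<Sum>u\<in>UNIV. (x $ u \<bullet> b) * (mat_act M x $ u \<bullet> b))"
    by (rule sum.swap)
  also have "\<dots> = (\<Sum>b\<in>Basis. (\<chi> v. x $ v \<bullet> b) \<bullet> mat_act M (\<chi> v. x $ v \<bullet> b))"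
    by (simp add: inner_vec_def mat_act_def inner_sum_left)
  finally show ?thesis .
qed

lemma weakly_negative_definite_inner:
  fixes x :: "'a::euclidean_space ^ 'v::finite"
  assumes "weakly_negative_definite \<Gamma>" "x \<in> families {v \<in> vertices \<Gamma>. 3 \<le> degree \<Gamma> v} UNIV" "x \<noteq> 0"
  shows "x \<bullet> mat_act (linking_inverse \<Gamma>) x < 0"
proof -
  let ?x = "\<lambda>b. (\<chi> v. x $ v \<bullet> b) :: real ^ 'v"
  have fam: "?x b \<in> families {v \<in> vertices \<Gamma>. 3 \<le> degree \<Gamma> v} UNIV" for b
    using assms(2) by (auto simp: families_iff)
  have neg: "?x b \<bullet> mat_act (linking_inverse \<Gamma>) (?x b) < 0" if "?x b \<noteq> 0" for b
    using assms(1) fam that unfolding weakly_negative_definite_def mat_act_real by blast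
  obtain v where "x $ v \<noteq> 0" using assms(3) by (auto simp: vec_eq_iff)
  then obtain b where b: "b \<in> Basis" "x $ v \<bullet> b \<noteq> 0" using euclidean_all_zero_iff by blast
  then have "?x b \<noteq> 0" by (auto simp: vec_eq_iff)
  have le: "?x b \<bullet> mat_act (linking_inverse \<Gamma>) (?x b) \<le> 0" for b
    using neg[of b] by (cases "?x b = 0") auto
  have "(\<Sum>b\<in>Basis. ?x b \<bullet> mat_act (linking_inverse \<Gamma>) (?x b)) < (\<Sum>b\<in>(Basis :: 'a set). 0)"
  proof (rule sum_strict_mono_ex1)
    show "\<exists>b\<in>(Basis :: 'a set). ?x b \<bullet> mat_act (linking_inverse \<Gamma>) (?x b) < 0"
      using neg[OF \<open>?x b \<noteq> 0\<close>] b(1) by (rule bexI)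
  qed (rule finite_Basis, rule ballI, rule le)
  then show ?thesis using mat_act_inner_Basis[of x "linking_inverse \<Gamma>"] by simp
qed

text \<open>By compactness of the unit sphere, the form attains a negative maximum there, and
  homogeneity spreads the bound.\<close>

lemma weakly_negative_definite_bound:
  assumes "weakly_negative_definite \<Gamma>"
  obtains c where "c > 0" "\<And>x :: 'a::euclidean_space ^ 'v::finite.
    x \<in> families {v \<in> vertices \<Gamma>. 3 \<le> degree \<Gamma> v} UNIV \<Longrightarrow>
    x \<bullet> mat_act (linking_inverse \<Gamma>) x \<le> - c * (norm x)\<^sup>2"
proof -
  let ?F = "families {v \<in> vertices \<Gamma>. 3 \<le> degree \<Gamma> v} UNIV :: ('a ^ 'v) set"
  let ?q = "\<lambda>x :: 'a ^ 'v. x \<bullet> mat_act (linking_inverse \<Gamma>) x"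
  define K where "K = ?F \<inter> sphere 0 1"
  have unit: "(1 / norm x) *\<^sub>R x \<in> K" if "x \<in> ?F" "x \<noteq> 0" for x
    using that subspace_scale[OF subspace_families] by (simp add: K_def)
  have scale: "?q x = (norm x)\<^sup>2 * ?q ((1 / norm x) *\<^sub>R x)" if "x \<noteq> 0" for x
    using that by (simp add: linear_cmul[OF linear_mat_act] power2_eq_square)
  show thesis
  proof (cases "K = {}")
    \<comment> \<open>The subspace is then zero, and any positive constant serves.\<close>
    case True
    then have "x = 0" if "x \<in> ?F" for x using unit that by blast
    then have "?q x \<le> - 1 * (norm x)\<^sup>2" if "x \<in> ?F" for x using that by force
    then show thesis using that[of 1] by simp
  next
    case False
    have "compact K" unfolding K_def by (simp add: closed_Int_compact closed_subspace subspace_families)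
    moreover have "continuous_on K ?q"
      by (intro continuous_intros linear_continuous_on linear_conv_bounded_linear[THEN iffD1] linear_mat_act)
    ultimately obtain z where z: "z \<in> K" "\<And>x. x \<in> K \<Longrightarrow> ?q x \<le> ?q z"
      using continuous_attains_sup[OF _ False, of ?q] by blast
    have "z \<noteq> 0" using z(1) by (auto simp: K_def)
    then have "?q z < 0"
      using z(1) by (intro weakly_negative_definite_inner[OF assms]) (simp_all add: K_def)
    moreover have "?q x \<le> - (- ?q z) * (norm x)\<^sup>2" if "x \<in> ?F" for x
    proof (cases "x = 0")
      case False
      then show ?thesis
        using mult_left_mono[OF z(2)[OF unit[OF that False]], of "(norm x)\<^sup>2"] scale[OF False]
        by (simp add: mult.commute)
    qed simp
    ultimately show thesis using that[of "- ?q z"] by simp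
  qed
qed

lemma finite_vec_box:
  assumes "finite K"
  shows "finite {x :: 'b ^ 'v::finite. \<forall>v. x $ v \<in> K}"
proof -
  have "{x :: 'b ^ 'v. \<forall>v. x $ v \<in> K} \<subseteq> vec_lambda ` (Pi\<^sub>E UNIV (\<lambda>_. K))"
    by (auto intro!: image_eqI[of _ _ "vec_nth _"])
  moreover have "finite (Pi\<^sub>E (UNIV :: 'v set) (\<lambda>_. K))" using assms by (intro finite_PiE) auto
  ultimately show ?thesis by (meson finite_imageI finite_subset)
qed

section \<open>Lattice points of bounded norm and the summation set\<close>

context based_root_system
begin

lemma root_lattice_in_span: "x \<in> root_lattice \<Delta> \<Longrightarrow> x \<in> span \<Delta>"
  by (auto simp: root_lattice_def intro: span_sum span_scale span_base)

lemma root_lattice_coroot_int: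
  assumes "x \<in> root_lattice \<Delta>" "\<alpha> \<in> \<Delta>"
  shows "2 * (x \<bullet> \<alpha>) / (\<alpha> \<bullet> \<alpha>) \<in> \<int>"
proof -
  obtain c :: "'a \<Rightarrow> int" where c: "x = (\<Sum>\<beta>\<in>\<Delta>. of_int (c \<beta>) *\<^sub>R \<beta>)"
    using assms(1) by (auto simp: root_lattice_def)
  have "2 * (x \<bullet> \<alpha>) / (\<alpha> \<bullet> \<alpha>) = (\<Sum>\<beta>\<in>\<Delta>. of_int (c \<beta>) * (2 * (\<beta> \<bullet> \<alpha>) / (\<alpha> \<bullet> \<alpha>)))"
    by (simp add: c inner_sum_left sum_distrib_left sum_divide_distrib mult_ac)
  also have "\<dots> \<in> \<int>" using assms(2) cartan_int by (intro Ints_sum Ints_mult) auto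
  finally show ?thesis .
qed

text \<open>A lattice vector lies in the span of the roots and is therefore determined by its
  pairings with the coroots, which are integers bounded by Cauchy-Schwarz.\<close>

lemma finite_root_lattice_bounded: "finite {x \<in> root_lattice \<Delta>. norm x \<le> M}"
proof (rule inj_on_finite)
  let ?g = "\<lambda>x. \<lambda>\<alpha>\<in>\<Delta>. 2 * (x \<bullet> \<alpha>) / (\<alpha> \<bullet> \<alpha>)"
  let ?B = "\<lambda>\<alpha>. {k \<in> \<int>. \<bar>k\<bar> \<le> 2 * M * norm \<alpha> / (\<alpha> \<bullet> \<alpha>)}"
  show "inj_on ?g {x \<in> root_lattice \<Delta>. norm x \<le> M}"
  proof (rule inj_onI)
    fix x y assume "x \<in> {x \<in> root_lattice \<Delta>. norm x \<le> M}" "y \<in> {x \<in> root_lattice \<Delta>. norm x \<le> M}"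
    then have span: "x - y \<in> span \<Delta>" by (simp add: root_lattice_in_span span_diff)
    assume eq: "?g x = ?g y"
    have "(x - y) \<bullet> \<alpha> = 0" if "\<alpha> \<in> \<Delta>" for \<alpha>
    proof -
      have "\<alpha> \<bullet> \<alpha> \<noteq> 0" using that zero_not_root by auto
      then show ?thesis using fun_cong[OF eq, of \<alpha>] that by (simp add: inner_diff_left)
    qed
    then have "orthogonal (x - y) (x - y)"
      by (intro orthogonal_to_span[OF span]) (auto simp: orthogonal_def)
    then show "x = y" by (simp add: orthogonal_self)
  qed
  show "?g ` {x \<in> root_lattice \<Delta>. norm x \<le> M} \<subseteq> Pi\<^sub>E \<Delta> ?B"
  proof (intro image_subsetI PiE_I)
    fix x \<alpha> assume x: "x \<in> {x \<in> root_lattice \<Delta>. norm x \<le> M}" and \<alpha>: "\<alpha> \<in> \<Delta>"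
    have "\<bar>x \<bullet> \<alpha>\<bar> \<le> M * norm \<alpha>"
      using Cauchy_Schwarz_ineq2[of x \<alpha>] x mult_right_mono[of "norm x" M "norm \<alpha>"] by auto
    then have "\<bar>2 * (x \<bullet> \<alpha>) / (\<alpha> \<bullet> \<alpha>)\<bar> \<le> 2 * M * norm \<alpha> / (\<alpha> \<bullet> \<alpha>)"
      by (simp add: abs_mult divide_right_mono)
    then show "?g x \<alpha> \<in> ?B \<alpha>" using root_lattice_coroot_int x \<alpha> by auto
  qed auto
  show "finite (Pi\<^sub>E \<Delta> ?B)"
    using finite_roots finite_abs_int_segment by (intro finite_PiE) auto
qed

lemma finite_families_bounded:
  "finite {x :: 'a ^ 'v::finite. x \<in> families V (root_lattice \<Delta>) \<and> norm x \<le> M}"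
proof -
  have "{x :: 'a ^ 'v. x \<in> families V (root_lattice \<Delta>) \<and> norm x \<le> M}
    \<subseteq> {x. \<forall>v. x $ v \<in> {y \<in> root_lattice \<Delta>. norm y \<le> M}}"
    using families_root_lattice_nth Finite_Cartesian_Product.norm_nth_le order_trans by blast
  then show ?thesis using finite_vec_box[OF finite_root_lattice_bounded] finite_subset by blast
qed

lemma finite_vertex_coeff_support: "finite {\<mu>. \<exists>d\<le>2. vertex_coeff \<Delta> \<Phi> d \<mu> \<noteq> 0}"
proof -
  have "{\<mu>. \<exists>d\<le>2. vertex_coeff \<Delta> \<Phi> d \<mu> \<noteq> 0} = (\<Union>d\<in>{..2}. Poly_Mapping.keys (weyl_denom \<Delta> \<Phi> ^ (2 - d)))"
    by (auto simp: vertex_coeff_def in_keys_iff)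
  then show ?thesis by simp
qed

lemma label_reps_families: "l \<in> label_reps \<Delta> \<Phi> \<Gamma> \<Longrightarrow> l \<in> families (vertices \<Gamma>) UNIV"
  by (auto simp: label_reps_def families_iff label_shift_def)

lemma label_class_families:
  assumes "l0 \<in> families (vertices \<Gamma>) UNIV" "l \<in> label_class \<Delta> \<Gamma> l0"
  shows "l \<in> families (vertices \<Gamma>) UNIV"
  using assms by (auto simp: label_class_def families_iff mat_act_linking_outside)

text \<open>A contributing family splits as \<open>h + m\<close> with \<open>h\<close> on the
  vertices of degree at least 3. A fixed exponent fixes the value of the form. Its part in
  \<open>h\<close> dominates \<open>c * (norm h)\<^sup>2\<close>, while the mixed terms grow only
  linearly in \<open>norm h\<close>, so \<open>h\<close> is bounded.\<close>

lemma finite_summation_set: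
  fixes \<Gamma> :: "'v::finite wgraph"
  assumes "weakly_negative_definite \<Gamma>" "l0 \<in> families (vertices \<Gamma>) UNIV"
  shows "finite {l \<in> label_class \<Delta> \<Gamma> l0. summand_coeff \<Delta> \<Phi> \<Gamma> l \<noteq> 0 \<and> summand_exponent \<Delta> \<Phi> \<Gamma> l = r}"
    (is "finite ?S")
proof -
  let ?H = "{v \<in> vertices \<Gamma>. 3 \<le> degree \<Gamma> v}"
  let ?C = "mat_act (linking_inverse \<Gamma>) :: 'a ^ 'v \<Rightarrow> _"
  obtain c where c: "c > 0" "\<And>x :: 'a ^ 'v. x \<in> families ?H UNIV \<Longrightarrow> x \<bullet> ?C x \<le> - c * (norm x)\<^sup>2"
    using weakly_negative_definite_bound[OF assms(1)] by blast
  obtain B where B: "B > 0" "\<And>x :: 'a ^ 'v. norm (?C x) \<le> B * norm x"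
    using linear_bounded_pos[OF linear_mat_act] by blast
  \<comment> \<open>The value 0 is added because \<open>m\<close> vanishes at vertices of high
    degree and off the tree.\<close>
  define K where "K = insert 0 {\<mu>. \<exists>d\<le>2. vertex_coeff \<Delta> \<Phi> d \<mu> \<noteq> 0}"
  have "finite {x :: 'a ^ 'v. \<forall>v. x $ v \<in> K}"
    using finite_vertex_coeff_support by (intro finite_vec_box) (simp add: K_def)
  then have "bounded {x :: 'a ^ 'v. \<forall>v. x $ v \<in> K}" by (rule finite_imp_bounded)
  then obtain M where M: "\<And>x :: 'a ^ 'v. (\<And>v. x $ v \<in> K) \<Longrightarrow> norm x \<le> M"
    by (auto simp: bounded_iff)
  have "M \<ge> 0" using M[of 0] by (simp add: K_def)
  \<comment> \<open>The value of the form on every family of exponent \<open>r\<close>.\<close>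
  define R where "R = (3 * of_int (signature \<Gamma>) - trace (linking_matrix \<Gamma>)) * (\<rho> \<bullet> \<rho>) - 2 * r"
  \<comment> \<open>The quotient arises on dividing the quadratic inequality for
    \<open>norm h\<close> by \<open>norm h\<close>, the 1 covers the case
    \<open>norm h \<le> 1\<close>, and the last \<open>M\<close> bounds \<open>m\<close>.\<close>
  define N where "N = 1 + (2 * B * M + B * M\<^sup>2 + \<bar>R\<bar>) / c + M"
  have bound: "norm l \<le> N" if l: "l \<in> ?S" for l
  proof -
    define h where "h = (\<chi> v. if v \<in> ?H then l $ v else 0)"
    define m where "m = (\<chi> v. if v \<in> ?H then 0 else l $ v)"
    have lhm: "l = h + m" by (auto simp: h_def m_def vec_eq_iff)
    have hF: "h \<in> families ?H UNIV" by (auto simp: h_def families_iff)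
    have fam: "l \<in> families (vertices \<Gamma>) UNIV" using l assms(2) label_class_families by blast
    have "m $ v \<in> K" for v
    proof (cases "v \<in> vertices \<Gamma> \<and> degree \<Gamma> v \<le> 2")
      case True
      then have "vertex_coeff \<Delta> \<Phi> (degree \<Gamma> v) (l $ v) \<noteq> 0"
        using l by (auto simp: summand_coeff_def)
      then show ?thesis using True by (auto simp: K_def m_def)
    next
      case False
      then show ?thesis using fam by (auto simp: K_def m_def families_iff not_le)
    qed
    then have mM: "norm m \<le> M" by (rule M)
    have "l \<bullet> ?C l = R" using l by (auto simp: summand_exponent_def R_def field_simps)
    then have "- (h \<bullet> ?C h) = h \<bullet> ?C m + m \<bullet> ?C h + m \<bullet> ?C m - R"
      by (simp add: lhm linear_add[OF linear_mat_act] inner_add_left inner_add_right)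
    moreover have CS: "x \<bullet> ?C y \<le> B * norm x * norm y" for x y
      using norm_cauchy_schwarz[of x "?C y"] mult_left_mono[OF B(2)[of y], of "norm x"]
      by (simp add: mult_ac)
    moreover have "B * norm h * norm m \<le> B * M * norm h" "B * norm m * norm h \<le> B * M * norm h"
      using B(1) mult_right_mono[OF mM norm_ge_zero[of h]] by (simp_all add: mult_ac)
    moreover have "B * norm m * norm m \<le> B * M\<^sup>2"
      using B(1) power_mono[OF mM norm_ge_zero, of 2] by (simp add: power2_eq_square mult.assoc)
    moreover have "h \<bullet> ?C m \<le> B * norm h * norm m" "m \<bullet> ?C h \<le> B * norm m * norm h"
      "m \<bullet> ?C m \<le> B * norm m * norm m" by (rule CS)+
    ultimately have main: "c * (norm h)\<^sup>2 \<le> 2 * B * M * norm h + B * M\<^sup>2 + \<bar>R\<bar>"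
      using c(2)[OF hF] by linarith
    have "norm h \<le> 1 + (2 * B * M + B * M\<^sup>2 + \<bar>R\<bar>) / c"
    proof (cases "norm h \<le> 1")
      case True
      moreover have "0 \<le> (2 * B * M + B * M\<^sup>2 + \<bar>R\<bar>) / c" using B(1) c(1) \<open>M \<ge> 0\<close> by simp
      ultimately show ?thesis by linarith
    next
      case False
      have "B * M\<^sup>2 + \<bar>R\<bar> \<le> (B * M\<^sup>2 + \<bar>R\<bar>) * norm h"
        using False B(1) mult_left_mono[of 1 "norm h" "B * M\<^sup>2 + \<bar>R\<bar>"] by simp
      with main have "c * norm h * norm h \<le> (2 * B * M + B * M\<^sup>2 + \<bar>R\<bar>) * norm h"
        by (simp add: power2_eq_square algebra_simps)
      moreover have "norm h > 0" using False by linarith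
      ultimately have "c * norm h \<le> 2 * B * M + B * M\<^sup>2 + \<bar>R\<bar>"
        by (simp only: mult_le_cancel_right_pos)
      then have "norm h \<le> (2 * B * M + B * M\<^sup>2 + \<bar>R\<bar>) / c" using c(1) by (simp add: field_simps)
      then show ?thesis by simp
    qed
    then show ?thesis using norm_triangle_ineq[of h m] mM by (simp add: lhm N_def)
  qed
  \<comment> \<open>The labels themselves lie in a translate of the lattice; their differences from
    \<open>l0\<close> are lattice families.\<close>
  have "?S \<subseteq> (\<lambda>k. k + l0) ` {k. k \<in> families (vertices \<Gamma>) (root_lattice \<Delta>) \<and> norm k \<le> N + norm l0}"
  proof
    fix l assume l: "l \<in> ?S"
    then obtain k where "k \<in> families (vertices \<Gamma>) (root_lattice \<Delta>)" "l = mat_act (linking_matrix \<Gamma>) k + l0"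
      by (auto simp: label_class_def)
    moreover have "norm (l - l0) \<le> N + norm l0" using bound[OF l] norm_triangle_ineq4[of l l0] by linarith
    ultimately show "l \<in> (\<lambda>k. k + l0) ` {k. k \<in> families (vertices \<Gamma>) (root_lattice \<Delta>) \<and> norm k \<le> N + norm l0}"
      using mat_act_linking_lattice by (intro image_eqI[of _ _ "l - l0"]) auto
  qed
  then show ?thesis using finite_families_bounded finite_subset by blast
qed

end

text \<open>Terms are grouped by their image under \<open>T\<close>. Finiteness on the side of
  \<open>\<Gamma>'\<close> is inherited: a nonzero coefficient there makes the fibre sum nonzero, as
  \<open>s\<close> is nonzero, so the fibre is not empty.\<close>

lemma Zhat_transfer:
  assumes fin: "\<And>r. finite {l \<in> b. summand_coeff \<Delta> \<Phi> \<Gamma> l \<noteq> 0 \<and> summand_exponent \<Delta> \<Phi> \<Gamma> l = r}"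
    and T: "\<And>l. l \<in> b \<Longrightarrow> summand_coeff \<Delta> \<Phi> \<Gamma> l \<noteq> 0 \<Longrightarrow>
      T l \<in> b' \<and> summand_exponent \<Delta> \<Phi> \<Gamma>' (T l) = summand_exponent \<Delta> \<Phi> \<Gamma> l"
    and fibre: "\<And>l'. l' \<in> b' \<Longrightarrow>
      (\<Sum>l\<in>{l \<in> b. summand_coeff \<Delta> \<Phi> \<Gamma> l \<noteq> 0 \<and> T l = l'}. summand_coeff \<Delta> \<Phi> \<Gamma> l)
        = s * summand_coeff \<Delta> \<Phi> \<Gamma>' l'"
    and sgn: "s * (-1) ^ (card (pos_roots \<Delta> \<Phi>) * num_positive \<Gamma>)
      = (-1) ^ (card (pos_roots \<Delta> \<Phi>) * num_positive \<Gamma>')"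
  shows "Zhat \<Delta> \<Phi> \<Gamma> b = Zhat \<Delta> \<Phi> \<Gamma>' b'"
proof
  fix r
  let ?c = "summand_coeff \<Delta> \<Phi> \<Gamma>" and ?c' = "summand_coeff \<Delta> \<Phi> \<Gamma>'"
  let ?e = "summand_exponent \<Delta> \<Phi> \<Gamma>" and ?e' = "summand_exponent \<Delta> \<Phi> \<Gamma>'"
  define S where "S = {l \<in> b. ?c l \<noteq> 0 \<and> ?e l = r}"
  define S' where "S' = {l \<in> b'. ?c' l \<noteq> 0 \<and> ?e' l = r}"
  have "finite S" unfolding S_def by (rule fin)
  have s0: "s \<noteq> 0" using sgn by auto
  have TS: "l' \<in> b' \<and> ?e' l' = r" if "l' \<in> T ` S" for l' using that T by (auto simp: S_def)
  have inner: "(\<Sum>l\<in>{l \<in> S. T l = l'}. ?c l) = s * ?c' l'" if "l' \<in> b'" "?e' l' = r" for l'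
  proof -
    have "{l \<in> S. T l = l'} = {l \<in> b. ?c l \<noteq> 0 \<and> T l = l'}" using T that(2) by (auto simp: S_def)
    then show ?thesis using fibre[OF that(1)] by simp
  qed
  have "(\<Sum>l\<in>S. ?c l) = (\<Sum>l'\<in>T ` S. \<Sum>l\<in>{l \<in> S. T l = l'}. ?c l)"
    using \<open>finite S\<close> by (rule sum.image_gen)
  also have "\<dots> = (\<Sum>l'\<in>T ` S. s * ?c' l')" using inner TS by (intro sum.cong) auto
  also have "\<dots> = (\<Sum>l'\<in>S'. s * ?c' l')"
  proof (rule sum.mono_neutral_right)
    show "finite (T ` S)" using \<open>finite S\<close> by simp
    show "S' \<subseteq> T ` S"
    proof
      fix l' assume l': "l' \<in> S'"
      then have "(\<Sum>l\<in>{l \<in> S. T l = l'}. ?c l) \<noteq> 0" using inner[of l'] s0 by (simp add: S'_def)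
      then have "{l \<in> S. T l = l'} \<noteq> {}" by (metis sum.empty)
      then show "l' \<in> T ` S" by blast
    qed
    show "\<forall>l'\<in>T ` S - S'. s * ?c' l' = 0" using TS by (auto simp: S'_def)
  qed
  finally have "(\<Sum>l\<in>S. ?c l) = s * (\<Sum>l'\<in>S'. ?c' l')" by (simp add: sum_distrib_left)
  then have "Zhat \<Delta> \<Phi> \<Gamma> b r = (s * (-1) ^ (card (pos_roots \<Delta> \<Phi>) * num_positive \<Gamma>)) * (\<Sum>l'\<in>S'. ?c' l')"
    by (simp add: Zhat_def S_def mult_ac)
  then show "Zhat \<Delta> \<Phi> \<Gamma> b r = Zhat \<Delta> \<Phi> \<Gamma>' b' r"
    unfolding sgn by (simp add: Zhat_def S'_def)
qed

section \<open>Invariance under the Neumann moves\<close>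

text \<open>Replaces the inverse matrix in the exponent by an explicitly known solution
  \<open>k\<close>.\<close>

lemma inner_linking_inverse:
  assumes "weakly_negative_definite \<Gamma>" "k \<in> families (vertices \<Gamma>) UNIV" "mat_act (linking_matrix \<Gamma>) k = l"
  shows "l \<bullet> mat_act (linking_inverse \<Gamma>) l = l \<bullet> k"
  using mat_act_linking_inverse(1)[of \<Gamma> k] assms by (auto simp: weakly_negative_definite_def)

text \<open>The embedding bounds both indices from below, one of them with an extra 1 from
  \<open>e\<close>. In each tree the indices add up to the number of vertices, and these numbers
  differ by one, so both bounds are equalities.\<close>

lemma inertia_blow_up:
  fixes \<Gamma> \<Gamma>' :: "'v::finite wgraph" and h :: "real ^ 'v \<Rightarrow> real ^ 'v"
  assumes inv: "weakly_negative_definite \<Gamma>" "weakly_negative_definite \<Gamma>'" and \<epsilon>: "\<epsilon> \<in> {1, -1 :: int}"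
    and h: "linear h" "\<And>x. x \<in> families (vertices \<Gamma>') UNIV \<Longrightarrow> h x \<in> families (vertices \<Gamma>) UNIV"
      "\<And>x. x \<in> families (vertices \<Gamma>') UNIV \<Longrightarrow>
         h x \<bullet> mat_act (linking_matrix \<Gamma>) (h x) = x \<bullet> mat_act (linking_matrix \<Gamma>') x"
    and e: "e \<in> families (vertices \<Gamma>) UNIV" "e \<bullet> mat_act (linking_matrix \<Gamma>) e = of_int \<epsilon>"
      "\<And>x. x \<in> families (vertices \<Gamma>') UNIV \<Longrightarrow> e \<bullet> mat_act (linking_matrix \<Gamma>) (h x) = 0"
    and card: "card (vertices \<Gamma>) = Suc (card (vertices \<Gamma>'))"
  shows "num_positive \<Gamma> = num_positive \<Gamma>' + (if \<epsilon> = 1 then 1 else 0)"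
    and "signature \<Gamma> = signature \<Gamma>' + \<epsilon>"
proof -
  have inv: "\<exists>C. is_linking_inverse \<Gamma> C" "\<exists>C. is_linking_inverse \<Gamma>' C"
    using inv by (auto simp: weakly_negative_definite_def)
  note mono = count_eigenvalues_mono[OF inv(1) _ h]
  note sums = count_eigenvalues_sum[OF inv(1)] count_eigenvalues_sum[OF inv(2)]
  have "num_positive \<Gamma> = num_positive \<Gamma>' + (if \<epsilon> = 1 then 1 else 0) \<and> signature \<Gamma> = signature \<Gamma>' + \<epsilon>"
  proof (cases "\<epsilon> = 1")
    case True
    have "count_eigenvalues \<Gamma>' {t. 1 * t > 0} + 1 \<le> count_eigenvalues \<Gamma> {t. 1 * t > 0}"
      using True e by (intro mono(2)[of _ e]) auto
    moreover have "count_eigenvalues \<Gamma>' {t. (-1) * t > 0} \<le> count_eigenvalues \<Gamma> {t. (-1) * t > 0}"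
      by (intro mono(1)) auto
    ultimately show ?thesis using True sums card unfolding num_positive_alt signature_alt by auto
  next
    case False
    then have "\<epsilon> = -1" using \<epsilon> by auto
    have "count_eigenvalues \<Gamma>' {t. (-1) * t > 0} + 1 \<le> count_eigenvalues \<Gamma> {t. (-1) * t > 0}"
      using \<open>\<epsilon> = -1\<close> e by (intro mono(2)[of _ e]) auto
    moreover have "count_eigenvalues \<Gamma>' {t. 1 * t > 0} \<le> count_eigenvalues \<Gamma> {t. 1 * t > 0}"
      by (intro mono(1)) auto
    ultimately show ?thesis using \<open>\<epsilon> = -1\<close> sums card unfolding num_positive_alt signature_alt by auto
  qed
  then show "num_positive \<Gamma> = num_positive \<Gamma>' + (if \<epsilon> = 1 then 1 else 0)"
    and "signature \<Gamma> = signature \<Gamma>' + \<epsilon>" by blast+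
qed

text \<open>The vectors \<open>e 1\<close> and \<open>e (-1)\<close> make both indices grow by at
  least one, while the number of vertices grows by two.\<close>

lemma inertia_hyperbolic:
  fixes \<Gamma> \<Gamma>' :: "'v::finite wgraph" and h :: "real ^ 'v \<Rightarrow> real ^ 'v"
  assumes inv: "weakly_negative_definite \<Gamma>" "weakly_negative_definite \<Gamma>'"
    and h: "linear h" "\<And>x. x \<in> families (vertices \<Gamma>') UNIV \<Longrightarrow> h x \<in> families (vertices \<Gamma>) UNIV"
      "\<And>x. x \<in> families (vertices \<Gamma>') UNIV \<Longrightarrow>
         h x \<bullet> mat_act (linking_matrix \<Gamma>) (h x) = x \<bullet> mat_act (linking_matrix \<Gamma>') x"
    and e: "\<And>c. e c \<in> families (vertices \<Gamma>) UNIV" "\<And>c. e c \<bullet> mat_act (linking_matrix \<Gamma>) (e c) = c"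
      "\<And>c x. x \<in> families (vertices \<Gamma>') UNIV \<Longrightarrow> e c \<bullet> mat_act (linking_matrix \<Gamma>) (h x) = 0"
    and card: "card (vertices \<Gamma>) = card (vertices \<Gamma>') + 2"
  shows "num_positive \<Gamma> = num_positive \<Gamma>' + 1" and "signature \<Gamma> = signature \<Gamma>'"
proof -
  have inv: "\<exists>C. is_linking_inverse \<Gamma> C" "\<exists>C. is_linking_inverse \<Gamma>' C"
    using inv by (auto simp: weakly_negative_definite_def)
  have mono: "count_eigenvalues \<Gamma>' {t. c * t > 0} + 1 \<le> count_eigenvalues \<Gamma> {t. c * t > 0}"
    if "c \<in> {1, -1}" for c
    using that e by (intro count_eigenvalues_mono(2)[OF inv(1) _ h, of _ "e c"]) auto
  have "num_positive \<Gamma> = num_positive \<Gamma>' + 1 \<and> signature \<Gamma> = signature \<Gamma>'"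
    using mono[of 1] mono[of "-1"] count_eigenvalues_sum[OF inv(1)] count_eigenvalues_sum[OF inv(2)] card
    unfolding num_positive_alt signature_alt by auto
  then show "num_positive \<Gamma> = num_positive \<Gamma>' + 1" "signature \<Gamma> = signature \<Gamma>'" by blast+
qed

text \<open>The parametrization \<open>g\<close> must reach every contributing family of the fibre
  but may also hit families with coefficient 0, which leaves freedom in the choice of
  \<open>K\<close>.\<close>

lemma sum_fibre:
  fixes c :: "'b \<Rightarrow> 'c::comm_monoid_add"
  assumes "finite K" "inj_on g K" "\<And>x. x \<in> K \<Longrightarrow> g x \<in> b \<and> T (g x) = l'"
    and "\<And>l. l \<in> b \<Longrightarrow> c l \<noteq> 0 \<Longrightarrow> T l = l' \<Longrightarrow> l \<in> g ` K"
  shows "(\<Sum>l\<in>{l \<in> b. c l \<noteq> 0 \<and> T l = l'}. c l) = (\<Sum>x\<in>K. c (g x))"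
proof -
  have "(\<Sum>l\<in>{l \<in> b. c l \<noteq> 0 \<and> T l = l'}. c l) = (\<Sum>l\<in>g ` K. c l)"
    using assms(1,3,4) by (intro sum.mono_neutral_left) auto
  also have "\<dots> = (\<Sum>x\<in>K. c (g x))" using assms(2) by (simp add: sum.reindex)
  finally show ?thesis .
qed

section \<open>Supports and convolutions of vertex coefficients\<close>

context based_root_system
begin

text \<open>The product side of the denominator formula gives the coset, the alternating sum gives
  the norm.\<close>

lemma rho_orbit_lattice:
  assumes "denom_coeff \<nu> \<noteq> 0"
  shows "\<nu> - \<rho> \<in> root_lattice \<Delta>" and "\<nu> \<bullet> \<nu> = \<rho> \<bullet> \<rho>"
proof -
  obtain S where S: "S \<subseteq> P" "\<nu> = \<rho> - \<Sum>S" using assms by (rule denom_coeff_support)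
  have "\<Sum>S \<in> root_lattice \<Delta>"
    using S(1) pos_subset finite_roots by (intro root_lattice_sum root_lattice_root) auto
  then show "\<nu> - \<rho> \<in> root_lattice \<Delta>" using root_lattice_uminus S(2) by simp
  obtain w where "w \<in> W" "w \<nu> = \<rho>" using assms by (rule denom_coeff_support_orbit)
  then show "\<nu> \<bullet> \<nu> = \<rho> \<bullet> \<rho>" using weyl_inner by metis
qed

text \<open>Ensures that a label with nonzero coefficient at a vertex of degree 1 or 2 lies in the
  coset prescribed by the shift of the labels.\<close>

lemma vertex_coeff_lattice:
  assumes "d \<in> {1, 2}" "vertex_coeff \<Delta> \<Phi> d x \<noteq> 0"
  shows "x - (2 - real d) *\<^sub>R \<rho> \<in> root_lattice \<Delta>"
proof (cases "d = 1")
  case True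
  then show ?thesis using assms rho_orbit_lattice(1)[of x]
    by (simp add: vertex_coeff_1[unfolded One_nat_def])
next
  case False
  then have "d = 2" using assms by auto
  then show ?thesis using assms root_lattice_0 by (simp add: vertex_coeff_2 split: if_splits)
qed

lemma label_reps_lattice:
  assumes "l \<in> label_reps \<Delta> \<Phi> \<Gamma>" "v \<in> vertices \<Gamma>"
  shows "l $ v - (2 - real (degree \<Gamma> v)) *\<^sub>R \<rho> \<in> root_lattice \<Delta>"
  using assms by (auto simp: label_reps_def label_shift_def families_iff)

lemma vertex_coeff_convolution_1:
  assumes "finite K" "\<And>\<nu>. denom_coeff \<nu> \<noteq> 0 \<Longrightarrow> vertex_coeff \<Delta> \<Phi> (Suc d) (\<mu> - \<nu>) \<noteq> 0 \<Longrightarrow> \<nu> \<in> K"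
  shows "(\<Sum>\<nu>\<in>K. denom_coeff \<nu> * vertex_coeff \<Delta> \<Phi> (Suc d) (\<mu> - \<nu>)) = vertex_coeff \<Delta> \<Phi> d \<mu>"
proof -
  have "vertex_coeff \<Delta> \<Phi> d \<mu> = denom_mult (vertex_coeff \<Delta> \<Phi> (Suc d)) \<mu>"
    by (simp add: denom_mult_vertex_coeff)
  also have "\<dots> = (\<Sum>\<nu>\<in>K. denom_coeff \<nu> * vertex_coeff \<Delta> \<Phi> (Suc d) (\<mu> - \<nu>))"
    unfolding denom_mult_def using assms
    by (intro sum.mono_neutral_cong) (auto simp: in_keys_iff weyl_denominator_formula)
  finally show ?thesis ..
qed

lemma vertex_coeff_convolution_le2:
  assumes "d \<in> {1, 2}" "d' \<ge> 1" "finite K"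
    and K: "\<And>x. vertex_coeff \<Delta> \<Phi> d x \<noteq> 0 \<Longrightarrow> vertex_coeff \<Delta> \<Phi> d' (\<mu> - x) \<noteq> 0 \<Longrightarrow> x \<in> K"
  shows "(\<Sum>x\<in>K. vertex_coeff \<Delta> \<Phi> d x * vertex_coeff \<Delta> \<Phi> d' (\<mu> - x)) = vertex_coeff \<Delta> \<Phi> (d + d' - 2) \<mu>"
proof (cases "d = 1")
  case True
  obtain e where "d' = Suc e" using assms(2) by (cases d') auto
  then show ?thesis
    using True vertex_coeff_convolution_1[OF assms(3), of e \<mu>] K
    by (simp add: vertex_coeff_1[unfolded One_nat_def])
next
  case False
  then have d: "d = 2" using assms(1) by auto
  have "(\<Sum>x\<in>K. vertex_coeff \<Delta> \<Phi> d x * vertex_coeff \<Delta> \<Phi> d' (\<mu> - x))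
    = (\<Sum>x\<in>K. if x = 0 then vertex_coeff \<Delta> \<Phi> d' \<mu> else 0)"
    by (intro sum.cong) (auto simp: d vertex_coeff_2)
  also have "\<dots> = vertex_coeff \<Delta> \<Phi> d' \<mu>"
    using assms(3) K[of 0] by (auto simp: d vertex_coeff_2)
  finally show ?thesis by (simp add: d)
qed

text \<open>The argument \<open>x - \<mu>\<close> is the form in which the third move produces the
  label at \<open>v2\<close>; parity turns it into \<open>\<mu> - x\<close>. If only
  \<open>d2\<close> is small, the substitution of \<open>\<mu> - x\<close> for \<open>x\<close>
  exchanges the roles.\<close>

lemma vertex_coeff_convolution:
  assumes "d1 \<ge> 1" "d2 \<ge> 1" "d1 \<le> 2 \<or> d2 \<le> 2" "finite K"
    and K: "\<And>x. vertex_coeff \<Delta> \<Phi> d1 x \<noteq> 0 \<Longrightarrow> vertex_coeff \<Delta> \<Phi> d2 (x - \<mu>) \<noteq> 0 \<Longrightarrow> x \<in> K"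
  shows "(\<Sum>x\<in>K. vertex_coeff \<Delta> \<Phi> d1 x * vertex_coeff \<Delta> \<Phi> d2 (x - \<mu>))
    = (-1) ^ (d2 * card P) * vertex_coeff \<Delta> \<Phi> (d1 + d2 - 2) \<mu>"
proof -
  have neg: "vertex_coeff \<Delta> \<Phi> d2 (x - \<mu>) = (-1) ^ (d2 * card P) * vertex_coeff \<Delta> \<Phi> d2 (\<mu> - x)" for x
    using vertex_coeff_uminus[of d2 "\<mu> - x"] by simp
  have nz: "vertex_coeff \<Delta> \<Phi> d2 (x - \<mu>) \<noteq> 0 \<longleftrightarrow> vertex_coeff \<Delta> \<Phi> d2 (\<mu> - x) \<noteq> 0" for x
    by (simp add: neg)
  have "(\<Sum>x\<in>K. vertex_coeff \<Delta> \<Phi> d1 x * vertex_coeff \<Delta> \<Phi> d2 (x - \<mu>))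
    = (-1) ^ (d2 * card P) * (\<Sum>x\<in>K. vertex_coeff \<Delta> \<Phi> d1 x * vertex_coeff \<Delta> \<Phi> d2 (\<mu> - x))"
    by (simp add: neg sum_distrib_left mult_ac)
  also have "(\<Sum>x\<in>K. vertex_coeff \<Delta> \<Phi> d1 x * vertex_coeff \<Delta> \<Phi> d2 (\<mu> - x)) = vertex_coeff \<Delta> \<Phi> (d1 + d2 - 2) \<mu>"
  proof (cases "d1 \<le> 2")
    case True
    then have "d1 \<in> {1, 2}" using assms(1) by auto
    then show ?thesis using assms(2,4) K nz by (intro vertex_coeff_convolution_le2) auto
  next
    case False
    then have "d2 \<in> {1, 2}" using assms(2,3) by auto
    have "(\<Sum>x\<in>K. vertex_coeff \<Delta> \<Phi> d1 x * vertex_coeff \<Delta> \<Phi> d2 (\<mu> - x))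
      = (\<Sum>y\<in>(\<lambda>x. \<mu> - x) ` K. vertex_coeff \<Delta> \<Phi> d2 y * vertex_coeff \<Delta> \<Phi> d1 (\<mu> - y))"
      by (subst sum.reindex) (auto simp: inj_on_def mult.commute)
    also have "\<dots> = vertex_coeff \<Delta> \<Phi> (d2 + d1 - 2) \<mu>"
    proof (rule vertex_coeff_convolution_le2)
      fix y assume "vertex_coeff \<Delta> \<Phi> d2 y \<noteq> 0" "vertex_coeff \<Delta> \<Phi> d1 (\<mu> - y) \<noteq> 0"
      then have "\<mu> - y \<in> K" using K[of "\<mu> - y"] nz[of "\<mu> - y"] by simp
      then show "y \<in> (\<lambda>x. \<mu> - x) ` K" by (intro image_eqI[of _ _ "\<mu> - y"]) auto
    qed (use assms \<open>d2 \<in> {1, 2}\<close> in auto)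
    finally show ?thesis by (simp add: add.commute)
  qed
  finally show ?thesis .
qed

end

lemma prod_sign: "(\<Prod>v\<in>R. (-1 :: rat) ^ (f v * n)) = (-1) ^ ((\<Sum>v\<in>R. f v) * n)"
  by (simp only: sum_distrib_right power_sum)

lemma neg_one_power_cancel: "(-1 :: rat) ^ n * (-1) ^ (n * (m + 1)) = (-1) ^ (n * m)"
proof -
  have "(-1 :: rat) ^ n * (-1) ^ (n * (m + 1)) = ((-1) ^ n * (-1) ^ n) * (-1) ^ (n * m)"
    by (simp add: power_add)
  then show ?thesis by (simp flip: power_mult_distrib)
qed

lemma neg_one_odd_power: "odd m \<Longrightarrow> (-1 :: rat) ^ (m * n) = (-1) ^ n"
  by (simp add: power_mult)

locale based_move = based_root_system \<Delta> \<Phi> for \<Delta> \<Phi> :: "'a::euclidean_space set" +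
  fixes \<Gamma> \<Gamma>' :: "'v::finite wgraph"
  assumes tree: "weighted_tree \<Gamma>" "weighted_tree \<Gamma>'"
    and wnd: "weakly_negative_definite \<Gamma>" "weakly_negative_definite \<Gamma>'"
begin

abbreviation "V \<equiv> vertices \<Gamma>"
abbreviation "V' \<equiv> vertices \<Gamma>'"
abbreviation "B \<equiv> mat_act (linking_matrix \<Gamma>)"
abbreviation "B' \<equiv> mat_act (linking_matrix \<Gamma>')"

lemma inner_inverse_lift:
  assumes "l' \<in> families V' UNIV"
  obtains k' where "k' \<in> families V' UNIV" "B' k' = l'" "l' \<bullet> mat_act (linking_inverse \<Gamma>') l' = l' \<bullet> k'"
  using mat_act_linking_inverse[of \<Gamma>' l'] assms wnd(2) by (auto simp: weakly_negative_definite_def)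

end

subsection \<open>The first move\<close>

locale move1 = based_move \<Delta> \<Phi> \<Gamma> \<Gamma>' for \<Delta> \<Phi> :: "'a::euclidean_space set" and \<Gamma> \<Gamma>' :: "'v::finite wgraph" +
  fixes \<epsilon> :: int and v0 v1 v2 :: 'v
  assumes eps: "\<epsilon> \<in> {1, -1}" and move: "neumann1 \<epsilon> v0 v1 v2 \<Gamma> \<Gamma>'"
begin

abbreviation "F \<equiv> edges \<Gamma>' - {{v1, v2}}"
abbreviation "L \<equiv> reach F v1"
abbreviation "R \<equiv> reach F v2"

lemma move_simps:
  "v0 \<notin> V'" "{v1, v2} \<in> edges \<Gamma>'" "V = insert v0 V'"
  "edges \<Gamma> = F \<union> {{v1, v0}, {v0, v2}}"
  "weight \<Gamma> v0 = \<epsilon>" "weight \<Gamma> v1 = weight \<Gamma>' v1 + \<epsilon>" "weight \<Gamma> v2 = weight \<Gamma>' v2 + \<epsilon>"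
  "\<And>v. v \<in> V' \<Longrightarrow> v \<noteq> v1 \<Longrightarrow> v \<noteq> v2 \<Longrightarrow> weight \<Gamma> v = weight \<Gamma>' v"
  using move by (auto simp: neumann1_def)

lemma v12: "v1 \<in> V'" "v2 \<in> V'" "v1 \<noteq> v2" "v0 \<noteq> v1" "v0 \<noteq> v2"
proof -
  show "v1 \<in> V'" "v2 \<in> V'" using weighted_treeD(1)[OF tree(2) move_simps(2)] by auto
  then show "v0 \<noteq> v1" "v0 \<noteq> v2" using move_simps(1) by auto
  show "v1 \<noteq> v2" using weighted_treeD(2)[OF tree(2) move_simps(2)] by auto
qed

lemma v2_notin_L: "v2 \<notin> L"
  using bridge[of "edges \<Gamma>'" v1 v2] weighted_treeD(4)[OF tree(2)] move_simps(2) v12(3) by blast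

lemma LR_disjoint: "v \<in> L \<Longrightarrow> v \<notin> R"
  using v2_notin_L reach_trans reach_sym by metis

lemma LR_subset: "v \<in> L \<union> R \<Longrightarrow> v \<in> V'"
proof -
  have "v \<in> V'" if "v \<in> reach F w" "w \<in> V'" for v w
    using that
  proof (induction rule: reach_induct)
    case (step y z)
    then show ?case using weighted_treeD(1)[OF tree(2), of "{y, z}"] by auto
  qed
  then show "v \<in> L \<union> R \<Longrightarrow> v \<in> V'" using v12 by auto
qed

lemma LR_cover: "V' = L \<union> R"
  using LR_subset reach_remove_edge[of _ "edges \<Gamma>'" v1 v2] weighted_treeD(3)[OF tree(2) v12(1)] by blast

lemma v0_notin: "v0 \<notin> L" "v0 \<notin> R"
  using LR_subset move_simps(1) by auto

lemma nbrs_move: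
  "nbrs \<Gamma> v0 = {v1, v2}"
  "nbrs \<Gamma> v1 = insert v0 (nbrs \<Gamma>' v1 - {v2})"
  "nbrs \<Gamma> v2 = insert v0 (nbrs \<Gamma>' v2 - {v1})"
  "v \<in> V' \<Longrightarrow> v \<noteq> v1 \<Longrightarrow> v \<noteq> v2 \<Longrightarrow> nbrs \<Gamma> v = nbrs \<Gamma>' v"
  using move_simps(1) v12 nbrsD[OF tree(2), of _ v0] nbrsD[OF tree(2), of v0]
  by (auto simp: nbrs_def move_simps(4) doubleton_eq_iff insert_commute)

lemma nbrs_v: "v2 \<in> nbrs \<Gamma>' v1" "v1 \<in> nbrs \<Gamma>' v2"
  using move_simps(2) by (auto simp: nbrs_def insert_commute)

lemma nbrs_L: "v \<in> L \<Longrightarrow> u \<in> nbrs \<Gamma>' v \<Longrightarrow> u \<noteq> v2 \<or> v \<noteq> v1 \<Longrightarrow> u \<in> L"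
  and nbrs_R: "v \<in> R \<Longrightarrow> u \<in> nbrs \<Gamma>' v \<Longrightarrow> u \<noteq> v1 \<or> v \<noteq> v2 \<Longrightarrow> u \<in> R"
proof -
  have *: "{v, u} \<in> F" if "u \<in> nbrs \<Gamma>' v" "{u, v} \<noteq> {v1, v2}" for u v
    using that by (auto simp: nbrs_def insert_commute)
  show "u \<in> L" if "v \<in> L" "u \<in> nbrs \<Gamma>' v" "u \<noteq> v2 \<or> v \<noteq> v1"
  proof -
    have "v \<noteq> v2" using that(1) v2_notin_L by auto
    then have "{u, v} \<noteq> {v1, v2}" using that(3) by (auto simp: doubleton_eq_iff)
    then show ?thesis using *[OF that(2)] reach_step[OF that(1)] by blast
  qed
  show "u \<in> R" if "v \<in> R" "u \<in> nbrs \<Gamma>' v" "u \<noteq> v1 \<or> v \<noteq> v2"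
  proof -
    have "v \<noteq> v1" using that(1) LR_disjoint[OF reach_self] by auto
    then have "{u, v} \<noteq> {v1, v2}" using that(3) by (auto simp: doubleton_eq_iff)
    then show ?thesis using *[OF that(2)] reach_step[OF that(1)] by blast
  qed
qed

lemma degree_move: "degree \<Gamma> v0 = 2" "v \<in> V' \<Longrightarrow> degree \<Gamma> v = degree \<Gamma>' v"
proof -
  have v0n: "v0 \<notin> nbrs \<Gamma>' v" for v using nbrsD(1)[OF tree(2), of v0 v] move_simps(1) by auto
  have c: "card (insert v0 (nbrs \<Gamma>' v - {u})) = card (nbrs \<Gamma>' v)" if "u \<in> nbrs \<Gamma>' v" for u v
  proof -
    have "card (insert v0 (nbrs \<Gamma>' v - {u})) = Suc (card (nbrs \<Gamma>' v - {u}))" using v0n by simp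
    also have "\<dots> = card (nbrs \<Gamma>' v)" using that by (intro card_Suc_Diff1) auto
    finally show ?thesis .
  qed
  show "degree \<Gamma> v0 = 2" using v12(3) by (simp add: degree_nbrs nbrs_move)
  show "v \<in> V' \<Longrightarrow> degree \<Gamma> v = degree \<Gamma>' v"
    using c nbrs_v nbrs_move by (cases "v = v1"; cases "v = v2") (simp_all add: degree_nbrs)
qed

lemma odd_degree_R: "odd (\<Sum>v\<in>R. degree \<Gamma>' v)"
proof (rule odd_sum_degree[OF tree(2)])
  have "v1 \<notin> R" by (rule LR_disjoint[OF reach_self])
  moreover have "u = v1 \<and> v = v2" if "{u, v} \<in> edges \<Gamma>'" "v \<in> R" "u \<notin> R" for u v
    using that nbrs_R[of v u] by (auto simp: nbrs_def)
  ultimately show "{(u, v). {u, v} \<in> edges \<Gamma>' \<and> v \<in> R \<and> u \<notin> R} = {(v1, v2)}"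
    using move_simps(2) reach_self by auto
qed

text \<open>The label map of the move. It is an involution on families that vanish at
  \<open>v0\<close>, hence serves in both directions.\<close>

definition psi :: "'b::real_vector ^ 'v \<Rightarrow> 'b ^ 'v" where
  "psi l = (\<chi> v. if v \<in> L then l $ v else if v \<in> R then - (of_int \<epsilon> *\<^sub>R (l $ v)) else 0)"

text \<open>Transports solutions. The value at \<open>v0\<close> is dictated by the row of
  \<open>v1\<close>, where \<open>v0\<close> has to replace the neighbour \<open>v2\<close> and
  offset the increase of the weight by \<open>\<epsilon>\<close>.\<close>

definition lift :: "'b::real_vector ^ 'v \<Rightarrow> 'b ^ 'v" where
  "lift k = (\<chi> v. if v = v0 then k $ v2 - of_int \<epsilon> *\<^sub>R k $ v1 else psi k $ v)"

lemma psi_psi: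
  assumes "l \<in> families V UNIV" "l $ v0 = 0"
  shows "psi (psi l) = l"
proof -
  have "psi (psi l) $ v = l $ v" for v
    using assms eps LR_cover LR_disjoint[of v] move_simps(3)
    by (cases "v = v0") (auto simp: psi_def families_iff v0_notin)
  then show ?thesis by (simp add: vec_eq_iff)
qed

lemma psi_add: "psi (x + y) = psi x + psi y"
  using eps by (auto simp: psi_def vec_eq_iff)

lemma linear_lift: "linear lift"
  using eps by (intro linearI) (auto simp: lift_def psi_def vec_eq_iff algebra_simps)

text \<open>Away from the subdivided edge, a vertex and its neighbours lie on one side, so the whole
  row is scaled by 1 or by \<open>- \<epsilon>\<close>. The rows of \<open>v0\<close>,
  \<open>v1\<close> and \<open>v2\<close> are checked directly, with \<open>\<epsilon>\<close> of
  square 1.\<close>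

lemma linking_lift: "B (lift k) = psi (B' k)" for k :: "'b::euclidean_space ^ 'v"
proof -
  have "B (lift k) $ v = psi (B' k) $ v" for v
  proof (cases "v \<in> V")
    case False
    then have "v \<notin> L" "v \<notin> R" using LR_cover move_simps(3) by auto
    then show ?thesis using False by (simp add: mat_act_linking_outside psi_def)
  next
    case True
    have v1: "v1 \<in> L" "v1 \<notin> R" "v2 \<in> R" "v2 \<notin> L" by (rule reach_self, rule LR_disjoint[OF reach_self], rule reach_self, rule v2_notin_L)
    have sumL: "(\<Sum>u\<in>A. lift k $ u) = (\<Sum>u\<in>A. k $ u)" if "A \<subseteq> L" for A
      using that v0_notin by (intro sum.cong) (auto simp: lift_def psi_def)
    have sumR: "(\<Sum>u\<in>A. lift k $ u) = - (of_int \<epsilon> *\<^sub>R (\<Sum>u\<in>A. k $ u))" if "A \<subseteq> R" for A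
    proof -
      have "(\<Sum>u\<in>A. lift k $ u) = (\<Sum>u\<in>A. - (of_int \<epsilon> *\<^sub>R k $ u))"
        using that v0_notin LR_disjoint by (intro sum.cong) (auto simp: lift_def psi_def)
      then show ?thesis by (simp add: sum_negf scaleR_sum_right)
    qed
    have v0n: "v0 \<notin> nbrs \<Gamma>' v" for v using nbrsD(1)[OF tree(2), of v0 v] move_simps(1) by auto
    consider "v = v0" | "v = v1" | "v = v2" | "v \<in> L" "v \<noteq> v1" | "v \<in> R" "v \<noteq> v2"
      using True move_simps(3) LR_cover by auto
    then show ?thesis
    proof cases
      case 1
      then show ?thesis
        using eps True v12 v1 v0_notin
        by (auto simp: mat_act_linking[OF tree(1)] nbrs_move move_simps(5) psi_def lift_def algebra_simps)
    next
      case 2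
      have "nbrs \<Gamma>' v1 - {v2} \<subseteq> L" using nbrs_L v1 by auto
      then have "(\<Sum>u\<in>nbrs \<Gamma> v1. lift k $ u) = lift k $ v0 + (\<Sum>u\<in>nbrs \<Gamma>' v1 - {v2}. k $ u)"
        using v0n by (simp add: nbrs_move sumL)
      moreover have "(\<Sum>u\<in>nbrs \<Gamma>' v1. k $ u) = k $ v2 + (\<Sum>u\<in>nbrs \<Gamma>' v1 - {v2}. k $ u)"
        using nbrs_v by (intro sum.remove) auto
      moreover have "lift k $ v1 = k $ v1" using v1 v12 by (simp add: lift_def psi_def)
      ultimately have "B (lift k) $ v1 = B' k $ v1"
        using True v12 unfolding 2
        by (simp add: mat_act_linking[OF tree(1)] mat_act_linking[OF tree(2)] move_simps(6) lift_def
            scaleR_add_left)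
      then show ?thesis using v1 by (simp add: 2 psi_def)
    next
      case 3
      have "nbrs \<Gamma>' v2 - {v1} \<subseteq> R" using nbrs_R v1 by auto
      then have "(\<Sum>u\<in>nbrs \<Gamma> v2. lift k $ u) = lift k $ v0 - of_int \<epsilon> *\<^sub>R (\<Sum>u\<in>nbrs \<Gamma>' v2 - {v1}. k $ u)"
        using v0n by (simp add: nbrs_move sumR)
      moreover have "(\<Sum>u\<in>nbrs \<Gamma>' v2. k $ u) = k $ v1 + (\<Sum>u\<in>nbrs \<Gamma>' v2 - {v1}. k $ u)"
        using nbrs_v by (intro sum.remove) auto
      moreover have "lift k $ v2 = - (of_int \<epsilon> *\<^sub>R k $ v2)" using v1 v12 by (simp add: lift_def psi_def)
      ultimately have "B (lift k) $ v2 = - (of_int \<epsilon> *\<^sub>R B' k $ v2)"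
        using True v12 eps unfolding 3
        by (auto simp: mat_act_linking[OF tree(1)] mat_act_linking[OF tree(2)] move_simps(7) lift_def
            algebra_simps)
      then show ?thesis using v1 by (simp add: 3 psi_def)
    next
      case 4
      then have "v \<in> V'" "v \<noteq> v2" "v \<noteq> v0" using LR_cover v1 v0_notin by auto
      moreover from this have "nbrs \<Gamma> v \<subseteq> L" using 4 nbrs_L nbrs_move(4) by auto
      ultimately show ?thesis using 4 True
        by (simp add: mat_act_linking[OF tree(1)] mat_act_linking[OF tree(2)] sumL nbrs_move(4)
            move_simps(8)) (simp add: lift_def psi_def mat_act_linking[OF tree(2)])
    next
      case 5
      then have v: "v \<in> V'" "v \<noteq> v1" "v \<noteq> v0" "v \<notin> L" using LR_cover v1 v0_notin LR_disjoint by auto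
      then have "nbrs \<Gamma> v \<subseteq> R" using 5 nbrs_R nbrs_move(4) by auto
      then have "B (lift k) $ v = of_int (weight \<Gamma>' v) *\<^sub>R lift k $ v - of_int \<epsilon> *\<^sub>R (\<Sum>u\<in>nbrs \<Gamma>' v. k $ u)"
        using 5 True v by (simp add: mat_act_linking[OF tree(1)] sumR nbrs_move(4) move_simps(8))
      moreover have "lift k $ v = - (of_int \<epsilon> *\<^sub>R k $ v)" using v 5 by (simp add: lift_def psi_def)
      moreover have "psi (B' k) $ v = - (of_int \<epsilon> *\<^sub>R B' k $ v)" using v 5 by (simp add: psi_def)
      ultimately show ?thesis using v eps by (auto simp: mat_act_linking[OF tree(2)])
    qed
  qed
  then show ?thesis by (simp add: vec_eq_iff)
qed

lemma inner_lift:
  assumes "l \<in> families V' UNIV"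
  shows "psi l \<bullet> lift k = l \<bullet> k"
proof -
  have "psi l $ v \<bullet> lift k $ v = l $ v \<bullet> k $ v" for v
    using assms eps LR_cover LR_disjoint[of v] v0_notin
    by (auto simp: psi_def lift_def families_iff)
  then show ?thesis by (simp add: inner_vec_def)
qed

lemma lift_families: "lift k \<in> families V UNIV"
  using LR_cover by (auto simp: lift_def psi_def families_iff move_simps(3))

text \<open>The unit vector at \<open>v0\<close> is split off: \<open>B (lift x)\<close> vanishes at
  \<open>v0\<close>, and the weight there is \<open>\<epsilon>\<close>.\<close>

lemma inertia: "num_positive \<Gamma> = num_positive \<Gamma>' + (if \<epsilon> = 1 then 1 else 0)"
    "signature \<Gamma> = signature \<Gamma>' + \<epsilon>"
proof -
  define e :: "real ^ 'v" where "e = axis v0 1"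
  have e: "e \<bullet> x = x $ v0" for x by (simp add: e_def inner_axis')
  note inertia_blow_up[OF wnd eps, of "lift :: real ^ 'v \<Rightarrow> _" e]
  moreover have "lift x \<bullet> B (lift x) = x \<bullet> B' x" for x :: "real ^ 'v"
    using inner_lift[OF mat_act_linking_families] by (metis linking_lift inner_commute)
  moreover have "e \<in> families V UNIV" by (auto simp: e_def families_iff axis_def move_simps(3))
  moreover have "e \<bullet> B e = of_int \<epsilon>"
    using v12 by (simp add: e mat_act_linking[OF tree(1)] move_simps(3,5) nbrs_move) (simp add: e_def axis_def)
  moreover have "e \<bullet> B (lift x) = 0" for x
    using v0_notin by (simp add: e linking_lift psi_def)
  moreover have "card V = Suc (card V')" using move_simps(1,3) by simp
  ultimately show "num_positive \<Gamma> = num_positive \<Gamma>' + (if \<epsilon> = 1 then 1 else 0)"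
    "signature \<Gamma> = signature \<Gamma>' + \<epsilon>" using linear_lift lift_families by blast+
qed

text \<open>The form keeps its value. The trace grows by \<open>3 * \<epsilon>\<close>, once for
  each of \<open>v0\<close>, \<open>v1\<close> and \<open>v2\<close>, and three times the signature
  grows by as much.\<close>

lemma exponent:
  assumes "l \<in> families V' UNIV"
  shows "summand_exponent \<Delta> \<Phi> \<Gamma> (psi l) = summand_exponent \<Delta> \<Phi> \<Gamma>' l"
proof -
  obtain k where k: "k \<in> families V' UNIV" "B' k = l" "l \<bullet> mat_act (linking_inverse \<Gamma>') l = l \<bullet> k"
    using inner_inverse_lift[OF assms] .
  have "psi l \<bullet> mat_act (linking_inverse \<Gamma>) (psi l) = psi l \<bullet> lift k"
    by (rule inner_linking_inverse[OF wnd(1) lift_families]) (simp add: linking_lift k)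
  then have q: "psi l \<bullet> mat_act (linking_inverse \<Gamma>) (psi l) = l \<bullet> mat_act (linking_inverse \<Gamma>') l"
    by (simp add: inner_lift[OF assms] k)
  have w: "weight \<Gamma> v = weight \<Gamma>' v + (if v = v1 then \<epsilon> else 0) + (if v = v2 then \<epsilon> else 0)" if "v \<in> V'" for v
    using that move_simps(6-8) v12 by auto
  have "(\<Sum>v\<in>V'. weight \<Gamma> v) = (\<Sum>v\<in>V'. weight \<Gamma>' v) + \<epsilon> + \<epsilon>"
    using v12 by (simp add: w sum.distrib)
  then have "(\<Sum>v\<in>V. weight \<Gamma> v) = (\<Sum>v\<in>V'. weight \<Gamma>' v) + 3 * \<epsilon>"
    using move_simps(1,3,5) by simp
  then have "trace (linking_matrix \<Gamma>) = trace (linking_matrix \<Gamma>') + 3 * of_int \<epsilon>"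
    by (simp add: trace_linking flip: of_int_sum)
  then show ?thesis by (simp add: summand_exponent_def q inertia)
qed

text \<open>Labels over \<open>R\<close> change sign only for \<open>\<epsilon> = 1\<close>, which
  is also the case in which the number of positive eigenvalues grows.\<close>

lemma coeff:
  "summand_coeff \<Delta> \<Phi> \<Gamma> (psi l) = (if \<epsilon> = 1 then (-1) ^ card P else 1) * summand_coeff \<Delta> \<Phi> \<Gamma>' l"
proof -
  let ?n = "vertex_coeff \<Delta> \<Phi>"
  have split: "(\<Prod>v\<in>V'. f v) = (\<Prod>v\<in>L. f v) * (\<Prod>v\<in>R. f v)" for f :: "'v \<Rightarrow> rat"
    unfolding LR_cover using LR_disjoint by (intro prod.union_disjoint) auto
  have "summand_coeff \<Delta> \<Phi> \<Gamma> (psi l) = ?n 2 (psi l $ v0) * (\<Prod>v\<in>V'. ?n (degree \<Gamma>' v) (psi l $ v))"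
    using move_simps(1) by (simp add: summand_coeff_def move_simps(3) degree_move)
  also have "psi l $ v0 = 0" using v0_notin by (simp add: psi_def)
  also have "(\<Prod>v\<in>V'. ?n (degree \<Gamma>' v) (psi l $ v))
    = (\<Prod>v\<in>L. ?n (degree \<Gamma>' v) (l $ v)) * (\<Prod>v\<in>R. ?n (degree \<Gamma>' v) (- (of_int \<epsilon> *\<^sub>R (l $ v))))"
    unfolding split using LR_disjoint by (intro arg_cong2[of _ _ _ _ "(*)"] prod.cong) (auto simp: psi_def)
  also have "(\<Prod>v\<in>R. ?n (degree \<Gamma>' v) (- (of_int \<epsilon> *\<^sub>R (l $ v))))
    = (if \<epsilon> = 1 then (-1) ^ card P else 1) * (\<Prod>v\<in>R. ?n (degree \<Gamma>' v) (l $ v))"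
    using eps odd_degree_R
    by (auto simp: vertex_coeff_uminus prod.distrib prod_sign neg_one_odd_power)
  finally show ?thesis
    by (simp add: summand_coeff_def split vertex_coeff_2)
qed

lemma Zhat_move:
  assumes "label_corr1 \<Delta> \<Phi> \<epsilon> v0 v1 v2 \<Gamma> \<Gamma>' b b'"
  shows "Zhat \<Delta> \<Phi> \<Gamma> b = Zhat \<Delta> \<Phi> \<Gamma>' b'"
proof -
  obtain l0 where l0: "l0 \<in> label_reps \<Delta> \<Phi> \<Gamma>'" and b': "b' = label_class \<Delta> \<Gamma>' l0"
    and b: "b = label_class \<Delta> \<Gamma> (psi l0)"
    using assms by (auto simp: label_corr1_def Let_def psi_def)
  let ?Q = "root_lattice \<Delta>"
  have Q\<epsilon>: "of_int \<epsilon> *\<^sub>R x \<in> ?Q" if "x \<in> ?Q" for x using that by (rule root_lattice_scale)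
  have l0F: "l0 \<in> families V' UNIV" using l0 by (rule label_reps_families)
  have psiF: "psi l \<in> families V' UNIV" for l :: "'a ^ 'v" using LR_cover by (auto simp: psi_def families_iff)
  have sub: "families V' UNIV \<subseteq> (families V UNIV :: ('a ^ 'v) set)" by (auto simp: families_iff move_simps(3))
  have v0_0: "l $ v0 = 0" if "l \<in> families V' UNIV" for l :: "'a ^ 'v"
    using that move_simps(1) by (auto simp: families_iff)
  have psipsi: "psi (psi l) = l" if "l \<in> families V' UNIV" for l :: "'a ^ 'v"
    using that sub v0_0 psi_psi by blast
  have bF: "l \<in> families V UNIV" if "l \<in> b" for l
    using label_class_families that psiF sub unfolding b by blast
  have b'F: "l \<in> families V' UNIV" if "l \<in> b'" for l
    using label_class_families that l0F unfolding b' by blast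
  \<comment> \<open>At a vertex of degree 2 the coefficient is supported at 0.\<close>
  have v0: "l $ v0 = 0" if "summand_coeff \<Delta> \<Phi> \<Gamma> l \<noteq> 0" for l
    using that by (auto simp: summand_coeff_def degree_move vertex_coeff_2 move_simps(3) split: if_splits)
  have to: "psi l \<in> b'" if l: "l \<in> b" "l $ v0 = 0" for l
  proof -
    obtain k where k: "k \<in> families V ?Q" "l = B k + psi l0"
      using l(1) unfolding b label_class_def by blast
    have "B k $ v0 = 0" using l(2) k(2) v0_notin by (simp add: psi_def)
    then have "of_int \<epsilon> *\<^sub>R k $ v0 + (k $ v1 + k $ v2) = 0"
      using v12 by (simp add: mat_act_linking[OF tree(1)] move_simps(3,5) nbrs_move)
    then have k0: "k $ v0 = - (of_int \<epsilon> *\<^sub>R (k $ v1 + k $ v2))"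
      using eps by (auto simp: add_eq_0_iff algebra_simps)
    \<comment> \<open>The row of \<open>v0\<close> determines \<open>k\<close> there, so the
      transport of solutions can be inverted.\<close>
    have "lift (psi k) = k"
    proof -
      have v1: "v1 \<in> L" "v1 \<notin> R" "v2 \<in> R" "v2 \<notin> L" by (rule reach_self, rule LR_disjoint[OF reach_self], rule reach_self, rule v2_notin_L)
      have "lift (psi k) $ v = k $ v" for v
      proof (cases "v = v0")
        case True
        then show ?thesis using v1 by (simp add: lift_def psi_def k0 algebra_simps)
      next
        case False
        then show ?thesis using k(1) eps LR_disjoint[of v] LR_cover
          by (auto simp: lift_def psi_def families_iff move_simps(3))
      qed
      then show ?thesis by (simp add: vec_eq_iff)
    qed
    then have "B k = psi (B' (psi k))" using linking_lift[of "psi k"] by simp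
    then have "psi l = B' (psi k) + l0"
      using k(2) psipsi[OF mat_act_linking_families] psipsi[OF l0F] by (simp add: psi_add)
    moreover have "psi k \<in> families V' ?Q"
      using families_root_lattice_nth[OF k(1)] LR_cover
      by (auto simp: psi_def families_iff intro!: root_lattice_uminus Q\<epsilon>)
    ultimately show ?thesis by (auto simp: b' label_class_def)
  qed
  have from_b': "psi l \<in> b" if l: "l \<in> b'" for l
  proof -
    obtain k where k: "k \<in> families V' ?Q" "l = B' k + l0"
      using l unfolding b' label_class_def by blast
    have "psi l = B (lift k) + psi l0" by (simp add: k(2) psi_add linking_lift)
    moreover have "lift k $ v \<in> ?Q" for v
      using families_root_lattice_nth[OF k(1)]
      by (auto simp: lift_def psi_def intro!: root_lattice_0 root_lattice_diff root_lattice_uminus Q\<epsilon>)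
    then have "lift k \<in> families V ?Q" using lift_families[of k] by (auto simp: families_iff)
    ultimately show ?thesis by (auto simp: b label_class_def)
  qed
  show ?thesis
  proof (rule Zhat_transfer[where T = psi and s = "if \<epsilon> = 1 then (-1) ^ card P else 1"])
    show "finite {l \<in> b. summand_coeff \<Delta> \<Phi> \<Gamma> l \<noteq> 0 \<and> summand_exponent \<Delta> \<Phi> \<Gamma> l = r}" for r
      unfolding b using wnd(1) psiF sub by (intro finite_summation_set) auto
    show "psi l \<in> b' \<and> summand_exponent \<Delta> \<Phi> \<Gamma>' (psi l) = summand_exponent \<Delta> \<Phi> \<Gamma> l"
      if "l \<in> b" "summand_coeff \<Delta> \<Phi> \<Gamma> l \<noteq> 0" for l
      using to[OF that(1) v0[OF that(2)]] exponent[OF psiF, of l] psi_psi[OF bF[OF that(1)] v0[OF that(2)]]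
      by simp
    show "(\<Sum>l\<in>{l \<in> b. summand_coeff \<Delta> \<Phi> \<Gamma> l \<noteq> 0 \<and> psi l = l'}. summand_coeff \<Delta> \<Phi> \<Gamma> l)
        = (if \<epsilon> = 1 then (-1) ^ card P else 1) * summand_coeff \<Delta> \<Phi> \<Gamma>' l'" if l': "l' \<in> b'" for l'
    proof -
      \<comment> \<open>Since \<open>psi\<close> is its own inverse on contributing families,
        \<open>psi l'\<close> is the only candidate in the fibre.\<close>
      have "(\<Sum>l\<in>{l \<in> b. summand_coeff \<Delta> \<Phi> \<Gamma> l \<noteq> 0 \<and> psi l = l'}. summand_coeff \<Delta> \<Phi> \<Gamma> l)
        = (\<Sum>l\<in>{l'}. summand_coeff \<Delta> \<Phi> \<Gamma> (psi l))"
      proof (rule sum_fibre)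
        fix l assume "l \<in> b" "summand_coeff \<Delta> \<Phi> \<Gamma> l \<noteq> 0" "psi l = l'"
        then have "l = psi l'" using psi_psi[OF bF v0] by metis
        then show "l \<in> psi ` {l'}" by simp
      qed (use from_b'[OF l'] psipsi[OF b'F[OF l']] in auto)
      then show ?thesis by (simp add: coeff)
    qed
    show "(if \<epsilon> = 1 then (-1) ^ card P else 1) * (-1) ^ (card P * num_positive \<Gamma>)
      = (-1 :: rat) ^ (card P * num_positive \<Gamma>')"
      using neg_one_power_cancel[of "card P" "num_positive \<Gamma>'"] by (simp only: inertia split: if_split) simp
  qed
qed

end

subsection \<open>The second move\<close>

locale move2 = based_move \<Delta> \<Phi> \<Gamma> \<Gamma>' for \<Delta> \<Phi> :: "'a::euclidean_space set" and \<Gamma> \<Gamma>' :: "'v::finite wgraph" +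
  fixes \<epsilon> :: int and v0 v1 :: 'v
  assumes eps: "\<epsilon> \<in> {1, -1}" and move: "neumann2 \<epsilon> v0 v1 \<Gamma> \<Gamma>'"
begin

lemma move_simps:
  "v0 \<in> V'" "v1 \<notin> V'" "V = insert v1 V'" "edges \<Gamma> = insert {v0, v1} (edges \<Gamma>')"
  "weight \<Gamma> v1 = \<epsilon>" "weight \<Gamma> v0 = weight \<Gamma>' v0 + \<epsilon>"
  "\<And>v. v \<in> V' \<Longrightarrow> v \<noteq> v0 \<Longrightarrow> weight \<Gamma> v = weight \<Gamma>' v"
  using move by (auto simp: neumann2_def)

lemma v01: "v0 \<noteq> v1" "v1 \<noteq> v0"
  using move_simps(1,2) by auto

lemma v1_not_nbr: "v1 \<notin> nbrs \<Gamma>' v"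
  using nbrsD(1)[OF tree(2), of v1 v] move_simps(2) by blast

lemma nbrs_move:
  "nbrs \<Gamma> v1 = {v0}" "nbrs \<Gamma> v0 = insert v1 (nbrs \<Gamma>' v0)"
  "v \<in> V' \<Longrightarrow> v \<noteq> v0 \<Longrightarrow> nbrs \<Gamma> v = nbrs \<Gamma>' v"
  using move_simps(2) v01 nbrsD(2)[OF tree(2), of _ v1]
  by (auto simp: nbrs_def move_simps(4) doubleton_eq_iff)

lemma degree_move: "degree \<Gamma> v1 = 1" "degree \<Gamma> v0 = Suc (degree \<Gamma>' v0)"
  "v \<in> V' \<Longrightarrow> v \<noteq> v0 \<Longrightarrow> degree \<Gamma> v = degree \<Gamma>' v"
  using v1_not_nbr by (simp_all add: degree_nbrs nbrs_move)

definition collapse :: "'b::real_vector ^ 'v \<Rightarrow> 'b ^ 'v" where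
  "collapse l = (\<chi> v. if v = v0 then l $ v0 - of_int \<epsilon> *\<^sub>R (l $ v1) else if v \<in> V' then l $ v else 0)"

text \<open>\<open>lift x k\<close> is the solution of \<open>B k = l\<close> for the family \<open>l\<close> that has the value \<open>x\<close> at the new leaf and
  collapses to \<open>B' k\<close>.\<close>

definition lift :: "'b::real_vector \<Rightarrow> 'b ^ 'v \<Rightarrow> 'b ^ 'v" where
  "lift x k = (\<chi> v. if v = v1 then of_int \<epsilon> *\<^sub>R (x - k $ v0) else k $ v)"

lemma collapse_families: "collapse l \<in> families V' UNIV"
  using move_simps(1) by (auto simp: collapse_def families_iff)

lemma collapse_add: "collapse (x + y) = collapse x + collapse y"
  by (auto simp: collapse_def vec_eq_iff algebra_simps)

lemma collapse_inject:
  assumes "l \<in> families V UNIV" "m \<in> families V UNIV" "collapse l = collapse m" "l $ v1 = m $ v1"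
  shows "l = m"
proof -
  have "l $ v = m $ v" for v
  proof -
    have "collapse l $ v = collapse m $ v" using assms(3) by simp
    then show ?thesis
      using assms(1,2,4)
      by (cases "v = v1") (auto simp: collapse_def families_iff move_simps(3) split: if_splits)
  qed
  then show ?thesis by (simp add: vec_eq_iff)
qed

lemma lift_families: "k \<in> families V' UNIV \<Longrightarrow> lift x k \<in> families V UNIV"
  by (auto simp: lift_def families_iff move_simps(3))

lemma linear_lift: "linear (lift 0)"
  by (intro linearI) (auto simp: lift_def vec_eq_iff algebra_simps)

lemma linking_v1: "B k $ v1 = of_int \<epsilon> *\<^sub>R k $ v1 + k $ v0"
  by (simp add: mat_act_linking[OF tree(1)] move_simps(3,5) nbrs_move)

text \<open>One step of elimination: subtracting \<open>\<epsilon>\<close> times the row of the leaf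
  from the row of \<open>v0\<close> removes the unknown at the leaf and the extra
  \<open>\<epsilon>\<close> in the weight.\<close>

lemma linking_collapse: "collapse (B k) = B' (\<chi> v. if v \<in> V' then k $ v else 0)"
proof -
  let ?k = "\<chi> v. if v \<in> V' then k $ v else 0"
  have "collapse (B k) $ v = B' ?k $ v" for v
  proof (cases "v \<in> V'")
    case False
    then show ?thesis using move_simps(1) by (auto simp: collapse_def mat_act_linking_outside)
  next
    case True
    have sum: "(\<Sum>u\<in>nbrs \<Gamma>' v. ?k $ u) = (\<Sum>u\<in>nbrs \<Gamma>' v. k $ u)" for v
      using nbrsD(1)[OF tree(2)] by (intro sum.cong) auto
    show ?thesis
    proof (cases "v = v0")
      case True
      have "B k $ v0 = of_int (weight \<Gamma>' v0) *\<^sub>R k $ v0 + of_int \<epsilon> *\<^sub>R k $ v0 + (k $ v1 + (\<Sum>u\<in>nbrs \<Gamma>' v0. k $ u))"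
        using move_simps(1) v1_not_nbr
        by (simp add: mat_act_linking[OF tree(1)] move_simps(3,6) nbrs_move scaleR_add_left)
      moreover have "B' ?k $ v0 = of_int (weight \<Gamma>' v0) *\<^sub>R k $ v0 + (\<Sum>u\<in>nbrs \<Gamma>' v0. k $ u)"
        using move_simps(1) sum by (simp add: mat_act_linking[OF tree(2)])
      ultimately show ?thesis using eps by (auto simp: True collapse_def linking_v1)
    next
      case False
      have "B k $ v = of_int (weight \<Gamma>' v) *\<^sub>R k $ v + (\<Sum>u\<in>nbrs \<Gamma>' v. k $ u)"
        using True False by (simp add: mat_act_linking[OF tree(1)] move_simps(3,7) nbrs_move(3))
      moreover have "B' ?k $ v = of_int (weight \<Gamma>' v) *\<^sub>R k $ v + (\<Sum>u\<in>nbrs \<Gamma>' v. k $ u)"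
        using True sum by (simp add: mat_act_linking[OF tree(2)])
      ultimately show ?thesis using True False by (simp add: collapse_def)
    qed
  qed
  then show ?thesis by (simp add: vec_eq_iff)
qed

lemma linking_lift:
  assumes "k \<in> families V' UNIV"
  shows "collapse (B (lift x k)) = B' k" "B (lift x k) $ v1 = x"
proof -
  have "(\<chi> v. if v \<in> V' then lift x k $ v else 0) = k"
    using assms move_simps(2) by (auto simp: lift_def vec_eq_iff families_iff)
  then show "collapse (B (lift x k)) = B' k" by (simp add: linking_collapse)
  show "B (lift x k) $ v1 = x" using eps v01 by (auto simp: linking_v1 lift_def)
qed

lemma linking_lift_eq:
  assumes "l \<in> families V UNIV" "k \<in> families V' UNIV" "collapse l = B' k"
  shows "B (lift (l $ v1) k) = l"
proof (rule collapse_inject[OF mat_act_linking_families assms(1)])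
  show "collapse (B (lift (l $ v1) k)) = collapse l" by (simp only: linking_lift(1)[OF assms(2)] assms(3))
qed (rule linking_lift(2)[OF assms(2)])

text \<open>The form on the top tree after completing the square in the leaf variable.\<close>

lemma inner_lift:
  fixes l k :: "'b::euclidean_space ^ 'v"
  assumes "l \<in> families V UNIV" "k \<in> families V' UNIV"
  shows "l \<bullet> lift (l $ v1) k = collapse l \<bullet> k + of_int \<epsilon> * (l $ v1 \<bullet> l $ v1)"
proof -
  have "l $ v \<bullet> lift (l $ v1) k $ v = collapse l $ v \<bullet> k $ v
      + (if v = v1 then of_int \<epsilon> * (l $ v1 \<bullet> l $ v1) - of_int \<epsilon> * (l $ v1 \<bullet> k $ v0) else 0)
      + (if v = v0 then of_int \<epsilon> * (l $ v1 \<bullet> k $ v0) else 0)" for v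
    using assms v01 move_simps(2)
    by (auto simp: lift_def collapse_def families_iff inner_diff_left inner_diff_right algebra_simps)
  then show ?thesis by (simp add: inner_vec_def sum.distrib)
qed

lemma inertia: "num_positive \<Gamma> = num_positive \<Gamma>' + (if \<epsilon> = 1 then 1 else 0)"
    "signature \<Gamma> = signature \<Gamma>' + \<epsilon>"
proof -
  define e :: "real ^ 'v" where "e = axis v1 1"
  have e: "e \<bullet> x = x $ v1" for x by (simp add: e_def inner_axis')
  note inertia_blow_up[OF wnd eps, of "lift 0 :: real ^ 'v \<Rightarrow> _" e]
  moreover have "lift 0 x \<bullet> B (lift 0 x) = x \<bullet> B' x" if "x \<in> families V' UNIV" for x :: "real ^ 'v"
    using inner_lift[OF mat_act_linking_families that, of "lift 0 x"] linking_lift[OF that, of 0]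
    by (simp add: inner_commute)
  moreover have "e \<in> families V UNIV" by (auto simp: e_def families_iff axis_def move_simps(3))
  moreover have "e \<bullet> B e = of_int \<epsilon>"
    using v01 by (simp add: e linking_v1) (simp add: e_def axis_def)
  moreover have "e \<bullet> B (lift 0 x) = 0" if "x \<in> families V' UNIV" for x
    using linking_lift(2)[OF that, of 0] by (simp add: e)
  moreover have "card V = Suc (card V')" using move_simps(2,3) by simp
  ultimately show "num_positive \<Gamma> = num_positive \<Gamma>' + (if \<epsilon> = 1 then 1 else 0)"
    "signature \<Gamma> = signature \<Gamma>' + \<epsilon>" using linear_lift lift_families by blast+
qed

text \<open>The trace grows by \<open>2 * \<epsilon>\<close> and three times the signature by
  \<open>3 * \<epsilon>\<close>. Half the difference times \<open>\<rho> \<bullet> \<rho>\<close> is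
  offset by the square of the leaf label, which is a Weyl conjugate of \<open>\<rho>\<close>
  whenever the family contributes.\<close>

lemma exponent:
  assumes "l \<in> families V UNIV" "l $ v1 \<bullet> l $ v1 = \<rho> \<bullet> \<rho>"
  shows "summand_exponent \<Delta> \<Phi> \<Gamma> l = summand_exponent \<Delta> \<Phi> \<Gamma>' (collapse l)"
proof -
  obtain k where k: "k \<in> families V' UNIV" "B' k = collapse l"
    "collapse l \<bullet> mat_act (linking_inverse \<Gamma>') (collapse l) = collapse l \<bullet> k"
    using inner_inverse_lift[OF collapse_families] .
  have "l \<bullet> mat_act (linking_inverse \<Gamma>) l = l \<bullet> lift (l $ v1) k"
    using assms(1) k(1,2) by (intro inner_linking_inverse[OF wnd(1)] lift_families linking_lift_eq) auto
  then have q: "l \<bullet> mat_act (linking_inverse \<Gamma>) l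
      = collapse l \<bullet> mat_act (linking_inverse \<Gamma>') (collapse l) + of_int \<epsilon> * (\<rho> \<bullet> \<rho>)"
    by (simp add: inner_lift[OF assms(1) k(1)] k(3) assms(2))
  have w: "weight \<Gamma> v = weight \<Gamma>' v + (if v = v0 then \<epsilon> else 0)" if "v \<in> V'" for v
    using that move_simps(6,7) by auto
  have "(\<Sum>v\<in>V. weight \<Gamma> v) = (\<Sum>v\<in>V'. weight \<Gamma>' v) + 2 * \<epsilon>"
    using move_simps(1,2) by (simp add: move_simps(3,5) w sum.distrib)
  then have "trace (linking_matrix \<Gamma>) = trace (linking_matrix \<Gamma>') + 2 * of_int \<epsilon>"
    by (simp add: trace_linking flip: of_int_sum)
  then show ?thesis by (simp add: summand_exponent_def q inertia field_simps)
qed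

text \<open>Parametrizes the fibre of \<open>collapse\<close> over \<open>l'\<close> by the leaf
  label.\<close>

definition extend :: "'b::real_vector \<Rightarrow> 'b ^ 'v \<Rightarrow> 'b ^ 'v" where
  "extend x l' = (\<chi> v. if v = v1 then x else if v = v0 then l' $ v0 + of_int \<epsilon> *\<^sub>R x else l' $ v)"

lemma extend:
  assumes "l' \<in> families V' UNIV"
  shows "extend x l' \<in> families V UNIV" "collapse (extend x l') = l'" "extend x l' $ v1 = x"
  using assms v01 by (auto simp: extend_def collapse_def families_iff move_simps(1-3) vec_eq_iff)

lemma coeff_extend:
  "summand_coeff \<Delta> \<Phi> \<Gamma> (extend x l') =
     denom_coeff x * vertex_coeff \<Delta> \<Phi> (Suc (degree \<Gamma>' v0)) (l' $ v0 + of_int \<epsilon> *\<^sub>R x)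
       * (\<Prod>v\<in>V' - {v0}. vertex_coeff \<Delta> \<Phi> (degree \<Gamma>' v) (l' $ v))"
proof -
  have "summand_coeff \<Delta> \<Phi> \<Gamma> (extend x l') =
      vertex_coeff \<Delta> \<Phi> (degree \<Gamma> v1) (extend x l' $ v1) *
      (vertex_coeff \<Delta> \<Phi> (degree \<Gamma> v0) (extend x l' $ v0) *
       (\<Prod>v\<in>V' - {v0}. vertex_coeff \<Delta> \<Phi> (degree \<Gamma> v) (extend x l' $ v)))"
    using move_simps(2) by (simp add: summand_coeff_def move_simps(3) prod.remove[OF finite move_simps(1)])
  also have "(\<Prod>v\<in>V' - {v0}. vertex_coeff \<Delta> \<Phi> (degree \<Gamma> v) (extend x l' $ v))
    = (\<Prod>v\<in>V' - {v0}. vertex_coeff \<Delta> \<Phi> (degree \<Gamma>' v) (l' $ v))"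
    using move_simps(2) by (intro prod.cong) (auto simp: degree_move extend_def)
  finally show ?thesis using v01
    by (simp add: degree_move(1)[unfolded One_nat_def] degree_move(2) extend_def
        vertex_coeff_1[unfolded One_nat_def])
qed

lemma Zhat_move:
  assumes "label_corr2 \<Delta> \<Phi> \<epsilon> v0 v1 \<Gamma> \<Gamma>' b b'"
  shows "Zhat \<Delta> \<Phi> \<Gamma> b = Zhat \<Delta> \<Phi> \<Gamma>' b'"
proof -
  obtain l0 where l0: "l0 \<in> label_reps \<Delta> \<Phi> \<Gamma>" and b: "b = label_class \<Delta> \<Gamma> l0"
    and b': "b' = label_class \<Delta> \<Gamma>' (collapse l0)"
    using assms by (auto simp: label_corr2_def collapse_def)
  let ?Q = "root_lattice \<Delta>"
  let ?c = "summand_coeff \<Delta> \<Phi> \<Gamma>"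
  let ?s = "if \<epsilon> = 1 then (-1) ^ card P else (1::rat)"
  have l0F: "l0 \<in> families V UNIV" using l0 by (rule label_reps_families)
  have bF: "l \<in> families V UNIV" if "l \<in> b" for l
    using label_class_families[OF l0F] that unfolding b .
  have b'F: "l \<in> families V' UNIV" if "l \<in> b'" for l
    using label_class_families[OF collapse_families] that unfolding b' .
  have nz: "denom_coeff (l $ v1) \<noteq> 0" if "?c l \<noteq> 0" for l
  proof -
    have "vertex_coeff \<Delta> \<Phi> (degree \<Gamma> v1) (l $ v1) \<noteq> 0"
      using that by (auto simp: summand_coeff_def move_simps(3))
    then show ?thesis unfolding degree_move(1) vertex_coeff_1 .
  qed
  have to_b': "collapse l \<in> b'" if l: "l \<in> b" for l
  proof -
    obtain k where k: "k \<in> families V ?Q" "l = B k + l0"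
      using l unfolding b label_class_def by blast
    have "collapse l = B' (\<chi> v. if v \<in> V' then k $ v else 0) + collapse l0"
      by (simp add: k(2) collapse_add linking_collapse)
    moreover have "(\<chi> v. if v \<in> V' then k $ v else 0) \<in> families V' ?Q"
      using families_root_lattice_nth[OF k(1)] by (auto simp: families_iff)
    ultimately show ?thesis unfolding b' label_class_def by blast
  qed
  have from_b': "extend x l' \<in> b" if l': "l' \<in> b'" and x: "denom_coeff x \<noteq> 0" for l' x
  proof -
    obtain k where k: "k \<in> families V' ?Q" "l' = B' k + collapse l0"
      using l' unfolding b' label_class_def by blast
    have kF: "k \<in> families V' UNIV" using k(1) by (auto simp: families_iff)
    \<comment> \<open>The image under \<open>B\<close> takes the first argument as its leaf value,
      so adding \<open>l0\<close> makes the leaf label \<open>x\<close>.\<close>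
    let ?m = "lift (x - l0 $ v1) k"
    have "B ?m + l0 = extend x l'"
    proof (rule collapse_inject)
      show "B ?m + l0 \<in> families V UNIV"
        using mat_act_linking_families l0F subspace_families subspace_add by blast
      show "extend x l' \<in> families V UNIV" using b'F[OF l'] by (rule extend)
      show "collapse (B ?m + l0) = collapse (extend x l')"
        using extend(2)[OF b'F[OF l']] linking_lift(1)[OF kF] k(2) by (simp add: collapse_add)
      show "(B ?m + l0) $ v1 = extend x l' $ v1"
        using extend(3)[OF b'F[OF l']] linking_lift(2)[OF kF] by simp
    qed
    moreover have "?m \<in> families V ?Q"
    proof -
      \<comment> \<open>The leaf has degree 1, so the shift there is \<open>\<rho>\<close>; this is
        also the coset of every exponent of D.\<close>
      have "l0 $ v1 - \<rho> \<in> ?Q"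
        using label_reps_lattice[OF l0, of v1] degree_move(1) move_simps(3) by simp
      then have "x - l0 $ v1 \<in> ?Q"
        using root_lattice_diff[OF rho_orbit_lattice(1)[OF x], of "l0 $ v1 - \<rho>"] by simp
      then have "?m $ v \<in> ?Q" for v
        using families_root_lattice_nth[OF k(1)]
        by (auto simp: lift_def intro!: root_lattice_scale root_lattice_diff)
      then show ?thesis using lift_families[OF kF] by (auto simp: families_iff)
    qed
    ultimately show ?thesis unfolding b label_class_def by force
  qed
  show ?thesis
  proof (rule Zhat_transfer[where T = collapse and s = ?s])
    show "finite {l \<in> b. ?c l \<noteq> 0 \<and> summand_exponent \<Delta> \<Phi> \<Gamma> l = r}" for r
      unfolding b using wnd(1) l0F by (rule finite_summation_set)
    show "collapse l \<in> b' \<and> summand_exponent \<Delta> \<Phi> \<Gamma>' (collapse l) = summand_exponent \<Delta> \<Phi> \<Gamma> l"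
      if "l \<in> b" "?c l \<noteq> 0" for l
      using to_b'[OF that(1)] exponent[OF bF[OF that(1)] rho_orbit_lattice(2)[OF nz[OF that(2)]]]
      by simp
    show "(\<Sum>l\<in>{l \<in> b. ?c l \<noteq> 0 \<and> collapse l = l'}. ?c l) = ?s * summand_coeff \<Delta> \<Phi> \<Gamma>' l'"
      if l': "l' \<in> b'" for l'
    proof -
      define K where "K = Poly_Mapping.keys (weyl_denom \<Delta> \<Phi>)"
      have K: "x \<in> K \<longleftrightarrow> denom_coeff x \<noteq> 0" for x
        by (simp add: K_def in_keys_iff weyl_denominator_formula)
      have finK: "finite K" by (simp add: K_def)
      note l'F = b'F[OF l']
      let ?d = "degree \<Gamma>' v0"
      let ?n = "vertex_coeff \<Delta> \<Phi> (Suc ?d)"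
      have "(\<Sum>l\<in>{l \<in> b. ?c l \<noteq> 0 \<and> collapse l = l'}. ?c l) = (\<Sum>x\<in>K. ?c (extend x l'))"
      proof (rule sum_fibre[OF finK])
        show "inj_on (\<lambda>x. extend x l') K" using extend(3)[OF l'F] by (metis inj_onI)
        show "extend x l' \<in> b \<and> collapse (extend x l') = l'" if "x \<in> K" for x
          using from_b'[OF l'] extend(2)[OF l'F] that by (simp add: K)
        show "l \<in> (\<lambda>x. extend x l') ` K" if "l \<in> b" "?c l \<noteq> 0" "collapse l = l'" for l
        proof (rule image_eqI)
          show "l = extend (l $ v1) l'"
            using that(3)
            by (intro collapse_inject[OF bF[OF that(1)] extend(1)[OF l'F]]) (simp_all only: extend[OF l'F])
          show "l $ v1 \<in> K" using nz[OF that(2)] by (simp add: K)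
        qed
      qed
      also have "\<dots> = (\<Sum>x\<in>K. denom_coeff x * ?n (l' $ v0 + of_int \<epsilon> *\<^sub>R x))
          * (\<Prod>v\<in>V' - {v0}. vertex_coeff \<Delta> \<Phi> (degree \<Gamma>' v) (l' $ v))"
        by (simp add: coeff_extend sum_distrib_right)
      also have "(\<Sum>x\<in>K. denom_coeff x * ?n (l' $ v0 + of_int \<epsilon> *\<^sub>R x)) = ?s * vertex_coeff \<Delta> \<Phi> ?d (l' $ v0)"
      proof (cases "\<epsilon> = 1")
        case True
        \<comment> \<open>A convolution needs the argument \<open>l' $ v0 - x\<close>; negating
          \<open>x\<close> costs the parity sign of D.\<close>
        have "(\<Sum>x\<in>K. denom_coeff x * ?n (l' $ v0 + of_int \<epsilon> *\<^sub>R x))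
          = (\<Sum>x\<in>K. (-1) ^ card P * (denom_coeff x * ?n (l' $ v0 - x)))"
        proof (rule sum.reindex_bij_witness[of _ uminus uminus])
          fix x
          show "(-1) ^ card P * (denom_coeff (- x) * ?n (l' $ v0 - - x)) =
              denom_coeff x * ?n (l' $ v0 + of_int \<epsilon> *\<^sub>R x)"
            using denom_coeff_uminus[of "- x"] True by simp
        qed (auto simp: K denom_coeff_uminus)
        also have "\<dots> = (-1) ^ card P * vertex_coeff \<Delta> \<Phi> ?d (l' $ v0)"
          using vertex_coeff_convolution_1[OF finK, of ?d "l' $ v0"] K
          by (simp flip: sum_distrib_left)
        finally show ?thesis using True by simp
      next
        case False
        then have "\<epsilon> = -1" using eps by auto
        then show ?thesis
          using vertex_coeff_convolution_1[OF finK, of ?d "l' $ v0"] K by simp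
      qed
      finally show ?thesis
        using move_simps(1) by (simp add: summand_coeff_def prod.remove[of V' v0])
    qed
    show "?s * (-1) ^ (card P * num_positive \<Gamma>) = (-1 :: rat) ^ (card P * num_positive \<Gamma>')"
      using neg_one_power_cancel[of "card P" "num_positive \<Gamma>'"] by (simp only: inertia split: if_split) simp
  qed
qed

end

subsection \<open>The third move\<close>

locale move3 = based_move \<Delta> \<Phi> \<Gamma> \<Gamma>' for \<Delta> \<Phi> :: "'a::euclidean_space set" and \<Gamma> \<Gamma>' :: "'v::finite wgraph" +
  fixes v0 v1 v2 v12 :: 'v
  assumes move: "neumann3 v0 v1 v2 v12 \<Gamma> \<Gamma>'"
begin

abbreviation "F \<equiv> {e \<in> edges \<Gamma>. v0 \<notin> e}"
abbreviation "L \<equiv> reach F v1"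
abbreviation "R \<equiv> reach F v2"

lemma move_simps:
  "v0 \<in> V" "weight \<Gamma> v0 = 0" "v1 \<noteq> v2" "nbrs \<Gamma> v0 = {v1, v2}"
  "v12 \<notin> V - {v0, v1, v2}" "V' = insert v12 (V - {v0, v1, v2})"
  "edges \<Gamma>' = {e \<in> edges \<Gamma>. e \<inter> {v0, v1, v2} = {}} \<union>
     {{v12, u} |u. u \<noteq> v0 \<and> (u \<in> nbrs \<Gamma> v1 \<or> u \<in> nbrs \<Gamma> v2)}"
  "weight \<Gamma>' v12 = weight \<Gamma> v1 + weight \<Gamma> v2"
  "\<And>v. v \<in> V - {v0, v1, v2} \<Longrightarrow> weight \<Gamma>' v = weight \<Gamma> v"
  using move by (auto simp: neumann3_def nbrs_def insert_commute)

lemma v012: "v1 \<in> V" "v2 \<in> V" "v0 \<noteq> v1" "v0 \<noteq> v2" "v1 \<noteq> v0" "v2 \<noteq> v0"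
  using nbrsD[OF tree(1), of v1 v0] nbrsD[OF tree(1), of v2 v0] move_simps(4) by auto

text \<open>A connection of \<open>v1\<close> and \<open>v2\<close> off \<open>v0\<close>, continued
  by the edge from \<open>v2\<close> to \<open>v0\<close>, would bypass the edge from
  \<open>v0\<close> to \<open>v1\<close>, which is a bridge.\<close>

lemma v2_notin_L: "v2 \<notin> L"
proof
  assume "v2 \<in> L"
  let ?G = "edges \<Gamma> - {{v0, v1}}"
  have "v1 \<in> reach F v2" using reach_sym[OF \<open>v2 \<in> L\<close>] .
  moreover have "F \<subseteq> ?G" by auto
  then have "reach F v2 \<subseteq> reach ?G v2" by (rule reach_mono)
  ultimately have v1: "v1 \<in> reach ?G v2" by (rule subsetD[rotated])
  have "{v0, v2} \<in> ?G"
    using move_simps(3,4) by (auto simp: nbrs_def doubleton_eq_iff insert_commute)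
  then have "v2 \<in> reach ?G v0" by (rule reach_step[OF reach_self])
  then have "v1 \<in> reach ?G v0" using v1 by (rule reach_trans)
  moreover have "{v0, v1} \<in> edges \<Gamma>" using move_simps(4) by (auto simp: nbrs_def insert_commute)
  moreover have "v1 \<notin> reach ?G v0"
    using weighted_treeD(4)[OF tree(1)] calculation(2) v012(3) by (intro bridge) auto
  ultimately show False by blast
qed

lemma LR_disjoint: "v \<in> L \<Longrightarrow> v \<notin> R"
proof
  assume "v \<in> L" "v \<in> R"
  from reach_trans[OF this(1) reach_sym[OF this(2)]] show False using v2_notin_L by contradiction
qed

lemma v12_LR: "v1 \<in> L" "v1 \<notin> R" "v2 \<in> R" "v2 \<notin> L"
  by (rule reach_self, rule LR_disjoint[OF reach_self], rule reach_self, rule v2_notin_L)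

lemma nbrs_F: "u \<in> nbrs \<Gamma> v \<Longrightarrow> u \<noteq> v0 \<Longrightarrow> v \<noteq> v0 \<Longrightarrow> {v, u} \<in> F"
  by (auto simp: nbrs_def insert_commute)

lemma nbrs_L: "v \<in> L \<Longrightarrow> u \<in> nbrs \<Gamma> v \<Longrightarrow> u \<noteq> v0 \<Longrightarrow> v \<noteq> v0 \<Longrightarrow> u \<in> L"
  and nbrs_R: "v \<in> R \<Longrightarrow> u \<in> nbrs \<Gamma> v \<Longrightarrow> u \<noteq> v0 \<Longrightarrow> v \<noteq> v0 \<Longrightarrow> u \<in> R"
  by (erule (1) reach_step[OF _ nbrs_F]; assumption)+

lemma reach_F: "v \<in> reach F w \<Longrightarrow> w \<in> V - {v0} \<Longrightarrow> v \<in> V - {v0}"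
proof (induction rule: reach_induct)
  case (step y z)
  then have "{y, z} \<in> edges \<Gamma>" "v0 \<notin> {y, z}" by auto
  then show ?case using weighted_treeD(1)[OF tree(1), of "{y, z}"] by auto
qed

lemma v0_notin: "v0 \<notin> L" "v0 \<notin> R"
  using reach_F[of v0 v1] reach_F[of v0 v2] v012 by auto

lemma LR_cover: "V - {v0} = L \<union> R"
proof
  show "L \<union> R \<subseteq> V - {v0}" using reach_F v012 by blast
  have "v = v0 \<or> v \<in> L \<or> v \<in> R" if "v \<in> reach (edges \<Gamma>) v0" for v
    using that
  proof (induction rule: reach_induct)
    case (step y z)
    then have z: "z \<in> nbrs \<Gamma> y" by (simp add: nbrs_def insert_commute)
    show ?case
    proof (cases "y = v0")
      case True
      then show ?thesis using z move_simps(4) v12_LR by auto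
    next
      case False
      then show ?thesis using step nbrs_L[OF _ z] nbrs_R[OF _ z] by blast
    qed
  qed simp
  then show "V - {v0} \<subseteq> L \<union> R" using weighted_treeD(3)[OF tree(1) move_simps(1)] by blast
qed

abbreviation "N \<equiv> V - {v0, v1, v2}"

lemma N_LR: "N = (L - {v1}) \<union> (R - {v2})"
  using LR_cover v12_LR by auto

lemma LR_N: "v \<in> L \<Longrightarrow> v \<noteq> v1 \<Longrightarrow> v \<in> N" "v \<in> R \<Longrightarrow> v \<noteq> v2 \<Longrightarrow> v \<in> N"
  using N_LR by auto

lemma v0_nbr: "v0 \<in> nbrs \<Gamma> v \<longleftrightarrow> v = v1 \<or> v = v2"
  using move_simps(4) nbrs_sym[of v0 \<Gamma> v] by auto

definition A1 where "A1 = nbrs \<Gamma> v1 - {v0}"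
definition A2 where "A2 = nbrs \<Gamma> v2 - {v0}"

lemma nbrs_v: "nbrs \<Gamma> v1 = insert v0 A1" "nbrs \<Gamma> v2 = insert v0 A2" "v0 \<notin> A1" "v0 \<notin> A2"
  using v0_nbr by (auto simp: A1_def A2_def)

lemma A_subset: "A1 \<subseteq> L - {v1}" "A2 \<subseteq> R - {v2}"
proof -
  show "A1 \<subseteq> L - {v1}"
    using nbrs_L[OF v12_LR(1)] v012 nbrsD(3)[OF tree(1), of _ v1] by (auto simp: A1_def)
  show "A2 \<subseteq> R - {v2}"
    using nbrs_R[OF v12_LR(3)] v012 nbrsD(3)[OF tree(1), of _ v2] by (auto simp: A2_def)
qed

lemma A_N: "u \<in> A1 \<Longrightarrow> u \<in> L" "u \<in> A1 \<Longrightarrow> u \<in> N" "u \<in> A2 \<Longrightarrow> u \<in> R" "u \<in> A2 \<Longrightarrow> u \<in> N"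
  using A_subset LR_N[of u] by blast+

lemma A_disjoint: "A1 \<inter> A2 = {}"
  using A_subset LR_disjoint by blast

lemma nbrs_v12: "nbrs \<Gamma>' v12 = A1 \<union> A2"
proof -
  define X where "X = {e \<in> edges \<Gamma>. e \<inter> {v0, v1, v2} = {}}"
  define Y where "Y = {{v12, u} |u. u \<noteq> v0 \<and> (u \<in> nbrs \<Gamma> v1 \<or> u \<in> nbrs \<Gamma> v2)}"
  have X: "{u, v12} \<notin> X" for u
  proof
    assume "{u, v12} \<in> X"
    then have e: "{u, v12} \<in> edges \<Gamma>" "v12 \<noteq> v0" "v12 \<noteq> v1" "v12 \<noteq> v2" by (auto simp: X_def)
    then have "v12 \<in> N" using weighted_treeD(1)[OF tree(1) e(1)] by auto
    then show False using move_simps(5) by contradiction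
  qed
  have Y: "{u, v12} \<in> Y \<longleftrightarrow> u \<in> A1 \<union> A2" for u
    by (auto simp: doubleton_eq_iff A1_def A2_def Y_def)
  have "edges \<Gamma>' = X \<union> Y" by (simp only: move_simps(7) X_def Y_def)
  then have "u \<in> nbrs \<Gamma>' v12 \<longleftrightarrow> u \<in> A1 \<union> A2" for u
    using X[of u] Y[of u] by (simp add: nbrs_def)
  then show ?thesis by (rule set_eqI)
qed

definition merge :: "'v \<Rightarrow> 'v" where
  "merge u = (if u = v1 \<or> u = v2 then v12 else u)"

lemma nbrs_N:
  assumes "v \<in> N"
  shows "nbrs \<Gamma>' v = merge ` nbrs \<Gamma> v"
proof -
  have v: "v \<noteq> v0" "v \<noteq> v1" "v \<noteq> v2" "v \<noteq> v12" using assms move_simps(5) by auto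
  have v0n: "v0 \<notin> nbrs \<Gamma> v" using v0_nbr v by blast
  have "u \<in> nbrs \<Gamma>' v \<longleftrightarrow> u \<in> merge ` nbrs \<Gamma> v" for u
  proof -
    have "u \<in> nbrs \<Gamma>' v \<longleftrightarrow>
        (u \<in> nbrs \<Gamma> v \<and> u \<notin> {v0, v1, v2}) \<or> (u = v12 \<and> (v \<in> nbrs \<Gamma> v1 \<or> v \<in> nbrs \<Gamma> v2))"
      using v by (auto simp: nbrs_def move_simps(7) doubleton_eq_iff)
    also have "\<dots> \<longleftrightarrow> (u \<in> nbrs \<Gamma> v \<and> u \<notin> {v0, v1, v2}) \<or> (u = v12 \<and> (v1 \<in> nbrs \<Gamma> v \<or> v2 \<in> nbrs \<Gamma> v))"
      by (simp only: nbrs_sym[of v])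
    also have "\<dots> \<longleftrightarrow> u \<in> merge ` nbrs \<Gamma> v"
      using v0n by (auto simp: merge_def image_iff)
    finally show ?thesis .
  qed
  then show ?thesis by blast
qed

lemma nbrs_side: "v \<in> N \<Longrightarrow> v \<in> L \<Longrightarrow> nbrs \<Gamma> v \<subseteq> L" "v \<in> N \<Longrightarrow> v \<in> R \<Longrightarrow> nbrs \<Gamma> v \<subseteq> R"
  using nbrs_L nbrs_R v0_nbr by blast+

text \<open>Each side contains just one of \<open>v1\<close> and \<open>v2\<close>. The name
  \<open>v12\<close> may be reused from a deleted vertex, but no vertex of \<open>N\<close> carries
  it.\<close>

lemma inj_merge: "inj_on merge L" "inj_on merge R"
proof -
  have L: "u \<noteq> v2 \<and> (u \<noteq> v1 \<longrightarrow> u \<noteq> v12)" if "u \<in> L" for u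
    using that LR_N(1)[OF that] v12_LR(4) move_simps(5) by auto
  have R: "u \<noteq> v1 \<and> (u \<noteq> v2 \<longrightarrow> u \<noteq> v12)" if "u \<in> R" for u
    using that LR_N(2)[OF that] v12_LR(2) move_simps(5) by auto
  show "inj_on merge L"
  proof (rule inj_onI)
    fix x y assume "x \<in> L" "y \<in> L" "merge x = merge y"
    with L[of x] L[of y] show "x = y" by (auto simp: merge_def split: if_splits)
  qed
  show "inj_on merge R"
  proof (rule inj_onI)
    fix x y assume "x \<in> R" "y \<in> R" "merge x = merge y"
    with R[of x] R[of y] show "x = y" by (auto simp: merge_def split: if_splits)
  qed
qed

lemma degree_move: "degree \<Gamma> v0 = 2" "v \<in> N \<Longrightarrow> degree \<Gamma>' v = degree \<Gamma> v"
  "degree \<Gamma>' v12 = degree \<Gamma> v1 + degree \<Gamma> v2 - 2" "degree \<Gamma> v1 \<ge> 1" "degree \<Gamma> v2 \<ge> 1"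
proof -
  show "degree \<Gamma> v0 = 2" using move_simps(3) by (simp add: degree_nbrs move_simps(4))
  show "degree \<Gamma>' v = degree \<Gamma> v" if "v \<in> N"
  proof -
    have "inj_on merge (nbrs \<Gamma> v)"
    proof -
      have "v \<in> L \<or> v \<in> R" using that unfolding N_LR by blast
      then show ?thesis
        using inj_on_subset[OF inj_merge(1) nbrs_side(1)[OF that]]
          inj_on_subset[OF inj_merge(2) nbrs_side(2)[OF that]] by blast
    qed
    then show ?thesis using that by (simp add: degree_nbrs nbrs_N card_image)
  qed
  have d: "degree \<Gamma> v1 = Suc (card A1)" "degree \<Gamma> v2 = Suc (card A2)"
    using nbrs_v by (simp_all add: degree_nbrs)
  then show "degree \<Gamma> v1 \<ge> 1" "degree \<Gamma> v2 \<ge> 1" by simp_all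
  show "degree \<Gamma>' v12 = degree \<Gamma> v1 + degree \<Gamma> v2 - 2"
    using d A_disjoint by (simp add: degree_nbrs nbrs_v12 card_Un_disjoint)
qed

lemma odd_degree_R: "odd (\<Sum>v\<in>R. degree \<Gamma> v)"
proof (rule odd_sum_degree[OF tree(1)])
  have "u = v0 \<and> v = v2" if "{u, v} \<in> edges \<Gamma>" "v \<in> R" "u \<notin> R" for u v
  proof -
    have u: "u \<in> nbrs \<Gamma> v" using that(1) by (simp add: nbrs_def)
    have "v \<noteq> v0" using that(2) v0_notin by auto
    then have "u = v0" using nbrs_R[OF that(2) u] that(3) by blast
    then show ?thesis using u v0_nbr that(2) v12_LR by auto
  qed
  moreover have "{v0, v2} \<in> edges \<Gamma>" using move_simps(4) by (auto simp: nbrs_def insert_commute)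
  ultimately show "{(u, v). {u, v} \<in> edges \<Gamma> \<and> v \<in> R \<and> u \<notin> R} = {(v0, v2)}"
    using v0_notin v12_LR by auto
qed

definition collapse :: "'b::real_vector ^ 'v \<Rightarrow> 'b ^ 'v" where
  "collapse l = (\<chi> v. if v = v12 then l $ v1 - l $ v2
     else if v \<in> L - {v1} then l $ v else if v \<in> R - {v2} then - (l $ v) else 0)"

text \<open>If the label at \<open>v0\<close> is 0, the row of \<open>v0\<close> makes the values of
  a solution at \<open>v1\<close> and \<open>v2\<close> opposite; the sign change on
  \<open>R\<close> glues them to one value at \<open>v12\<close>.\<close>

definition unlift :: "'b::real_vector ^ 'v \<Rightarrow> 'b ^ 'v" where
  "unlift k = (\<chi> v. if v = v12 then k $ v1
     else if v \<in> L - {v1} then k $ v else if v \<in> R - {v2} then - (k $ v) else 0)"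

text \<open>The value \<open>t\<close> at \<open>v0\<close> is free. It does not enter the inner
  product with a family that vanishes at \<open>v0\<close>, and \<open>solve\<close> uses it to
  adjust the row of \<open>v1\<close>.\<close>

definition lift :: "'b::real_vector \<Rightarrow> 'b ^ 'v \<Rightarrow> 'b ^ 'v" where
  "lift t k = (\<chi> v. if v = v0 then t else if v = v1 then k $ v12 else if v = v2 then - k $ v12
     else if v \<in> L then k $ v else if v \<in> R then - k $ v else 0)"

text \<open>The solution of \<open>B k = l\<close> for the family \<open>l\<close> that vanishes at \<open>v0\<close>, has the value \<open>x\<close> at \<open>v1\<close> and
  collapses to \<open>B' k\<close>.\<close>

definition solve :: "'b::real_vector \<Rightarrow> 'b ^ 'v \<Rightarrow> 'b ^ 'v" where
  "solve x k = lift (x - of_int (weight \<Gamma> v1) *\<^sub>R k $ v12 - (\<Sum>u\<in>A1. k $ u)) k"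

lemma v12_notin_N: "v \<in> N \<Longrightarrow> v \<noteq> v12"
  using move_simps(5) by auto

lemma vertex_cases:
  obtains "v = v0" | "v = v1" | "v = v2" | "v \<in> L" "v \<notin> R" "v \<in> N" | "v \<in> R" "v \<notin> L" "v \<in> N" | "v \<notin> V"
  using LR_cover LR_disjoint[of v] LR_N[of v] by blast

lemma vertex'_cases:
  obtains "v = v12" | "v \<in> L" "v \<notin> R" "v \<in> N" "v \<noteq> v12" | "v \<in> R" "v \<notin> L" "v \<in> N" "v \<noteq> v12"
    | "v \<notin> V'" "v \<notin> N" "v \<noteq> v12"
  using LR_disjoint[of v] v12_notin_N[of v] N_LR move_simps(6) by blast

lemma side_notin: "v \<notin> N \<Longrightarrow> v \<notin> L - {v1}" "v \<notin> N \<Longrightarrow> v \<notin> R - {v2}"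
  using N_LR by auto

lemma collapse_families: "collapse l \<in> families V' UNIV"
proof -
  have "collapse l $ v = 0" if "v \<notin> V'" for v
    using that side_notin[of v] by (auto simp: collapse_def move_simps(6))
  then show ?thesis by (simp add: families_iff)
qed

lemma collapse_add: "collapse (x + y) = collapse x + collapse y"
  by (auto simp: collapse_def vec_eq_iff)

lemma collapse_inject:
  assumes "l \<in> families V UNIV" "m \<in> families V UNIV" "collapse l = collapse m"
    "l $ v0 = m $ v0" "l $ v1 = m $ v1"
  shows "l = m"
proof -
  have eq: "collapse l $ v = collapse m $ v" for v using assms(3) by simp
  have "l $ v = m $ v" for v
  proof (cases rule: vertex_cases[of v])
    case 3
    then show ?thesis using eq[of v12] assms(5) by (simp add: collapse_def)
  next
    case 4
    then show ?thesis using eq[of v] v12_notin_N[of v] by (simp add: collapse_def)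
  next
    case 5
    then show ?thesis using eq[of v] v12_notin_N[of v] by (simp add: collapse_def)
  next
    case 6
    then show ?thesis using assms(1,2) by (simp add: families_iff)
  qed (use assms in simp_all)
  then show ?thesis by (simp add: vec_eq_iff)
qed

lemma lift_simps:
  "lift t k $ v0 = t" "lift t k $ v1 = k $ v12" "lift t k $ v2 = - k $ v12"
  "v \<in> L \<Longrightarrow> v \<in> N \<Longrightarrow> lift t k $ v = k $ v" "v \<in> R \<Longrightarrow> v \<in> N \<Longrightarrow> lift t k $ v = - k $ v"
  using v012 move_simps(3) LR_disjoint[of v] by (auto simp: lift_def)

lemma lift_families: "lift t k \<in> families V UNIV"
proof -
  have "lift t k $ v = 0" if "v \<notin> V" for v
    using that v012 move_simps(1) LR_cover by (auto simp: lift_def)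
  then show ?thesis by (simp add: families_iff)
qed

lemma unlift_lift:
  assumes "k \<in> families V' UNIV"
  shows "unlift (lift t k) = k"
proof -
  have "unlift (lift t k) $ v = k $ v" for v
  proof (cases rule: vertex'_cases[of v])
    case 4
    then show ?thesis using assms side_notin[of v] by (auto simp: unlift_def families_iff)
  qed (simp_all add: unlift_def lift_simps)
  then show ?thesis by (simp add: vec_eq_iff)
qed

lemma linear_solve: "linear (solve 0)"
proof (rule linearI)
  show "solve 0 (x + y) = solve 0 x + solve 0 y" for x y :: "'b ^ 'v"
    by (auto simp: solve_def lift_def vec_eq_iff algebra_simps sum.distrib)
  show "solve 0 (c *\<^sub>R x) = c *\<^sub>R solve 0 x" for c and x :: "'b ^ 'v"
    by (auto simp: solve_def lift_def vec_eq_iff algebra_simps scaleR_sum_right)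
qed

lemma linking_v0: "B k $ v0 = k $ v1 + k $ v2"
  using move_simps(3) by (simp add: mat_act_linking[OF tree(1) move_simps(1)] move_simps(2,4))

lemma linking_v1: "B k $ v1 = of_int (weight \<Gamma> v1) *\<^sub>R k $ v1 + (k $ v0 + (\<Sum>u\<in>A1. k $ u))"
  and linking_v2: "B k $ v2 = of_int (weight \<Gamma> v2) *\<^sub>R k $ v2 + (k $ v0 + (\<Sum>u\<in>A2. k $ u))"
  using nbrs_v(3,4) by (simp_all add: mat_act_linking[OF tree(1)] v012(1,2) nbrs_v(1,2))

lemma unlift_merge:
  assumes "k $ v1 + k $ v2 = 0"
  shows "u \<in> L \<Longrightarrow> unlift k $ merge u = k $ u" "u \<in> R \<Longrightarrow> unlift k $ merge u = - (k $ u)"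
proof -
  have k2: "k $ v1 = - (k $ v2)" using assms by (simp add: eq_neg_iff_add_eq_0)
  show "unlift k $ merge u = k $ u" if "u \<in> L"
  proof (cases "u = v1")
    case False
    then have "u \<noteq> v12" "u \<noteq> v2" using that LR_N(1) v12_notin_N by auto
    then show ?thesis using False that by (simp add: unlift_def merge_def)
  qed (simp add: unlift_def merge_def)
  show "unlift k $ merge u = - (k $ u)" if "u \<in> R"
  proof (cases "u = v2")
    case False
    then have "u \<noteq> v12" "u \<noteq> v1" "u \<notin> L" using that LR_N(2)[of u] v12_notin_N LR_disjoint[of u] by auto
    then show ?thesis using False that by (simp add: unlift_def merge_def)
  qed (simp add: unlift_def merge_def k2)
qed

text \<open>In the row of \<open>v1\<close> minus the row of \<open>v2\<close> the unknown at
  \<open>v0\<close> cancels, and since the values at \<open>v1\<close> and \<open>v2\<close> are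
  opposite, the two weights add up.\<close>

lemma linking_collapse:
  fixes k :: "'b::euclidean_space ^ 'v"
  assumes "k $ v1 + k $ v2 = 0"
  shows "collapse (B k) = B' (unlift k)"
proof -
  note um = unlift_merge[OF assms]
  have "collapse (B k) $ v = B' (unlift k) $ v" for v
  proof (cases rule: vertex'_cases[of v])
    case 1
    have "(\<Sum>u\<in>A1. unlift k $ u) = (\<Sum>u\<in>A1. k $ u)"
      using A_subset(1) LR_N(1) v12_notin_N by (intro sum.cong) (auto simp: unlift_def)
    moreover have "(\<Sum>u\<in>A2. unlift k $ u) = (\<Sum>u\<in>A2. - (k $ u))"
    proof (intro sum.cong refl)
      fix u assume "u \<in> A2"
      then have "u \<in> R" "u \<noteq> v2" using A_subset(2) by auto
      then show "unlift k $ u = - (k $ u)"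
        using LR_N(2)[of u] v12_notin_N[of u] LR_disjoint[of u] by (auto simp: unlift_def)
    qed
    ultimately have "(\<Sum>u\<in>A1 \<union> A2. unlift k $ u) = (\<Sum>u\<in>A1. k $ u) - (\<Sum>u\<in>A2. k $ u)"
      using A_disjoint by (simp add: sum.union_disjoint sum_negf)
    moreover have "unlift k $ v12 = k $ v1" by (simp add: unlift_def)
    moreover have "v12 \<in> V'" using move_simps(6) by simp
    ultimately have "B' (unlift k) $ v12 =
        of_int (weight \<Gamma> v1 + weight \<Gamma> v2) *\<^sub>R k $ v1 + ((\<Sum>u\<in>A1. k $ u) - (\<Sum>u\<in>A2. k $ u))"
      by (simp add: mat_act_linking[OF tree(2)] nbrs_v12 move_simps(8))
    moreover have "k $ v2 = - (k $ v1)" using assms by (simp add: add_eq_0_iff)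
    ultimately show ?thesis using 1 by (simp add: collapse_def linking_v1 linking_v2 algebra_simps)
  next
    case 2
    have vV: "v \<in> V" "v \<in> V'" "v \<noteq> v1" using 2 move_simps(6) by auto
    have "(\<Sum>u\<in>nbrs \<Gamma>' v. unlift k $ u) = (\<Sum>u\<in>nbrs \<Gamma> v. unlift k $ merge u)"
      unfolding nbrs_N[OF 2(3)]
      by (rule sum.reindex[OF inj_on_subset[OF inj_merge(1) nbrs_side(1)[OF 2(3,1)]], unfolded o_def])
    also have "\<dots> = (\<Sum>u\<in>nbrs \<Gamma> v. k $ u)"
      using um(1) nbrs_side(1)[OF 2(3,1)] by (intro sum.cong) auto
    finally show ?thesis
      using 2 vV by (simp add: mat_act_linking[OF tree(2)] move_simps(9)[OF 2(3)] collapse_def unlift_def)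
        (simp add: mat_act_linking[OF tree(1)])
  next
    case 3
    have vV: "v \<in> V" "v \<in> V'" "v \<noteq> v2" using 3 move_simps(6) by auto
    have "(\<Sum>u\<in>nbrs \<Gamma>' v. unlift k $ u) = (\<Sum>u\<in>nbrs \<Gamma> v. unlift k $ merge u)"
      unfolding nbrs_N[OF 3(3)]
      by (rule sum.reindex[OF inj_on_subset[OF inj_merge(2) nbrs_side(2)[OF 3(3,1)]], unfolded o_def])
    also have "\<dots> = (\<Sum>u\<in>nbrs \<Gamma> v. - (k $ u))"
      using um(2) nbrs_side(2)[OF 3(3,1)] by (intro sum.cong) auto
    finally have "B' (unlift k) $ v = - (of_int (weight \<Gamma> v) *\<^sub>R k $ v + (\<Sum>u\<in>nbrs \<Gamma> v. k $ u))"
      using 3 vV by (simp add: mat_act_linking[OF tree(2)] move_simps(9)[OF 3(3)] sum_negf)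
        (simp add: unlift_def)
    moreover have "collapse (B k) $ v = - B k $ v" using 3 vV by (simp add: collapse_def)
    ultimately show ?thesis using vV by (simp add: mat_act_linking[OF tree(1)])
  next
    case 4
    then show ?thesis using side_notin[of v] by (auto simp: collapse_def mat_act_linking_outside)
  qed
  then show ?thesis by (simp add: vec_eq_iff)
qed

lemma linking_solve:
  fixes k :: "'b::euclidean_space ^ 'v"
  assumes "k \<in> families V' UNIV"
  shows "collapse (B (solve x k)) = B' k" "B (solve x k) $ v0 = 0" "B (solve x k) $ v1 = x"
proof -
  have 0: "solve x k $ v1 + solve x k $ v2 = 0" by (simp add: solve_def lift_simps)
  then show "collapse (B (solve x k)) = B' k"
    using linking_collapse[OF 0] unlift_lift[OF assms] by (simp add: solve_def)
  show "B (solve x k) $ v0 = 0" using 0 by (simp add: linking_v0)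
  have "(\<Sum>u\<in>A1. solve x k $ u) = (\<Sum>u\<in>A1. k $ u)"
    unfolding solve_def by (intro sum.cong refl lift_simps(4) A_N)
  then show "B (solve x k) $ v1 = x" by (simp add: linking_v1) (simp add: solve_def lift_simps)
qed

lemma linking_solve_eq:
  fixes l :: "'b::euclidean_space ^ 'v"
  assumes "l \<in> families V UNIV" "l $ v0 = 0" "k \<in> families V' UNIV" "collapse l = B' k"
  shows "B (solve (l $ v1) k) = l"
proof (rule collapse_inject[OF mat_act_linking_families assms(1)])
  show "collapse (B (solve (l $ v1) k)) = collapse l" by (simp only: linking_solve(1)[OF assms(3)] assms(4))
  show "B (solve (l $ v1) k) $ v0 = l $ v0" by (simp only: linking_solve(2)[OF assms(3)] assms(2))
qed (rule linking_solve(3)[OF assms(3)])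

lemma inner_lift:
  fixes l k :: "'b::euclidean_space ^ 'v"
  assumes "l \<in> families V UNIV" "l $ v0 = 0" "k \<in> families V' UNIV"
  shows "l \<bullet> lift t k = collapse l \<bullet> k"
proof -
  define f where "f v = (if v \<in> N then l $ v \<bullet> lift t k $ v else 0)" for v
  have "l $ v \<bullet> lift t k $ v = f v + (if v = v1 then l $ v1 \<bullet> k $ v12 else 0)
      + (if v = v2 then - (l $ v2 \<bullet> k $ v12) else 0)" for v
  proof (cases rule: vertex_cases[of v])
    case 6
    then show ?thesis using assms(1) v012 by (auto simp: f_def families_iff)
  qed (use assms(2) v012 move_simps(3) in \<open>auto simp: f_def lift_simps\<close>)
  then have 1: "l \<bullet> lift t k = (\<Sum>v\<in>UNIV. f v) + l $ v1 \<bullet> k $ v12 - l $ v2 \<bullet> k $ v12"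
    by (simp add: inner_vec_def sum.distrib)
  have "collapse l $ v \<bullet> k $ v = f v + (if v = v12 then (l $ v1 - l $ v2) \<bullet> k $ v12 else 0)" for v
  proof (cases rule: vertex'_cases[of v])
    case 1
    then show ?thesis using v12_notin_N by (auto simp: f_def collapse_def)
  next
    case 4
    then show ?thesis using assms(3) by (auto simp: f_def families_iff)
  qed (auto simp: f_def collapse_def lift_simps)
  then have "collapse l \<bullet> k = (\<Sum>v\<in>UNIV. f v) + (l $ v1 - l $ v2) \<bullet> k $ v12"
    by (simp add: inner_vec_def sum.distrib)
  with 1 show ?thesis by (simp add: inner_diff_left)
qed

lemma card_vertices: "card V = card V' + 2"
proof -
  have "card V = Suc (Suc (Suc (card N)))"
  proof -
    have "V = insert v0 (insert v1 (insert v2 N))" using v012 move_simps(1) by auto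
    moreover have "card (insert v0 (insert v1 (insert v2 N))) = Suc (Suc (Suc (card N)))"
      using v012 move_simps(3) by simp
    ultimately show ?thesis by metis
  qed
  moreover have "card V' = Suc (card N)"
    unfolding move_simps(6) using move_simps(5) by (intro card_insert_disjoint) auto
  ultimately show ?thesis by simp
qed

lemma inertia: "num_positive \<Gamma> = num_positive \<Gamma>' + 1" "signature \<Gamma> = signature \<Gamma>'"
proof -
  \<comment> \<open>A vector with entry \<open>a\<close> at \<open>v0\<close> and 1 at
    \<open>v1\<close> has form value \<open>2 * a + weight \<Gamma> v1\<close>, because
    \<open>v0\<close> has weight 0; the entry is chosen to make this \<open>c\<close>. Orthogonality
    holds since \<open>B (solve 0 x)\<close> vanishes at both vertices.\<close>
  define e :: "real \<Rightarrow> real ^ 'v" where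
    "e c = (\<chi> v. if v = v0 then (c - of_int (weight \<Gamma> v1)) / 2 else if v = v1 then 1 else 0)" for c
  have e: "e c \<bullet> x = (c - of_int (weight \<Gamma> v1)) / 2 * x $ v0 + x $ v1" for c x
  proof -
    have "e c $ v \<bullet> x $ v = (if v = v0 then (c - of_int (weight \<Gamma> v1)) / 2 * x $ v0 else 0)
        + (if v = v1 then x $ v1 else 0)" for v
      using v012 by (simp add: e_def)
    then show ?thesis by (simp add: inner_vec_def sum.distrib)
  qed
  have sum: "(\<Sum>u\<in>A1. e c $ u) = 0" for c
    using A_subset(1) nbrs_v(3) by (intro sum.neutral) (auto simp: e_def)
  have "solve 0 x \<bullet> B (solve 0 x) = x \<bullet> B' x" if "x \<in> families V' UNIV" for x :: "real ^ 'v"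
    using inner_lift[OF mat_act_linking_families linking_solve(2)[OF that] that, of 0]
      linking_solve(1)[OF that, of 0] by (simp add: solve_def inner_commute)
  moreover have "solve 0 x \<in> families V UNIV" for x :: "real ^ 'v" by (simp add: solve_def lift_families)
  moreover have "e c \<in> families V UNIV" for c using v012 move_simps(1) by (auto simp: e_def families_iff)
  moreover have "e c \<bullet> B (e c) = c" for c
    using v012 move_simps(3) by (simp add: e linking_v0 linking_v1 sum) (simp add: e_def field_simps)
  moreover have "e c \<bullet> B (solve 0 x) = 0" if "x \<in> families V' UNIV" for c x
    using linking_solve(2,3)[OF that, of 0] by (simp add: e)
  ultimately show "num_positive \<Gamma> = num_positive \<Gamma>' + 1" "signature \<Gamma> = signature \<Gamma>'"
    using inertia_hyperbolic[OF wnd linear_solve, of e] card_vertices by blast+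
qed

lemma exponent:
  assumes "l \<in> families V UNIV" "l $ v0 = 0"
  shows "summand_exponent \<Delta> \<Phi> \<Gamma> l = summand_exponent \<Delta> \<Phi> \<Gamma>' (collapse l)"
proof -
  obtain k where k: "k \<in> families V' UNIV" "B' k = collapse l"
    "collapse l \<bullet> mat_act (linking_inverse \<Gamma>') (collapse l) = collapse l \<bullet> k"
    using inner_inverse_lift[OF collapse_families] .
  have "solve (l $ v1) k \<in> families V UNIV" by (simp add: solve_def lift_families)
  then have "l \<bullet> mat_act (linking_inverse \<Gamma>) l = l \<bullet> solve (l $ v1) k"
    using linking_solve_eq[OF assms k(1) k(2)[symmetric]] by (intro inner_linking_inverse[OF wnd(1)])
  then have q: "l \<bullet> mat_act (linking_inverse \<Gamma>) l
      = collapse l \<bullet> mat_act (linking_inverse \<Gamma>') (collapse l)"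
    by (simp add: solve_def inner_lift[OF assms k(1)] k(3))
  have "V = insert v0 (insert v1 (insert v2 N))" using v012 move_simps(1) by auto
  then have "(\<Sum>v\<in>V. weight \<Gamma> v) = (\<Sum>v\<in>insert v0 (insert v1 (insert v2 N)). weight \<Gamma> v)" by (rule arg_cong)
  also have "\<dots> = weight \<Gamma> v1 + weight \<Gamma> v2 + (\<Sum>v\<in>N. weight \<Gamma> v)"
    using v012 move_simps(2,3) by simp
  also have "\<dots> = (\<Sum>v\<in>V'. weight \<Gamma>' v)"
    unfolding move_simps(6) using move_simps(5) by (subst sum.insert) (simp_all add: move_simps(8,9))
  finally have "trace (linking_matrix \<Gamma>) = trace (linking_matrix \<Gamma>')"
    by (simp add: trace_linking flip: of_int_sum)
  then show ?thesis by (simp add: summand_exponent_def q inertia)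
qed

text \<open>The fibre over \<open>l'\<close> is parametrized by the label at \<open>v1\<close>; the
  difference prescribed at \<open>v12\<close> then fixes the label at \<open>v2\<close>.\<close>

definition extend :: "'b::real_vector \<Rightarrow> 'b ^ 'v \<Rightarrow> 'b ^ 'v" where
  "extend x l' = (\<chi> v. if v = v0 then 0 else if v = v1 then x else if v = v2 then x - l' $ v12
     else if v \<in> L then l' $ v else if v \<in> R then - (l' $ v) else 0)"

lemma extend_simps:
  "extend x l' $ v0 = 0" "extend x l' $ v1 = x" "extend x l' $ v2 = x - l' $ v12"
  "v \<in> L \<Longrightarrow> v \<in> N \<Longrightarrow> extend x l' $ v = l' $ v" "v \<in> R \<Longrightarrow> v \<in> N \<Longrightarrow> extend x l' $ v = - (l' $ v)"
  using v012 move_simps(3) LR_disjoint[of v] by (auto simp: extend_def)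

lemma extend:
  assumes "l' \<in> families V' UNIV"
  shows "extend x l' \<in> families V UNIV" "collapse (extend x l') = l'"
proof -
  have "extend x l' $ v = 0" if "v \<notin> V" for v
    using that v012 move_simps(1) LR_cover by (auto simp: extend_def)
  then show "extend x l' \<in> families V UNIV" by (simp add: families_iff)
  have "collapse (extend x l') $ v = l' $ v" for v
  proof (cases rule: vertex'_cases[of v])
    case 4
    then show ?thesis using assms side_notin[of v] by (auto simp: collapse_def families_iff)
  qed (simp_all add: collapse_def extend_simps)
  then show "collapse (extend x l') = l'" by (simp add: vec_eq_iff)
qed

lemma coeff_extend:
  "summand_coeff \<Delta> \<Phi> \<Gamma> (extend x l') =
     vertex_coeff \<Delta> \<Phi> (degree \<Gamma> v1) x * vertex_coeff \<Delta> \<Phi> (degree \<Gamma> v2) (x - l' $ v12)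
       * ((-1) ^ ((\<Sum>v\<in>R - {v2}. degree \<Gamma> v) * card P)
         * (\<Prod>v\<in>N. vertex_coeff \<Delta> \<Phi> (degree \<Gamma>' v) (l' $ v)))"
proof -
  let ?n = "vertex_coeff \<Delta> \<Phi>"
  have split: "(\<Prod>v\<in>N. f v) = (\<Prod>v\<in>L - {v1}. f v) * (\<Prod>v\<in>R - {v2}. f v)" for f :: "'v \<Rightarrow> rat"
    unfolding N_LR using LR_disjoint by (intro prod.union_disjoint) auto
  have "(\<Prod>v\<in>N. ?n (degree \<Gamma> v) (extend x l' $ v)) =
      (\<Prod>v\<in>L - {v1}. ?n (degree \<Gamma>' v) (l' $ v)) *
      (\<Prod>v\<in>R - {v2}. (-1) ^ (degree \<Gamma> v * card P) * ?n (degree \<Gamma>' v) (l' $ v))"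
    unfolding split
  proof (intro arg_cong2[of _ _ _ _ "(*)"] prod.cong refl)
    fix v assume "v \<in> L - {v1}"
    then have v: "v \<in> L" "v \<in> N" using LR_N(1) by auto
    show "?n (degree \<Gamma> v) (extend x l' $ v) = ?n (degree \<Gamma>' v) (l' $ v)"
      by (simp only: extend_simps(4)[OF v] degree_move(2)[OF v(2)])
  next
    fix v assume "v \<in> R - {v2}"
    then have v: "v \<in> R" "v \<in> N" using LR_N(2) by auto
    show "?n (degree \<Gamma> v) (extend x l' $ v) = (-1) ^ (degree \<Gamma> v * card P) * ?n (degree \<Gamma>' v) (l' $ v)"
      by (simp only: extend_simps(5)[OF v] degree_move(2)[OF v(2)] vertex_coeff_uminus)
  qed
  also have "\<dots> = (-1) ^ ((\<Sum>v\<in>R - {v2}. degree \<Gamma> v) * card P) * (\<Prod>v\<in>N. ?n (degree \<Gamma>' v) (l' $ v))"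
    unfolding split by (simp add: prod.distrib prod_sign)
  finally have N: "(\<Prod>v\<in>N. ?n (degree \<Gamma> v) (extend x l' $ v)) = \<dots>" .
  have "V = insert v0 (insert v1 (insert v2 N))" using v012 move_simps(1) by auto
  then have "summand_coeff \<Delta> \<Phi> \<Gamma> (extend x l')
    = (\<Prod>v\<in>insert v0 (insert v1 (insert v2 N)). ?n (degree \<Gamma> v) (extend x l' $ v))"
    unfolding summand_coeff_def by (rule arg_cong)
  also have "\<dots> = ?n 2 0 * (?n (degree \<Gamma> v1) x * (?n (degree \<Gamma> v2) (x - l' $ v12) *
      (\<Prod>v\<in>N. ?n (degree \<Gamma> v) (extend x l' $ v))))"
    using v012 move_simps(3) by (simp add: extend_simps(1-3) degree_move(1))
  finally show ?thesis by (simp add: N vertex_coeff_2 mult.assoc)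
qed

text \<open>The form of the inverse linking matrix is isotropic on the sum of the unit vectors at \<open>v1\<close> and \<open>v2\<close>,
  which is the image of the unit vector at \<open>v0\<close>.\<close>

lemma low_degree: "degree \<Gamma> v1 \<le> 2 \<or> degree \<Gamma> v2 \<le> 2"
proof (rule ccontr)
  assume "\<not> ?thesis"
  then have d: "3 \<le> degree \<Gamma> v1" "3 \<le> degree \<Gamma> v2" by auto
  define e0 :: "real ^ 'v" where "e0 = axis v0 1"
  define x :: "real ^ 'v" where "x = axis v1 1 + axis v2 1"
  have e0: "e0 \<in> families V UNIV" using move_simps(1) by (auto simp: e0_def families_iff axis_def)
  have "B e0 $ v = x $ v" for v
  proof (cases "v \<in> V")
    case False
    then have "v \<noteq> v1" "v \<noteq> v2" using v012 by auto
    then show ?thesis using False by (simp add: mat_act_linking_outside x_def axis_def)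
  next
    case True
    have "(\<Sum>u\<in>nbrs \<Gamma> v. e0 $ u) = (if v0 \<in> nbrs \<Gamma> v then 1 else 0)"
      by (simp add: e0_def axis_def)
    moreover have "of_int (weight \<Gamma> v) *\<^sub>R e0 $ v = 0" using move_simps(2) by (simp add: e0_def axis_def)
    ultimately have "B e0 $ v = (if v = v1 \<or> v = v2 then 1 else 0)"
      using True by (simp add: mat_act_linking[OF tree(1)] v0_nbr)
    then show ?thesis using move_simps(3) by (auto simp: x_def axis_def)
  qed
  then have "B e0 = x" by (simp add: vec_eq_iff)
  then have "x \<bullet> mat_act (linking_inverse \<Gamma>) x = x \<bullet> e0"
    by (rule inner_linking_inverse[OF wnd(1) e0])
  also have "\<dots> = 0" using v012 unfolding e0_def inner_axis by (simp add: x_def axis_def)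
  finally have "x \<bullet> mat_act (linking_inverse \<Gamma>) x = 0" .
  moreover have "x \<in> families {v \<in> V. 3 \<le> degree \<Gamma> v} UNIV"
    using d v012 by (auto simp: x_def families_iff axis_def)
  moreover have "x $ v1 \<noteq> 0" using move_simps(3) by (simp add: x_def axis_def)
  then have "x \<noteq> 0" by auto
  ultimately show False using weakly_negative_definite_inner[OF wnd(1)] by fastforce
qed

lemma Zhat_move:
  assumes "label_corr3 \<Delta> \<Phi> v0 v1 v2 v12 \<Gamma> \<Gamma>' b b'"
  shows "Zhat \<Delta> \<Phi> \<Gamma> b = Zhat \<Delta> \<Phi> \<Gamma>' b'"
proof -
  obtain l0 where l0: "l0 \<in> label_reps \<Delta> \<Phi> \<Gamma>" "l0 $ v0 = 0" and b: "b = label_class \<Delta> \<Gamma> l0"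
    and b': "b' = label_class \<Delta> \<Gamma>' (collapse l0)"
    using assms by (auto simp: label_corr3_def Let_def collapse_def)
  let ?Q = "root_lattice \<Delta>"
  let ?c = "summand_coeff \<Delta> \<Phi> \<Gamma>"
  let ?n = "vertex_coeff \<Delta> \<Phi>"
  let ?d1 = "degree \<Gamma> v1" and ?d2 = "degree \<Gamma> v2"
  have l0F: "l0 \<in> families V UNIV" using l0(1) by (rule label_reps_families)
  have bF: "l \<in> families V UNIV" if "l \<in> b" for l
    using label_class_families[OF l0F] that unfolding b .
  have b'F: "l \<in> families V' UNIV" if "l \<in> b'" for l
    using label_class_families[OF collapse_families] that unfolding b' .
  have nz: "?n (degree \<Gamma> v) (l $ v) \<noteq> 0" if "?c l \<noteq> 0" "v \<in> V" for l v
    using that by (auto simp: summand_coeff_def)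
  have nz0: "l $ v0 = 0" if "?c l \<noteq> 0" for l
    using nz[OF that move_simps(1)] by (simp add: degree_move(1) vertex_coeff_2 split: if_splits)
  have to_b': "collapse l \<in> b'" if l: "l \<in> b" "l $ v0 = 0" for l
  proof -
    obtain k where k: "k \<in> families V ?Q" "l = B k + l0"
      using l(1) unfolding b label_class_def by blast
    have "k $ v1 + k $ v2 = 0" using l(2) l0(2) k(2) by (simp add: linking_v0)
    then have "collapse l = B' (unlift k) + collapse l0"
      by (simp add: k(2) collapse_add linking_collapse)
    moreover have "unlift k \<in> families V' ?Q"
    proof -
      have "unlift k $ v \<in> ?Q" for v
        using families_root_lattice_nth[OF k(1)]
        by (auto simp: unlift_def intro!: root_lattice_0 root_lattice_uminus)
      moreover have "unlift k $ v = 0" if "v \<notin> V'" for v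
        using that side_notin[of v] by (auto simp: unlift_def move_simps(6))
      ultimately show ?thesis by (simp add: families_iff)
    qed
    ultimately show ?thesis unfolding b' label_class_def by blast
  qed
  have from_b': "extend x l' \<in> b"
    if l': "l' \<in> b'" and x: "?n ?d1 x \<noteq> 0" "?n ?d2 (x - l' $ v12) \<noteq> 0" for l' x
  proof -
    obtain k where k: "k \<in> families V' ?Q" "l' = B' k + collapse l0"
      using l' unfolding b' label_class_def by blast
    have kF: "k \<in> families V' UNIV" using k(1) by (auto simp: families_iff)
    \<comment> \<open>Chosen so that adding \<open>l0\<close> to its image under \<open>B\<close>
      gives the label \<open>x\<close> at \<open>v1\<close>.\<close>
    let ?m = "solve (x - l0 $ v1) k"
    have "B ?m + l0 = extend x l'"
    proof (rule collapse_inject)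
      show "B ?m + l0 \<in> families V UNIV"
        using mat_act_linking_families l0F subspace_families subspace_add by blast
      show "extend x l' \<in> families V UNIV" using b'F[OF l'] by (rule extend)
      show "collapse (B ?m + l0) = collapse (extend x l')"
        using extend(2)[OF b'F[OF l']] linking_solve(1)[OF kF] k(2) by (simp add: collapse_add)
      show "(B ?m + l0) $ v0 = extend x l' $ v0"
        using linking_solve(2)[OF kF] l0(2) by (simp add: extend_simps)
      show "(B ?m + l0) $ v1 = extend x l' $ v1"
        using linking_solve(3)[OF kF] by (simp add: extend_simps)
    qed
    moreover have "?m \<in> families V ?Q"
    proof -
      \<comment> \<open>The support of a vertex coefficient determines the coset at a vertex of
        degree at most 2. If that vertex is \<open>v2\<close>, the condition is carried over to
        \<open>v1\<close> by the class of \<open>l' $ v12\<close>.\<close>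
      have xQ: "x - l0 $ v1 \<in> ?Q"
      proof (cases "?d1 \<le> 2")
        case True
        then have "?d1 \<in> {1, 2}" using degree_move(4) by auto
        then show ?thesis
          using root_lattice_diff[OF vertex_coeff_lattice[OF _ x(1)] label_reps_lattice[OF l0(1) v012(1)]]
          by simp
      next
        case False
        then have "?d2 \<in> {1, 2}" using low_degree degree_move(5) by auto
        then have "x - l' $ v12 - l0 $ v2 \<in> ?Q"
          using root_lattice_diff[OF vertex_coeff_lattice[OF _ x(2)] label_reps_lattice[OF l0(1) v012(2)]]
          by simp
        moreover have "l' $ v12 - (l0 $ v1 - l0 $ v2) \<in> ?Q"
          using families_root_lattice_nth[OF mat_act_linking_lattice[OF k(1)], of v12]
          by (simp add: k(2) collapse_def)
        ultimately have "x - l' $ v12 - l0 $ v2 + (l' $ v12 - (l0 $ v1 - l0 $ v2)) \<in> ?Q"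
          by (rule root_lattice_add)
        then show ?thesis by simp
      qed
      have "?m $ v \<in> ?Q" for v
        using families_root_lattice_nth[OF k(1)] xQ
        by (auto simp: solve_def lift_def
            intro!: root_lattice_0 root_lattice_scale root_lattice_diff root_lattice_uminus root_lattice_sum)
      moreover have "?m \<in> families V UNIV" by (simp add: solve_def lift_families)
      ultimately show ?thesis by (auto simp: families_iff)
    qed
    ultimately show ?thesis unfolding b label_class_def by force
  qed
  show ?thesis
  proof (rule Zhat_transfer[where T = collapse and s = "(-1) ^ card P"])
    show "finite {l \<in> b. ?c l \<noteq> 0 \<and> summand_exponent \<Delta> \<Phi> \<Gamma> l = r}" for r
      unfolding b using wnd(1) l0F by (rule finite_summation_set)
    show "collapse l \<in> b' \<and> summand_exponent \<Delta> \<Phi> \<Gamma>' (collapse l) = summand_exponent \<Delta> \<Phi> \<Gamma> l"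
      if "l \<in> b" "?c l \<noteq> 0" for l
      using to_b'[OF that(1) nz0[OF that(2)]] exponent[OF bF[OF that(1)] nz0[OF that(2)]] by simp
    show "(\<Sum>l\<in>{l \<in> b. ?c l \<noteq> 0 \<and> collapse l = l'}. ?c l) = (-1) ^ card P * summand_coeff \<Delta> \<Phi> \<Gamma>' l'"
      if l': "l' \<in> b'" for l'
    proof -
      define K where "K = {x. ?n ?d1 x \<noteq> 0 \<and> ?n ?d2 (x - l' $ v12) \<noteq> 0}"
      note l'F = b'F[OF l']
      \<comment> \<open>The factor at a vertex of degree at most 2 confines \<open>x\<close>, or its
        translate by \<open>l' $ v12\<close>, to a finite support.\<close>
      have finK: "finite K"
      proof (cases "?d1 \<le> 2")
        case True
        then show ?thesis
          by (intro finite_subset[OF _ finite_vertex_coeff_support]) (auto simp: K_def)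
      next
        case False
        then have "K \<subseteq> (\<lambda>y. y + l' $ v12) ` {\<mu>. \<exists>d\<le>2. ?n d \<mu> \<noteq> 0}"
          using low_degree by (auto simp: K_def intro!: image_eqI[of _ _ "_ - l' $ v12"])
        then show ?thesis using finite_vertex_coeff_support finite_subset by blast
      qed
      have "(\<Sum>l\<in>{l \<in> b. ?c l \<noteq> 0 \<and> collapse l = l'}. ?c l) = (\<Sum>x\<in>K. ?c (extend x l'))"
      proof (rule sum_fibre[OF finK])
        show "inj_on (\<lambda>x. extend x l') K"
        proof (rule inj_onI)
          fix x y assume "extend x l' = extend y l'"
          then have "extend x l' $ v1 = extend y l' $ v1" by simp
          then show "x = y" by (simp only: extend_simps(2))
        qed
        show "extend x l' \<in> b \<and> collapse (extend x l') = l'" if "x \<in> K" for x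
          using from_b'[OF l'] extend(2)[OF l'F] that by (simp add: K_def)
        show "l \<in> (\<lambda>x. extend x l') ` K" if "l \<in> b" "?c l \<noteq> 0" "collapse l = l'" for l
        proof (rule image_eqI)
          show eq: "l = extend (l $ v1) l'"
            using that(3) nz0[OF that(2)]
            by (intro collapse_inject[OF bF[OF that(1)] extend(1)[OF l'F]])
              (simp_all only: extend[OF l'F] extend_simps)
          have "l $ v2 = l $ v1 - l' $ v12" using arg_cong[OF eq, of "\<lambda>l. l $ v2"] by (simp add: extend_simps)
          then show "l $ v1 \<in> K" using nz[OF that(2)] v012 by (metis (mono_tags, lifting) K_def mem_Collect_eq)
        qed
      qed
      also have "\<dots> = (\<Sum>x\<in>K. ?n ?d1 x * ?n ?d2 (x - l' $ v12)) *
          ((-1) ^ ((\<Sum>v\<in>R - {v2}. degree \<Gamma> v) * card P) * (\<Prod>v\<in>N. ?n (degree \<Gamma>' v) (l' $ v)))"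
        by (simp add: coeff_extend sum_distrib_right)
      also have "(\<Sum>x\<in>K. ?n ?d1 x * ?n ?d2 (x - l' $ v12))
          = (-1) ^ (?d2 * card P) * ?n (degree \<Gamma>' v12) (l' $ v12)"
        unfolding degree_move(3) using low_degree degree_move(4,5) finK
        by (intro vertex_coeff_convolution) (auto simp: K_def)
      also have "(-1) ^ (?d2 * card P) * ?n (degree \<Gamma>' v12) (l' $ v12) *
          ((-1) ^ ((\<Sum>v\<in>R - {v2}. degree \<Gamma> v) * card P) * (\<Prod>v\<in>N. ?n (degree \<Gamma>' v) (l' $ v)))
        = (-1) ^ ((?d2 + (\<Sum>v\<in>R - {v2}. degree \<Gamma> v)) * card P) *
          (?n (degree \<Gamma>' v12) (l' $ v12) * (\<Prod>v\<in>N. ?n (degree \<Gamma>' v) (l' $ v)))"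
        by (simp add: add_mult_distrib power_add)
      \<comment> \<open>The sign from reversing the argument in the convolution supplies the missing
        contribution of \<open>v2\<close>, which completes the degree sum over
        \<open>R\<close>.\<close>
      also have "?d2 + (\<Sum>v\<in>R - {v2}. degree \<Gamma> v) = (\<Sum>v\<in>R. degree \<Gamma> v)"
        using v12_LR(3) by (intro sum.remove[symmetric]) auto
      also have "?n (degree \<Gamma>' v12) (l' $ v12) * (\<Prod>v\<in>N. ?n (degree \<Gamma>' v) (l' $ v))
        = summand_coeff \<Delta> \<Phi> \<Gamma>' l'"
        unfolding summand_coeff_def move_simps(6) using move_simps(5) by (intro prod.insert[symmetric]) auto
      finally show ?thesis using odd_degree_R by (simp add: neg_one_odd_power)
    qed
    show "(-1) ^ card P * (-1) ^ (card P * num_positive \<Gamma>) = (-1 :: rat) ^ (card P * num_positive \<Gamma>')"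
      unfolding inertia by (rule neg_one_power_cancel)
  qed
qed

end

theorem theorem2p3:
  fixes \<Delta> \<Phi> :: "'a::euclidean_space set"
    and \<Gamma> \<Gamma>' :: "'v::finite wgraph"
    and b b' :: "('a ^ 'v) set"
  assumes "root_system \<Delta>" and "normalized \<Delta>" and "simple_system \<Delta> \<Phi>"
    and "weighted_tree \<Gamma>" and "weakly_negative_definite \<Gamma>"
    and "weighted_tree \<Gamma>'" and "weakly_negative_definite \<Gamma>'"
    and "b \<in> labels \<Delta> \<Phi> \<Gamma>" and "b' \<in> labels \<Delta> \<Phi> \<Gamma>'"
    and "neumann_related \<Delta> \<Phi> \<Gamma> \<Gamma>' b b'"
  shows "Zhat \<Delta> \<Phi> \<Gamma> b = Zhat \<Delta> \<Phi> \<Gamma>' b'"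
proof -
  interpret based_move \<Delta> \<Phi> \<Gamma> \<Gamma>'
    using assms by unfold_locales
  consider \<epsilon> v0 v1 v2 where "\<epsilon> \<in> {1, -1}" "neumann1 \<epsilon> v0 v1 v2 \<Gamma> \<Gamma>'"
      "label_corr1 \<Delta> \<Phi> \<epsilon> v0 v1 v2 \<Gamma> \<Gamma>' b b'"
    | \<epsilon> v0 v1 where "\<epsilon> \<in> {1, -1}" "neumann2 \<epsilon> v0 v1 \<Gamma> \<Gamma>'" "label_corr2 \<Delta> \<Phi> \<epsilon> v0 v1 \<Gamma> \<Gamma>' b b'"
    | v0 v1 v2 v12 where "neumann3 v0 v1 v2 v12 \<Gamma> \<Gamma>'" "label_corr3 \<Delta> \<Phi> v0 v1 v2 v12 \<Gamma> \<Gamma>' b b'"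
    using assms(10) unfolding neumann_related_def by blast
  then show ?thesis
  proof cases
    case (1 \<epsilon> v0 v1 v2)
    interpret move1 \<Delta> \<Phi> \<Gamma> \<Gamma>' \<epsilon> v0 v1 v2 using 1(1,2) by unfold_locales
    show ?thesis using 1(3) by (rule Zhat_move)
  next
    case (2 \<epsilon> v0 v1)
    interpret move2 \<Delta> \<Phi> \<Gamma> \<Gamma>' \<epsilon> v0 v1 using 2(1,2) by unfold_locales
    show ?thesis using 2(3) by (rule Zhat_move)
  next
    case (3 v0 v1 v2 v12)
    interpret move3 \<Delta> \<Phi> \<Gamma> \<Gamma>' v0 v1 v2 v12 using 3(1) by unfold_locales
    show ?thesis using 3(2) by (rule Zhat_move)
  qed
qed

end
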